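(* Let $G$ be a connected graph on $n$ vertices $1,2,\ldots,n$ with $n\ge2$. Let $\lambda_1<\mu_1<\lambda_2<\cdots<\mu_{n-1}<\lambda_n$ be $2n-1$ real numbers such that $\lambda_j=-\lambda_{n+1-j}$ for all $j=1,\ldots,n$, and $\mu_k=-\mu_{n-k}$ for all $k=1,\ldots,n-1$. If $G$ has a spanning tree $T$ which is NEB at a vertex $v$, then there exists a skew-symmetric matrix $A\in S^-(G)$ with eigenvalues $\mathrm{i}\lambda_1,\mathrm{i}\lambda_2,\ldots,\mathrm{i}\lambda_n$ such that the eigenvalues of $A(v)$ are $\mathrm{i}\mu_1,\mathrm{i}\mu_2,\ldots,\mathrm{i}\mu_{n-1}$.
   Context: $\mathrm{i}=\sqrt{-1}$. For a real skew-symmetric matrix $A=[a_{i,j}]$ of order $n$, its graph $G(A)$ has vertex set $\{1,\ldots,n\}$ and edge set $\{\{i,j\}: a_{i,j}\ne 0,\ i<j\}$. $S^-(G)$ is the set of all real skew-symmetric matrices whose graph is $G$. $A(v)$ is the principal submatrix of $A$ obtained by deleting row and column $v$. For a vertex $w$ of a tree $T$, $T(w)$ is the forest obtained by deleting $w$; for a neighbor $u$ of $w$, $T_u(w)$ is the connected component of $T(w)$ containing $u$. NEB (nearly even branching; recursive): let $T$ be a tree on $n$ vertices and $w$ a vertex of $T$. If $n=1$, $T$ is NEB at $w$. If $n\ge2$, $T$ is NEB at $w$ if (i) $T(w)$ has exactly one odd component (a connected component with an odd number of vertices) when $n$ is even, and no odd component when $n$ is odd; and (ii) for each neighbor $u$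 of $w$ in $T$, $T_u(w)$ is NEB at $u$. *)

theory Defs
  imports
    "Graph_Theory.Digraph_Component"
    "Jordan_Normal_Form.Char_Poly"
    "Jordan_Normal_Form.Spectral_Radius"
begin

(* Simple graphs are finite symmetric loopfree digraphs without parallel arcs
   (locales graph, pair_graph): an edge {u, v} is the pair of arcs (u, v), (v, u).
   The library's forest and tree regard u, v, u as a cycle, so a symmetric digraph with an
   edge is never a tree in that sense; a cycle of the undirected graph is a directed cycle
   of length at least 3. *)

definition undirected_tree :: "('a, 'b) pre_digraph \<Rightarrow> bool" where
  "undirected_tree T \<longleftrightarrow>
     graph T \<and> Digraph_Component.connected T \<and>
     \<not> (\<exists>p. pre_digraph.cycle T p \<and> 3 \<le> length p)"

definition undirected_spanning_tree ::
    "('a, 'b) pre_digraph \<Rightarrow> ('a, 'b) pre_digraph \<Rightarrow> bool" where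
  "undirected_spanning_tree T G \<longleftrightarrow> undirected_tree T \<and> spanning T G"

(* In a symmetric digraph the strongly connected components are the connected components. *)

definition odd_components :: "('a, 'b) pre_digraph \<Rightarrow> ('a, 'b) pre_digraph set" where
  "odd_components H = {C \<in> pre_digraph.sccs H. odd (card (verts C))}"

(* T_u(w): the component containing u of T with w deleted *)
definition branch :: "('a, 'b) pre_digraph \<Rightarrow> 'a \<Rightarrow> 'a \<Rightarrow> ('a, 'b) pre_digraph" where
  "branch T w u =
     (let H = pre_digraph.del_vert T w in H \<restriction> pre_digraph.scc_of H u)"

(* Nearly even branching. The recursion descends to trees with fewer vertices, so the least
   fixed point is the only solution of the recursive definition. *)
inductive NEB :: "('a, 'b) pre_digraph \<Rightarrow> 'a \<Rightarrow> bool" where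
  single: "NEB T w"
    if "undirected_tree T" and "w \<in> verts T" and "card (verts T) = 1"
| branching: "NEB T w"
    if "undirected_tree T" and "w \<in> verts T" and "2 \<le> card (verts T)"
    and "even (card (verts T)) \<Longrightarrow> card (odd_components (pre_digraph.del_vert T w)) = 1"
    and "odd (card (verts T)) \<Longrightarrow> odd_components (pre_digraph.del_vert T w) = {}"
    and "\<And>u. w \<rightarrow>\<^bsub>T\<^esub> u \<Longrightarrow> NEB (branch T w u) u"

definition skew_symmetric :: "real mat \<Rightarrow> bool" where
  "skew_symmetric A \<longleftrightarrow> square_mat A \<and> transpose_mat A = - A"

(* Matrix indices, and hence vertices, start at 0. For skew-symmetric A the arc set is
   symmetric and irreflexive. *)
definition mat_graph :: "real mat \<Rightarrow> nat pair_pre_digraph" where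
  "mat_graph A =
     \<lparr> pverts = {0..<dim_row A},
       parcs = {(i, j). i < dim_row A \<and> j < dim_row A \<and> A $$ (i, j) \<noteq> 0} \<rparr>"

definition S_minus :: "nat pair_pre_digraph \<Rightarrow> real mat set" where
  "S_minus G = {A. skew_symmetric A \<and> mat_graph A = G}"

definition complex_eigenvalues :: "real mat \<Rightarrow> complex set" where
  "complex_eigenvalues A = spectrum (map_mat complex_of_real A)"

end

theory Submission
  imports "HOL-Analysis.Brouwer_Fixpoint" "HOL-Analysis.Function_Metric" Defs
begin

text \<open>On a tree \<open>T\<close> with root \<open>w\<close>, the quotient of the characteristic polynomials of \<open>A\<close> and
  \<open>A(w)\<close> is \<open>y\<close> minus the sum over the branches \<open>u\<close> of the squared edge weight times the inverse
  quotient of the branch. Prescribing interlacing spectra therefore amounts to distributing the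
  poles of a partial fraction over the branches and recursing; symmetry of the spectra lets one
  work with the squares of the eigenvalues, and nearly even branching says exactly that the
  pole at \<open>0\<close> (present for even order) has a unique odd branch to go to.

  Non-tree edges are added without an inverse function theorem. The tree matrix depends
  continuously on the prescribed spectra, so let these range over a small box around the target
  and give all missing edges one small weight. The characteristic polynomials evaluated at the
  target eigenvalues change sign between opposite faces of the box, hence by the
  Poincare--Miranda theorem (from Kuhn's lemma) they vanish simultaneously somewhere.\<close>

section \<open>Determinants of principal submatrices\<close>

text \<open>The parity condition comes from counting poles in the squared variable: the inverse
  quotient of a branch with m vertices contributes (m + 1) div 2 of them. Together the branches
  absorb half of n - 1 plus the number of odd branches, and this equals the n div 2 poles available
  at the root exactly if there is one odd branch for even n and none for odd n. The edge weights
  arise from choosing zeros of partial fractions and taking square roots, so continuity in the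
  prescribed spectra is what the recursion carries along. It suffices because the unperturbed
  characteristic polynomials factor over the shifted nodes: the sign of such a polynomial at a
  target node is governed by the displacement of that one node, wherever the other nodes are in the
  box. Each equation is thereby paired with one coordinate. Determinant identities are kept in
  product form, since branch determinants vanish at the poles, which are among the points of
  interest.\<close>

definition mask_mat :: "nat \<Rightarrow> nat set \<Rightarrow> (nat \<Rightarrow> nat \<Rightarrow> 'a::comm_ring_1) \<Rightarrow> 'a mat" where
  "mask_mat n V A =
     Matrix.mat n n (\<lambda>(i, j). if i \<in> V \<and> j \<in> V then A i j else if i = j then 1 else 0)"

text \<open>Principal minors are determinants of full \<open>n\<close> by \<open>n\<close> matrices
  padded with the identity outside \<open>V\<close>. Vertex sets of branches thus keep their labels,
  and the recursion involves no renumbering of rows.\<close>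

definition pdet :: "nat \<Rightarrow> nat set \<Rightarrow> (nat \<Rightarrow> nat \<Rightarrow> 'a::comm_ring_1) \<Rightarrow> 'a" where
  "pdet n V A = Determinant.det (mask_mat n V A)"

lemma mask_mat_carrier [simp]: "mask_mat n V A \<in> carrier_mat n n"
  by (simp add: mask_mat_def)

lemma pdet_cong:
  assumes "\<And>i j. i \<in> V \<Longrightarrow> j \<in> V \<Longrightarrow> i < n \<Longrightarrow> j < n \<Longrightarrow> A i j = B i j"
  shows "pdet n V A = pdet n V B"
proof -
  have "mask_mat n V A = mask_mat n V B"
    unfolding mask_mat_def by (rule eq_matI) (use assms in auto)
  then show ?thesis by (simp add: pdet_def)
qed

lemma pdet_empty [simp]: "pdet n {} A = 1"
proof -
  have "mask_mat n {} A = 1\<^sub>m n" unfolding mask_mat_def by (rule eq_matI) auto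
  then show ?thesis by (simp add: pdet_def)
qed

lemma det_row_unit:
  fixes M :: "'a::comm_ring_1 mat"
  assumes M: "M \<in> carrier_mat n n" and w: "w < n"
    and row: "\<And>j. j < n \<Longrightarrow> j \<noteq> w \<Longrightarrow> M $$ (w, j) = 0"
  shows "Determinant.det M = M $$ (w, w) * Determinant.det (mat_delete M w w)"
proof -
  have "Determinant.det M = (\<Sum>j<n. M $$ (w, j) * cofactor M w j)"
    by (rule laplace_expansion_row[OF M w])
  also have "\<dots> = (\<Sum>j<n. if j = w then M $$ (w, w) * cofactor M w w else 0)"
    by (rule sum.cong) (auto simp: row)
  also have "\<dots> = M $$ (w, w) * cofactor M w w" using w by simp
  finally show ?thesis by (simp add: cofactor_def flip: mult_2)
qed

lemma mat_delete_mask: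
  assumes "w < n"
  shows "mat_delete (mask_mat n (V - {w}) A) w w = mat_delete (mask_mat n V A) w w"
  unfolding mat_delete_def mask_mat_def using assms by (intro eq_matI) auto

lemma pdet_remove:
  assumes "w < n"
  shows "pdet n (V - {w}) A = Determinant.det (mat_delete (mask_mat n V A) w w)"
proof -
  have "pdet n (V - {w}) A = mask_mat n (V - {w}) A $$ (w, w)
      * Determinant.det (mat_delete (mask_mat n (V - {w}) A) w w)"
    unfolding pdet_def by (rule det_row_unit) (use assms in \<open>auto simp: mask_mat_def\<close>)
  also have "mask_mat n (V - {w}) A $$ (w, w) = 1" using assms by (simp add: mask_mat_def)
  finally show ?thesis unfolding mat_delete_mask[OF assms] by simp
qed

lemma pdet_isolated_row:
  assumes "w \<in> V" "w < n" and "\<And>j. j \<in> V \<Longrightarrow> j \<noteq> w \<Longrightarrow> A w j = 0"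
  shows "pdet n V A = A w w * pdet n (V - {w}) A"
proof -
  have "pdet n V A = mask_mat n V A $$ (w, w) * Determinant.det (mat_delete (mask_mat n V A) w w)"
    unfolding pdet_def by (rule det_row_unit) (use assms in \<open>auto simp: mask_mat_def\<close>)
  also have "mask_mat n V A $$ (w, w) = A w w" using assms by (simp add: mask_mat_def)
  finally show ?thesis unfolding pdet_remove[OF assms(2)] .
qed

lemma pdet_identity_rows:
  assumes "finite V1" "V1 \<inter> V2 = {}" "V1 \<subseteq> {..<n}"
    and "\<And>i j. i \<in> V1 \<Longrightarrow> j \<in> V1 \<union> V2 \<Longrightarrow> A i j = (if i = j then 1 else 0)"
  shows "pdet n (V1 \<union> V2) A = pdet n V2 A"
  using assms
proof (induction V1 rule: finite_induct)
  case empty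
  then show ?case by simp
next
  case (insert w V1)
  have "pdet n (insert w V1 \<union> V2) A = A w w * pdet n (insert w V1 \<union> V2 - {w}) A"
    by (rule pdet_isolated_row) (use insert.prems in auto)
  also have "insert w V1 \<union> V2 - {w} = V1 \<union> V2" using insert by auto
  also have "pdet n (V1 \<union> V2) A = pdet n V2 A" by (rule insert.IH) (use insert.prems in auto)
  finally show ?case using insert.prems(3)[of w w] by simp
qed

lemma mask_mat_mult_index:
  assumes "i < n" "j < n"
  shows "(mask_mat n V A * mask_mat n W B) $$ (i, j) =
    (\<Sum>k<n. (if i \<in> V \<and> k \<in> V then A i k else if i = k then 1 else 0) *
            (if k \<in> W \<and> j \<in> W then B k j else if k = j then 1 else 0))"
  using assms by (simp add: mask_mat_def scalar_prod_def atLeast0LessThan)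

text \<open>A block lower triangular matrix is the product of diag(A11, I), a unipotent matrix
  carrying the block A21, and diag(I, A22). All factors are masked matrices; \<open>L\<close> is the
  unipotent one.\<close>

lemma pdet_block_triangular:
  assumes disj: "V1 \<inter> V2 = {}" and sub: "V1 \<union> V2 \<subseteq> {..<n}"
    and zero: "\<And>i j. i \<in> V1 \<Longrightarrow> j \<in> V2 \<Longrightarrow> A i j = 0"
  shows "pdet n (V1 \<union> V2) A = pdet n V1 A * pdet n V2 A"
proof -
  define L where "L i j = (if i = j then 1 else if i \<in> V2 \<and> j \<in> V1 then A i j else 0)" for i j
  have fin: "finite V1" "finite V2" using sub finite_subset by auto
  have L1: "pdet n (V1 \<union> V2) L = 1"
  proof -
    have "pdet n (V1 \<union> V2) L = pdet n V2 L"
      by (rule pdet_identity_rows) (use disj sub fin in \<open>auto simp: L_def\<close>)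
    also have "\<dots> = pdet n (V2 \<union> {}) L" by simp
    also have "\<dots> = pdet n {} L"
      by (rule pdet_identity_rows) (use disj sub fin in \<open>auto simp: L_def\<close>)
    finally show ?thesis by simp
  qed
  \<comment> \<open>The product of the first two factors: A11 and A21 in place, the identity on
    \<open>V2\<close>.\<close>
  define B where "B i j = (if i \<in> V2 then (if j \<in> V1 then A i j else if i = j then 1 else 0) else A i j)" for i j
  have e1: "mask_mat n V1 A * mask_mat n (V1 \<union> V2) L = mask_mat n (V1 \<union> V2) B"
  proof (rule eq_matI)
    fix i j assume ij: "i < dim_row (mask_mat n (V1 \<union> V2) B)" "j < dim_col (mask_mat n (V1 \<union> V2) B)"
    then have ij: "i < n" "j < n" by (auto simp: mask_mat_def)
    show "(mask_mat n V1 A * mask_mat n (V1 \<union> V2) L) $$ (i, j) = mask_mat n (V1 \<union> V2) B $$ (i, j)"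
    proof (cases "i \<in> V1")
      case True
      have "(mask_mat n V1 A * mask_mat n (V1 \<union> V2) L) $$ (i, j)
          = (\<Sum>k<n. if k = j then (if j \<in> V1 then A i j else 0) else 0)"
        unfolding mask_mat_mult_index[OF ij]
        by (rule sum.cong[OF refl]) (use True disj in \<open>auto simp: L_def\<close>)
      also have "\<dots> = mask_mat n (V1 \<union> V2) B $$ (i, j)"
        using ij True disj zero by (auto simp: mask_mat_def B_def)
      finally show ?thesis .
    next
      case False
      have "(mask_mat n V1 A * mask_mat n (V1 \<union> V2) L) $$ (i, j)
          = (\<Sum>k<n. if k = i then (if i \<in> V1 \<union> V2 \<and> j \<in> V1 \<union> V2 then L i j else if i = j then 1 else 0) else 0)"
        unfolding mask_mat_mult_index[OF ij]
        by (rule sum.cong[OF refl]) (use False in auto)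
      also have "\<dots> = mask_mat n (V1 \<union> V2) B $$ (i, j)"
        using ij False disj by (auto simp: mask_mat_def B_def L_def)
      finally show ?thesis .
    qed
  qed (auto simp: mask_mat_def)
  have e2: "mask_mat n (V1 \<union> V2) B * mask_mat n V2 A = mask_mat n (V1 \<union> V2) A"
  proof (rule eq_matI)
    fix i j assume ij: "i < dim_row (mask_mat n (V1 \<union> V2) A)" "j < dim_col (mask_mat n (V1 \<union> V2) A)"
    then have ij: "i < n" "j < n" by (auto simp: mask_mat_def)
    show "(mask_mat n (V1 \<union> V2) B * mask_mat n V2 A) $$ (i, j) = mask_mat n (V1 \<union> V2) A $$ (i, j)"
    proof (cases "j \<in> V2")
      case True
      have "(mask_mat n (V1 \<union> V2) B * mask_mat n V2 A) $$ (i, j)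
          = (\<Sum>k<n. if k = i then (if i \<in> V2 then A i j else 0) else 0)"
        unfolding mask_mat_mult_index[OF ij]
        by (rule sum.cong[OF refl]) (use True disj zero in \<open>auto simp: B_def\<close>)
      also have "\<dots> = mask_mat n (V1 \<union> V2) A $$ (i, j)"
        using ij True disj zero by (auto simp: mask_mat_def)
      finally show ?thesis .
    next
      case False
      have "(mask_mat n (V1 \<union> V2) B * mask_mat n V2 A) $$ (i, j)
          = (\<Sum>k<n. if k = j then (if i \<in> V1 \<union> V2 \<and> j \<in> V1 \<union> V2 then B i j else if i = j then 1 else 0) else 0)"
        unfolding mask_mat_mult_index[OF ij]
        by (rule sum.cong[OF refl]) (use False in auto)
      also have "\<dots> = mask_mat n (V1 \<union> V2) A $$ (i, j)"
        using ij False disj by (auto simp: mask_mat_def B_def)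
      finally show ?thesis .
    qed
  qed (auto simp: mask_mat_def)
  have "pdet n (V1 \<union> V2) A = pdet n (V1 \<union> V2) B * pdet n V2 A"
    unfolding pdet_def e2[symmetric] by (rule det_mult[where n = n]) auto
  also have "pdet n (V1 \<union> V2) B = pdet n V1 A * pdet n (V1 \<union> V2) L"
    unfolding pdet_def e1[symmetric] by (rule det_mult[where n = n]) auto
  finally show ?thesis using L1 by simp
qed

lemma pdet_row_linear:
  assumes "w \<in> V" "w < n"
    and "\<And>i j. i \<noteq> w \<Longrightarrow> A i j = C i j" "\<And>i j. i \<noteq> w \<Longrightarrow> B i j = C i j"
    and "\<And>j. C w j = A w j + t * B w j"
  shows "pdet n V C = pdet n V A + t * pdet n V B"
proof -
  let ?M = "mask_mat n V"
  have del: "mat_delete (?M A) w j = mat_delete (?M C) w j"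
            "mat_delete (?M B) w j = mat_delete (?M C) w j" for j
    unfolding mat_delete_def mask_mat_def using assms(2-4)
    by (auto intro!: eq_matI)
  have row: "?M C $$ (w, j) = ?M A $$ (w, j) + t * ?M B $$ (w, j)" if "j < n" "j \<in> V" for j
    using that assms by (simp add: mask_mat_def)
  have row0: "?M D $$ (w, j) = 0" if "j < n" "j \<notin> V" for j and D :: "nat \<Rightarrow> nat \<Rightarrow> 'a"
    using that assms by (auto simp: mask_mat_def)
  have "pdet n V D = (\<Sum>j<n. ?M D $$ (w, j) * cofactor (?M D) w j)" for D :: "nat \<Rightarrow> nat \<Rightarrow> 'a"
    unfolding pdet_def by (rule laplace_expansion_row) (use assms in auto)
  note expand = this
  have cof: "cofactor (?M A) w j = cofactor (?M C) w j" "cofactor (?M B) w j = cofactor (?M C) w j" for j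
    unfolding cofactor_def del by (rule refl)+
  have "pdet n V C = (\<Sum>j<n. (?M A $$ (w, j) + t * ?M B $$ (w, j)) * cofactor (?M C) w j)"
    unfolding expand
  proof (rule sum.cong[OF refl])
    fix j assume "j \<in> {..<n}"
    then have "?M C $$ (w, j) = ?M A $$ (w, j) + t * ?M B $$ (w, j)"
      using row row0 by (cases "j \<in> V") auto
    then show "?M C $$ (w, j) * cofactor (?M C) w j
      = (?M A $$ (w, j) + t * ?M B $$ (w, j)) * cofactor (?M C) w j" by simp
  qed
  also have "\<dots> = pdet n V A + t * pdet n V B"
    unfolding expand cof distrib_right sum.distrib sum_distrib_left by (simp only: mult.assoc)
  finally show ?thesis .
qed

lemma pdet_swapcols:
  assumes "u \<in> V" "w \<in> V" "u < n" "w < n" "u \<noteq> w"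
  shows "pdet n V (\<lambda>i j. A i (if j = u then w else if j = w then u else j)) = - pdet n V A"
proof -
  have "mask_mat n V (\<lambda>i j. A i (if j = u then w else if j = w then u else j))
      = swapcols u w (mask_mat n V A)"
    by (rule eq_matI) (use assms in \<open>auto simp: mask_mat_def\<close>)
  then show ?thesis unfolding pdet_def using assms by (simp add: det_swapcols[where n = n])
qed

text \<open>The blocks are joined by the entries \<open>(w, u)\<close> and \<open>(u, w)\<close>
  only, and a permutation contributing to the determinant uses both or neither. Linearity in row
  \<open>w\<close> separates the two cases without handling permutations.\<close>

lemma pdet_bridge:
  fixes A :: "nat \<Rightarrow> nat \<Rightarrow> 'a::comm_ring_1"
  assumes disj: "V \<inter> U = {}" and sub: "V \<union> U \<subseteq> {..<n}" and w: "w \<in> V" and u: "u \<in> U"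
    and zero: "\<And>i j. i \<in> V \<Longrightarrow> j \<in> U \<Longrightarrow> (i, j) \<noteq> (w, u) \<Longrightarrow> A i j = 0"
      "\<And>i j. i \<in> V \<Longrightarrow> j \<in> U \<Longrightarrow> (i, j) \<noteq> (w, u) \<Longrightarrow> A j i = 0"
  shows "pdet n (V \<union> U) A = pdet n V A * pdet n U A
           - A w u * A u w * (pdet n (V - {w}) A * pdet n (U - {u}) A)"
proof -
  have wu: "w \<noteq> u" "w < n" "u < n" "w \<notin> U" "u \<notin> V" using disj sub w u by auto
  define A0 where "A0 i j = (if i = w \<and> j = u then 0 else A i j)" for i j
  define A1 where "A1 i j = (if i = w then if j = u then 1 else 0 else A i j)" for i j
  \<comment> \<open>\<open>A0\<close> drops the entry \<open>(w, u)\<close> and becomes block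
    triangular; \<open>A1\<close> reduces row \<open>w\<close> to that entry, scaled to 1.\<close>
  have "pdet n (V \<union> U) A = pdet n (V \<union> U) A0 + A w u * pdet n (V \<union> U) A1"
    by (rule pdet_row_linear) (use w wu in \<open>auto simp: A0_def A1_def\<close>)
  also have "pdet n (V \<union> U) A0 = pdet n V A0 * pdet n U A0"
    by (rule pdet_block_triangular) (use disj sub zero in \<open>auto simp: A0_def\<close>)
  also have "pdet n V A0 = pdet n V A" by (rule pdet_cong) (use wu in \<open>auto simp: A0_def\<close>)
  also have "pdet n U A0 = pdet n U A" by (rule pdet_cong) (use wu in \<open>auto simp: A0_def\<close>)
  also have "pdet n (V \<union> U) A1 = - (A u w * (pdet n (V - {w}) A * pdet n (U - {u}) A))"
  proof -
    \<comment> \<open>Swapping the columns \<open>u\<close> and \<open>w\<close> brings the unit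
      entry of row \<open>w\<close> and the entry \<open>A u w\<close> to the diagonal, where rows
      \<open>w\<close> and \<open>u\<close> can be split off.\<close>
    define B where "B i j = A1 i (if j = u then w else if j = w then u else j)" for i j
    have "pdet n (V \<union> U) B = - pdet n (V \<union> U) A1"
      unfolding B_def by (rule pdet_swapcols) (use w u wu in auto)
    moreover have "pdet n (V \<union> U) B = B w w * pdet n (V \<union> U - {w}) B"
      by (rule pdet_isolated_row) (use w u wu in \<open>auto simp: B_def A1_def\<close>)
    moreover have "V \<union> U - {w} = (U - {u}) \<union> insert u (V - {w})" using w u wu by auto
    moreover have "pdet n ((U - {u}) \<union> insert u (V - {w})) B
        = pdet n (U - {u}) B * pdet n (insert u (V - {w})) B"
      by (rule pdet_block_triangular) (use w u wu disj sub zero in \<open>auto simp: B_def A1_def\<close>)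
    moreover have "pdet n (U - {u}) B = pdet n (U - {u}) A"
      by (rule pdet_cong) (use wu in \<open>auto simp: B_def A1_def\<close>)
    moreover have "pdet n (insert u (V - {w})) B = B u u * pdet n (insert u (V - {w}) - {u}) B"
      by (rule pdet_isolated_row) (use w u wu zero in \<open>auto simp: B_def A1_def\<close>)
    moreover have "insert u (V - {w}) - {u} = V - {w}" using wu by auto
    moreover have "pdet n (V - {w}) B = pdet n (V - {w}) A"
      by (rule pdet_cong) (use wu in \<open>auto simp: B_def A1_def\<close>)
    moreover have "B w w = 1" "B u u = A u w" using wu by (auto simp: B_def A1_def)
    ultimately have "- pdet n (V \<union> U) A1 = A u w * (pdet n (V - {w}) A * pdet n (U - {u}) A)"
      by (simp only: mult_1 mult.assoc mult.commute mult.left_commute)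
    then show ?thesis by (simp only: minus_equation_iff[of "pdet n (V \<union> U) A1"])
  qed
  finally show ?thesis by (simp add: algebra_simps)
qed

lemma pdet_disjoint_blocks:
  assumes "finite N" "\<And>u u'. u \<in> N \<Longrightarrow> u' \<in> N \<Longrightarrow> u \<noteq> u' \<Longrightarrow> W u \<inter> W u' = {}"
    and "\<And>u. u \<in> N \<Longrightarrow> W u \<subseteq> {..<n}"
    and "\<And>u u' i j. u \<in> N \<Longrightarrow> u' \<in> N \<Longrightarrow> u \<noteq> u' \<Longrightarrow> i \<in> W u \<Longrightarrow> j \<in> W u' \<Longrightarrow> A i j = 0"
  shows "pdet n (\<Union>u\<in>N. W u) A = (\<Prod>u\<in>N. pdet n (W u) A)"
  using assms
proof (induction N rule: finite_induct)
  case (insert v N)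
  have "pdet n (W v \<union> (\<Union>u\<in>N. W u)) A = pdet n (W v) A * pdet n (\<Union>u\<in>N. W u) A"
  proof (rule pdet_block_triangular)
    have "W v \<inter> W u = {}" if "u \<in> N" for u
      using insert.prems(1)[of v u] insert.hyps(2) that by auto
    then show "W v \<inter> (\<Union>u\<in>N. W u) = {}" by auto
    show "W v \<union> (\<Union>u\<in>N. W u) \<subseteq> {..<n}" using insert.prems(2) by auto
    fix i j assume i: "i \<in> W v" and "j \<in> (\<Union>u\<in>N. W u)"
    then obtain u where "u \<in> N" "j \<in> W u" by blast
    then show "A i j = 0" using insert.prems(3)[of v u i j] insert.hyps(2) i by auto
  qed
  also have "pdet n (\<Union>u\<in>N. W u) A = (\<Prod>u\<in>N. pdet n (W u) A)"
    using insert.prems by (intro insert.IH) (simp; fail | meson insertI2)+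
  finally show ?case using insert.hyps by simp
qed simp

text \<open>Branches are attached to \<open>w\<close> one at a time by \<open>pdet_bridge\<close>.
  Divided by the product of the branch determinants, this is the Schur complement at
  \<open>w\<close>; the product form also holds where branch determinants vanish.\<close>

lemma pdet_star:
  fixes A :: "nat \<Rightarrow> nat \<Rightarrow> 'a::comm_ring_1"
  assumes fin: "finite N" and w: "w < n"
    and W: "\<And>u. u \<in> N \<Longrightarrow> u \<in> W u \<and> w \<notin> W u \<and> W u \<subseteq> {..<n}"
    and disj: "\<And>u u'. u \<in> N \<Longrightarrow> u' \<in> N \<Longrightarrow> u \<noteq> u' \<Longrightarrow> W u \<inter> W u' = {}"
    and cross: "\<And>u u' i j. u \<in> N \<Longrightarrow> u' \<in> N \<Longrightarrow> u \<noteq> u' \<Longrightarrow> i \<in> W u \<Longrightarrow> j \<in> W u' \<Longrightarrow> A i j = 0"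
    and root: "\<And>u i. u \<in> N \<Longrightarrow> i \<in> W u \<Longrightarrow> i \<noteq> u \<Longrightarrow> A w i = 0 \<and> A i w = 0"
  shows "pdet n (insert w (\<Union>u\<in>N. W u)) A = A w w * (\<Prod>u\<in>N. pdet n (W u) A)
    - (\<Sum>u\<in>N. A w u * A u w * (pdet n (W u - {u}) A * (\<Prod>x\<in>N - {u}. pdet n (W x) A)))"
  using assms
proof (induction N rule: finite_induct)
  case empty
  have "pdet n {w} A = A w w * pdet n ({w} - {w}) A"
    by (rule pdet_isolated_row) (use empty in auto)
  then show ?case by simp
next
  case (insert v N)
  let ?V = "insert w (\<Union>u\<in>N. W u)"
  have IH: "pdet n ?V A = A w w * (\<Prod>u\<in>N. pdet n (W u) A)
    - (\<Sum>u\<in>N. A w u * A u w * (pdet n (W u - {u}) A * (\<Prod>x\<in>N - {u}. pdet n (W x) A)))"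
    using insert.prems by (intro insert.IH) (simp; fail | meson insertI2)+
  have v: "v \<in> W v" "w \<notin> W v" "W v \<subseteq> {..<n}" using insert.prems(2)[of v] by auto
  have dv: "W u \<inter> W v = {}" if "u \<in> N" for u
    using insert.prems(3)[of u v] that insert.hyps by auto
  have zv: "A i j = 0 \<and> A j i = 0" if "u \<in> N" "i \<in> W u" "j \<in> W v" for u i j
    using insert.prems(4)[of u v i j] insert.prems(4)[of v u j i] that insert.hyps by auto
  have "pdet n (?V \<union> W v) A = pdet n ?V A * pdet n (W v) A
           - A w v * A v w * (pdet n (?V - {w}) A * pdet n (W v - {v}) A)"
  proof (rule pdet_bridge)
    show "?V \<inter> W v = {}" using v dv by blast
    show "?V \<union> W v \<subseteq> {..<n}" using v insert.prems by auto
    show "w \<in> ?V" "v \<in> W v" using v by auto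
    fix i j assume *: "i \<in> ?V" "j \<in> W v" "(i, j) \<noteq> (w, v)"
    then show "A i j = 0" "A j i = 0" using zv insert.prems(5)[of v j] by (cases "i = w"; auto)+
  qed
  also have "?V - {w} = (\<Union>u\<in>N. W u)" using insert.prems(2) by auto
  also have "pdet n (\<Union>u\<in>N. W u) A = (\<Prod>u\<in>N. pdet n (W u) A)"
    using insert.hyps insert.prems by (intro pdet_disjoint_blocks) (simp; fail | meson insertI2)+
  finally have e: "pdet n (?V \<union> W v) A = pdet n ?V A * pdet n (W v) A
     - A w v * A v w * ((\<Prod>u\<in>N. pdet n (W u) A) * pdet n (W v - {v}) A)" .
  have s: "(\<Sum>u\<in>N. A w u * A u w * (pdet n (W u - {u}) A * (\<Prod>x\<in>insert v N - {u}. pdet n (W x) A)))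
    = (\<Sum>u\<in>N. A w u * A u w * (pdet n (W u - {u}) A * (\<Prod>x\<in>N - {u}. pdet n (W x) A))) * pdet n (W v) A"
    unfolding sum_distrib_right
  proof (rule sum.cong[OF refl])
    fix u assume "u \<in> N"
    then have "insert v N - {u} = insert v (N - {u})" "v \<notin> N - {u}" using insert.hyps by auto
    then have "(\<Prod>x\<in>insert v N - {u}. pdet n (W x) A) = pdet n (W v) A * (\<Prod>x\<in>N - {u}. pdet n (W x) A)"
      using insert.hyps by simp
    then show "A w u * A u w * (pdet n (W u - {u}) A * (\<Prod>x\<in>insert v N - {u}. pdet n (W x) A))
      = A w u * A u w * (pdet n (W u - {u}) A * (\<Prod>x\<in>N - {u}. pdet n (W x) A)) * pdet n (W v) A"
      by (simp add: algebra_simps)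
  qed
  have d: "insert v N - {v} = N" using insert.hyps by auto
  have i: "insert w (\<Union>u\<in>insert v N. W u) = ?V \<union> W v" by auto
  show ?case
    unfolding i e sum.insert[OF insert.hyps] prod.insert[OF insert.hyps] s d IH
    by (simp add: algebra_simps)
qed

section \<open>Continuity of determinants in a parameter\<close>

lemma continuous_on_det:
  fixes M :: "'s::topological_space \<Rightarrow> 'a::{real_normed_field} mat"
  assumes "\<And>s. M s \<in> carrier_mat n n"
    and "\<And>i j. i < n \<Longrightarrow> j < n \<Longrightarrow> continuous_on S (\<lambda>s. M s $$ (i, j))"
  shows "continuous_on S (\<lambda>s. Determinant.det (M s))"
proof -
  have "(\<lambda>s. Determinant.det (M s)) =
     (\<lambda>s. \<Sum>p | p permutes {0..<n}. signof p * (\<Prod>i = 0..<n. M s $$ (i, p i)))"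
    using assms(1) by (auto simp: det_def')
  moreover have "continuous_on S \<dots>"
    by (intro continuous_intros assms(2)) (auto dest: permutes_in_image)
  ultimately show ?thesis by (simp only:)
qed

lemma continuous_on_pdet:
  fixes A :: "nat \<Rightarrow> nat \<Rightarrow> 's::topological_space \<Rightarrow> 'a::{real_normed_field}"
  assumes "\<And>i j. continuous_on S (A i j)"
  shows "continuous_on S (\<lambda>s. pdet n V (\<lambda>i j. A i j s))"
  unfolding pdet_def
proof (rule continuous_on_det)
  fix i j assume "i < n" "j < n"
  then show "continuous_on S (\<lambda>s. mask_mat n V (\<lambda>i j. A i j s) $$ (i, j))"
    using assms by (cases "i \<in> V \<and> j \<in> V") (auto simp: mask_mat_def)
qed auto

section \<open>Interlacing and partial fractions\<close>

text \<open>Both sides are monic of degree \<open>h\<close> in \<open>z\<close>, because the sum has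
  degree below \<open>h\<close>; their difference is therefore determined by its values at
  \<open>h\<close> distinct points.\<close>

lemma monic_interpolation:
  fixes \<alpha> \<beta> d x :: "nat \<Rightarrow> real"
  assumes inj: "inj_on x {..<h}"
    and eq: "\<And>k. k < h \<Longrightarrow> (\<Prod>j<h. x k - \<alpha> j)
      = (\<Prod>j<h. x k - \<beta> j) + (\<Sum>i<h. d i * (\<Prod>j\<in>{..<h} - {i}. x k - \<beta> j))"
  shows "(\<Prod>j<h. z - \<alpha> j) = (\<Prod>j<h. z - \<beta> j) + (\<Sum>i<h. d i * (\<Prod>j\<in>{..<h} - {i}. z - \<beta> j))"
proof -
  define p where "p = (\<Prod>j<h. [:- \<alpha> j, 1:])"
  define q where "q = (\<Prod>j<h. [:- \<beta> j, 1:])"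
  define r where "r = (\<Sum>i<h. Polynomial.smult (d i) (\<Prod>j\<in>{..<h} - {i}. [:- \<beta> j, 1:]))"
  have deg: "degree (\<Prod>j\<in>A. [:- f j, 1:]) = card A" for A and f :: "nat \<Rightarrow> real"
    by (subst degree_prod_sum_eq) auto
  have lead: "coeff (\<Prod>j\<in>A. [:- f j, 1:]) (card A) = 1" for A and f :: "nat \<Rightarrow> real"
    using lead_coeff_prod[of "\<lambda>j. [:- f j, 1:]" A] by (simp add: deg)
  have "coeff r h = 0"
    unfolding r_def coeff_sum
    by (rule sum.neutral) (auto simp: deg intro!: coeff_eq_0)
  moreover have "coeff p h = 1" "coeff q h = 1"
    using lead[of \<alpha> "{..<h}"] lead[of \<beta> "{..<h}"] by (simp_all add: p_def q_def)
  ultimately have c: "coeff p h = coeff (q + r) h" by simp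
  have "degree r \<le> h"
    unfolding r_def
    by (rule degree_sum_le) (auto intro!: order_trans[OF degree_smult_le] simp: deg)
  then have dq: "degree (q + r) \<le> h"
    by (intro degree_add_le) (auto simp: q_def deg)
  have "p = q + r"
  proof (rule poly_eqI_degree_lead_coeff[OF c _ _ dq])
    show "h \<le> card (x ` {..<h})" using inj by (simp add: card_image)
    show "degree p \<le> h" by (simp add: p_def deg)
    show "poly p z = poly (q + r) z" if "z \<in> x ` {..<h}" for z
      using that eq by (auto simp: p_def q_def r_def poly_prod poly_sum)
  qed
  then have "poly p z = poly (q + r) z" by simp
  then show ?thesis by (simp add: p_def q_def r_def poly_prod poly_sum)
qed

text \<open>In the application \<open>a\<close> holds squared imaginary parts of eigenvalues of the
  matrix with its root deleted, \<open>b\<close> those of the full matrix. The chain starts with an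
  \<open>a\<close> because the zero eigenvalue of a full matrix of odd order is left out.\<close>

definition interlacing :: "nat \<Rightarrow> (nat \<Rightarrow> real) \<Rightarrow> (nat \<Rightarrow> real) \<Rightarrow> bool" where
  "interlacing h a b \<longleftrightarrow> (\<forall>k<h. a k < b k) \<and> (\<forall>k. Suc k < h \<longrightarrow> b k < a (Suc k))"

lemma interlacing_less:
  assumes "interlacing h a b" "j < k" "k < h"
  shows "b j < a k"
  using assms(2,3)
proof (induction k)
  case (Suc k)
  have "b k < a (Suc k)" "a k < b k" using assms(1) Suc.prems by (auto simp: interlacing_def)
  then show ?case using Suc by (cases "j = k") auto
qed simp

lemma interlacing_strict:
  assumes "interlacing h a b" "j < k" "k < h"
  shows "a j < a k" "b j < b k"
proof -
  have "a j < b j" "a k < b k" using assms by (auto simp: interlacing_def)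
  with interlacing_less[OF assms] show "a j < a k" "b j < b k" by linarith+
qed

lemma interlacing_inj_on:
  assumes "interlacing h a b"
  shows "inj_on a {..<h}" "inj_on b {..<h}"
  unfolding inj_on_def using interlacing_strict[OF assms]
  by (metis lessThan_iff less_irrefl linorder_neqE_nat)+

text \<open>Minus the residue at \<open>a k\<close> of the product of all
  \<open>(z - b j) / (z - a j)\<close>.\<close>

definition pf_weight :: "nat \<Rightarrow> (nat \<Rightarrow> real) \<Rightarrow> (nat \<Rightarrow> real) \<Rightarrow> nat \<Rightarrow> real" where
  "pf_weight h a b k = (b k - a k) * (\<Prod>j\<in>{..<h} - {k}. (a k - b j) / (a k - a j))"

text \<open>Interlacing puts \<open>a j\<close> and \<open>b j\<close> on the same side of
  \<open>a k\<close> whenever \<open>j \<noteq> k\<close>, so every factor is positive.\<close>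

lemma pf_weight_pos:
  assumes I: "interlacing h a b" and k: "k < h"
  shows "0 < pf_weight h a b k"
  unfolding pf_weight_def
proof (intro mult_pos_pos prod_pos)
  show "0 < b k - a k" using I k by (simp add: interlacing_def)
  fix j assume "j \<in> {..<h} - {k}"
  then have j: "j < h" "j \<noteq> k" by auto
  have jj: "a j < b j" using I j by (simp add: interlacing_def)
  show "0 < (a k - b j) / (a k - a j)"
  proof (cases "j < k")
    case True
    then show ?thesis
      using interlacing_less[OF I True k] interlacing_strict(1)[OF I True k] by simp
  next
    case False
    then have "a k < a j" using interlacing_strict(1)[OF I _ j(1), of k] j by auto
    then show ?thesis using jj by (intro divide_neg_neg) auto
  qed
qed

text \<open>The partial fraction decomposition, cleared of denominators. By
  \<open>monic_interpolation\<close> it is enough to compare values at the poles, where a single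
  summand survives.\<close>

lemma pf_weight_expansion:
  assumes I: "interlacing h a b"
  shows "(\<Prod>k<h. z - b k)
    = (\<Prod>k<h. z - a k) - (\<Sum>k<h. pf_weight h a b k * (\<Prod>j\<in>{..<h} - {k}. z - a j))"
proof -
  have "(\<Prod>j<h. z - b j)
    = (\<Prod>j<h. z - a j) + (\<Sum>i<h. - pf_weight h a b i * (\<Prod>j\<in>{..<h} - {i}. z - a j))"
  proof (rule monic_interpolation[OF interlacing_inj_on(1)[OF I]])
    fix k assume k: "k < h"
    have ne: "a k - a j \<noteq> 0" if "j \<in> {..<h} - {k}" for j
      using inj_onD[OF interlacing_inj_on(1)[OF I], of k j] that k by auto
    have "(\<Sum>i<h. - pf_weight h a b i * (\<Prod>j\<in>{..<h} - {i}. a k - a j))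
      = (\<Sum>i<h. if i = k then - pf_weight h a b k * (\<Prod>j\<in>{..<h} - {k}. a k - a j) else 0)"
    proof (rule sum.cong[OF refl])
      fix i assume "i \<in> {..<h}"
      show "- pf_weight h a b i * (\<Prod>j\<in>{..<h} - {i}. a k - a j)
        = (if i = k then - pf_weight h a b k * (\<Prod>j\<in>{..<h} - {k}. a k - a j) else 0)"
      proof (cases "i = k")
        case False
        have "(\<Prod>j\<in>{..<h} - {i}. a k - a j) = 0"
          by (rule prod_zero) (use k False in auto)
        then show ?thesis using False by simp
      qed simp
    qed
    also have "\<dots> = - pf_weight h a b k * (\<Prod>j\<in>{..<h} - {k}. a k - a j)" using k by simp
    also have "\<dots> = (a k - b k) * ((\<Prod>j\<in>{..<h} - {k}. (a k - b j) / (a k - a j)) * (\<Prod>j\<in>{..<h} - {k}. a k - a j))"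
      by (simp add: pf_weight_def algebra_simps)
    also have "(\<Prod>j\<in>{..<h} - {k}. (a k - b j) / (a k - a j)) * (\<Prod>j\<in>{..<h} - {k}. a k - a j)
      = (\<Prod>j\<in>{..<h} - {k}. a k - b j)"
      unfolding prod.distrib[symmetric] by (rule prod.cong) (use ne in auto)
    also have "(a k - b k) * \<dots> = (\<Prod>j<h. a k - b j)"
      using k by (subst prod.remove[of _ k]) auto
    finally show "(\<Prod>j<h. a k - b j)
      = (\<Prod>j<h. a k - a j) + (\<Sum>i<h. - pf_weight h a b i * (\<Prod>j\<in>{..<h} - {i}. a k - a j))"
      using prod_zero[of "{..<h}" "\<lambda>j. a k - a j"] k by auto
  qed
  then show ?thesis by (simp add: sum_negf)
qed

section \<open>Continuous dependence of residues and zeros on the nodes\<close>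

lemma continuous_on_pf_weight:
  fixes a b :: "nat \<Rightarrow> 's::topological_space \<Rightarrow> real"
  assumes "\<And>k. k < h \<Longrightarrow> continuous_on S (a k)" "\<And>k. k < h \<Longrightarrow> continuous_on S (b k)"
    and I: "\<And>s. s \<in> S \<Longrightarrow> interlacing h (\<lambda>k. a k s) (\<lambda>k. b k s)" and k: "k < h"
  shows "continuous_on S (\<lambda>s. pf_weight h (\<lambda>k. a k s) (\<lambda>k. b k s) k)"
  unfolding pf_weight_def
proof (intro continuous_intros)
  fix j assume j: "j \<in> {..<h} - {k}"
  show "\<forall>s\<in>S. a k s - a j s \<noteq> 0"
    using inj_onD[OF interlacing_inj_on(1)[OF I], of _ k j] j k by auto
qed (use assms in auto)

text \<open>At a fixed \<open>z\<close> on either side of the root, the strict sign of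
  \<open>F s z\<close> persists for nearby parameters and so traps the nearby roots. The moving
  bounds keep \<open>z\<close> inside an interval free of poles.\<close>

lemma continuous_on_root:
  fixes F :: "'s::topological_space \<Rightarrow> real \<Rightarrow> real"
  assumes lo: "continuous_on S lo" and hi: "continuous_on S hi"
    and a: "\<And>s. s \<in> S \<Longrightarrow> lo s < a s \<and> a s < hi s"
    and F: "\<And>s z. s \<in> S \<Longrightarrow> lo s < z \<Longrightarrow> z < hi s \<Longrightarrow> (0 < F s z \<longleftrightarrow> z < a s) \<and> (F s z < 0 \<longleftrightarrow> a s < z)"
    and cF: "\<And>s z. s \<in> S \<Longrightarrow> lo s < z \<Longrightarrow> z < hi s \<Longrightarrow> ((\<lambda>s. F s z) \<longlongrightarrow> F s z) (at s within S)"
  shows "continuous_on S a"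
  unfolding continuous_on_def
proof
  fix s assume s: "s \<in> S"
  have tl: "(lo \<longlongrightarrow> lo s) (at s within S)" "(hi \<longlongrightarrow> hi s) (at s within S)"
    using lo hi s by (auto simp: continuous_on_def)
  have inS: "eventually (\<lambda>t. t \<in> S) (at s within S)"
    by (simp add: eventually_at_filter)
  show "(a \<longlongrightarrow> a s) (at s within S)"
  proof (rule order_tendstoI)
    fix x assume "x < a s"
    then have "max x (lo s) < a s" using a[OF s] by simp
    then obtain z where z: "max x (lo s) < z" "z < a s" using dense by blast
    then have zz: "lo s < z" "z < hi s" using a[OF s] by auto
    then have "0 < F s z" using F[OF s zz] z by simp
    show "eventually (\<lambda>t. x < a t) (at s within S)"
      using order_tendstoD(2)[OF tl(1) zz(1)] order_tendstoD(1)[OF tl(2) zz(2)] inS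
        order_tendstoD(1)[OF cF[OF s zz] \<open>0 < F s z\<close>]
      by eventually_elim (use F z in fastforce)
  next
    fix x assume "a s < x"
    then have "a s < min x (hi s)" using a[OF s] by simp
    then obtain z where z: "z < min x (hi s)" "a s < z" using dense by blast
    then have zz: "lo s < z" "z < hi s" using a[OF s] by auto
    then have "F s z < 0" using F[OF s zz] z by simp
    show "eventually (\<lambda>t. a t < x) (at s within S)"
      using order_tendstoD(2)[OF tl(1) zz(1)] order_tendstoD(1)[OF tl(2) zz(2)] inS
        order_tendstoD(2)[OF cF[OF s zz] \<open>F s z < 0\<close>]
      by eventually_elim (use F z in fastforce)
  qed
qed

lemma IVT_opposite_signs:
  fixes f :: "real \<Rightarrow> real"
  assumes "x < y" "f x * f y < 0" "continuous_on {x..y} f"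
  obtains z where "x < z" "z < y" "f z = 0"
proof -
  have "\<exists>z. x \<le> z \<and> z \<le> y \<and> f z = 0"
    using assms IVT'[of f x 0 y] IVT2'[of f y 0 x] by (auto simp: mult_less_0_iff)
  then obtain z where "x \<le> z" "z \<le> y" "f z = 0" by blast
  moreover from this have "z \<noteq> x" "z \<noteq> y" using assms(2) by auto
  ultimately show ?thesis using that by force
qed

lemma prod_eq_prod_mult_sum:
  fixes b d :: "nat \<Rightarrow> real"
  assumes "\<And>k. k < h \<Longrightarrow> z \<noteq> b k"
  shows "(\<Prod>k<h. z - b k) + (\<Sum>i<h. d i * (\<Prod>j\<in>{..<h} - {i}. z - b j))
    = (\<Prod>k<h. z - b k) * (1 + (\<Sum>k<h. d k / (z - b k)))"
proof -
  have "d i * (\<Prod>j\<in>{..<h} - {i}. z - b j) = (\<Prod>k<h. z - b k) * (d i / (z - b i))" if "i < h" for i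
    using that assms[OF that] by (subst prod.remove[of "{..<h}" i]) auto
  then show ?thesis by (simp add: algebra_simps sum_distrib_left)
qed

text \<open>Clearing denominators gives a polynomial with opposite signs at consecutive
  \<open>b\<close>s. For the leftmost root, let D be the sum of the \<open>d i\<close>: the bound
  lies at distance at least D + 1 from every \<open>b i\<close>, so the sum of fractions is at least
  -D / (D + 1) there and cannot reach -1.\<close>

lemma interlacing_roots_exist:
  fixes b d :: "nat \<Rightarrow> real"
  assumes b: "\<And>j k. j < k \<Longrightarrow> k < h \<Longrightarrow> b j < b k" and d: "\<And>k. k < h \<Longrightarrow> 0 < d k"
    and k: "k < h"
  defines "lo \<equiv> if k = 0 then b 0 - (\<Sum>i<h. d i) - 1 else b (k - 1)"
  shows "\<exists>a. lo < a \<and> a < b k \<and> 1 + (\<Sum>i<h. d i / (a - b i)) = 0"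
proof -
  define G where "G z = (\<Prod>k<h. z - b k) + (\<Sum>i<h. d i * (\<Prod>j\<in>{..<h} - {i}. z - b j))" for z
  have Gb: "G (b k) = d k * (\<Prod>j\<in>{..<h} - {k}. b k - b j)" if "k < h" for k
  proof -
    have "(\<Sum>i<h. d i * (\<Prod>j\<in>{..<h} - {i}. b k - b j))
      = (\<Sum>i<h. if i = k then d k * (\<Prod>j\<in>{..<h} - {k}. b k - b j) else 0)"
    proof (rule sum.cong[OF refl])
      fix i assume "i \<in> {..<h}"
      show "d i * (\<Prod>j\<in>{..<h} - {i}. b k - b j)
        = (if i = k then d k * (\<Prod>j\<in>{..<h} - {k}. b k - b j) else 0)"
      proof (cases "i = k")
        case False
        have "(\<Prod>j\<in>{..<h} - {i}. b k - b j) = 0"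
          by (rule prod_zero) (use that False in auto)
        then show ?thesis using False by simp
      qed simp
    qed
    moreover have "(\<Prod>j<h. b k - b j) = 0" by (rule prod_zero) (use that in auto)
    ultimately show ?thesis using that by (simp add: G_def)
  qed
  have bk: "b j < b k" if "j < k" for j using b[OF that k] .
  have kb: "b k < b j" if "k < j" "j < h" for j using b[OF that] .
  have lob: "lo < b k"
  proof (cases "k = 0")
    case True
    have "0 \<le> (\<Sum>i<h. d i)" by (rule sum_nonneg) (use d less_imp_le in blast)
    then show ?thesis using True by (simp add: lo_def)
  qed (use bk in \<open>auto simp: lo_def\<close>)
  \<comment> \<open>In the product of the two values, matching factors by \<open>j\<close> leaves
    the single negative factor \<open>lo - b k\<close>; in every other pair both differences have
    the same sign.\<close>
  have "G lo * G (b k) < 0"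
  proof (cases "k = 0")
    case True
    have lo: "lo < b j" if "j < h" for j
      using lob kb[of j] that True by (cases "j = 0") auto
    have "- 1 < (\<Sum>i<h. d i / (lo - b i))"
    proof -
      let ?D = "\<Sum>i<h. d i"
      have D: "0 \<le> ?D" by (rule sum_nonneg) (use d less_imp_le in blast)
      have "- 1 < - (?D / (?D + 1))" using D by (simp add: field_simps)
      also have "\<dots> = (\<Sum>i<h. - (d i / (?D + 1)))"
        by (simp add: sum_divide_distrib sum_negf)
      also have "\<dots> \<le> (\<Sum>i<h. d i / (lo - b i))"
      proof (rule sum_mono)
        fix i assume "i \<in> {..<h}"
        then have i: "i < h" by simp
        have "b 0 \<le> b i" using b[of 0 i] i by (cases "i = 0") auto
        then have "?D + 1 \<le> b i - lo" using True by (simp add: lo_def)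
        then have "d i / (b i - lo) \<le> d i / (?D + 1)"
          using d[OF i] D by (intro divide_left_mono) auto
        moreover have "d i / (lo - b i) = - (d i / (b i - lo))"
          by (metis minus_diff_eq divide_minus_right)
        ultimately show "- (d i / (?D + 1)) \<le> d i / (lo - b i)" by simp
      qed
      finally show ?thesis .
    qed
    then have r: "0 < 1 + (\<Sum>i<h. d i / (lo - b i))" by simp
    have "G lo = (\<Prod>k<h. lo - b k) * (1 + (\<Sum>i<h. d i / (lo - b i)))"
      unfolding G_def by (rule prod_eq_prod_mult_sum) (use lo in force)
    also have "(\<Prod>k<h. lo - b k) = (lo - b k) * (\<Prod>j\<in>{..<h} - {k}. lo - b j)"
      using k by (subst prod.remove[of _ k]) auto
    finally have "G lo * G (b k) = (lo - b k) * ((1 + (\<Sum>i<h. d i / (lo - b i))) * d k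
        * (\<Prod>j\<in>{..<h} - {k}. (lo - b j) * (b k - b j)))"
      unfolding Gb[OF k] prod.distrib by (simp only: mult.assoc mult.commute mult.left_commute)
    moreover have "0 < (\<Prod>j\<in>{..<h} - {k}. (lo - b j) * (b k - b j))"
      by (rule prod_pos) (use lo kb True in \<open>auto intro!: mult_neg_neg\<close>)
    ultimately show ?thesis
      using r d[OF k] lob by (simp add: mult_neg_pos)
  next
    case False
    then obtain l where l: "k = Suc l" by (cases k) auto
    then have lh: "l < h" using k by simp
    have lo: "lo = b l" using l by (simp add: lo_def)
    have e: "(\<Prod>j\<in>{..<h} - {l}. b l - b j) = (b l - b k) * (\<Prod>j\<in>{..<h} - {l} - {k}. b l - b j)"
      "(\<Prod>j\<in>{..<h} - {k}. b k - b j) = (b k - b l) * (\<Prod>j\<in>{..<h} - {k} - {l}. b k - b j)"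
      using k lh l by (subst prod.remove; simp)+
    have e2: "{..<h} - {k} - {l} = {..<h} - {l} - {k}" by auto
    have "G lo * G (b k) = (b l - b k) * (d l * d k * (b k - b l)
        * (\<Prod>j\<in>{..<h} - {l} - {k}. (b l - b j) * (b k - b j)))"
      unfolding lo Gb[OF k] Gb[OF lh] e e2 prod.distrib
      by (simp only: mult.assoc mult.commute mult.left_commute)
    moreover have "0 < (\<Prod>j\<in>{..<h} - {l} - {k}. (b l - b j) * (b k - b j))"
    proof (rule prod_pos)
      fix j assume j: "j \<in> {..<h} - {l} - {k}"
      show "0 < (b l - b j) * (b k - b j)"
      proof (cases "j < l")
        case True
        then show ?thesis using bk b[OF True lh] l by simp
      next
        case False
        then show ?thesis using kb[of j] b[of l j] j l by (auto intro!: mult_neg_neg)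
      qed
    qed
    ultimately show ?thesis
      using d[OF k] d[OF lh] bk[of l] l by (simp add: mult_neg_pos)
  qed
  moreover have "continuous_on {lo..b k} G"
    unfolding G_def by (intro continuous_intros)
  ultimately obtain a where a: "lo < a" "a < b k" "G a = 0"
    using IVT_opposite_signs[OF lob, of G] by metis
  have ne: "a \<noteq> b j" if "j < h" for j
  proof (cases "j < k")
    case True
    then have "b j \<le> lo" using b[of j "k - 1"] k
      by (cases "j = k - 1") (auto simp: lo_def intro!: less_imp_le)
    then show ?thesis using a by auto
  next
    case False
    then show ?thesis using a kb[of j] that by (cases "j = k") auto
  qed
  have "(\<Prod>k<h. a - b k) * (1 + (\<Sum>k<h. d k / (a - b k))) = 0"
    using prod_eq_prod_mult_sum[of h a b d] ne a(3) by (simp add: G_def)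
  moreover have "(\<Prod>k<h. a - b k) \<noteq> 0" using ne by auto
  ultimately show ?thesis using a by auto
qed

text \<open>Poles and positive residues determine interlacing zeros, the converse of
  \<open>pf_weight_expansion\<close>; here \<open>b\<close> lists the poles and \<open>a\<close> the
  zeros. The zeros are chosen separately for each parameter, but strict monotonicity between poles
  makes the choice unique, and uniqueness gives continuity.\<close>

lemma interlacing_roots:
  fixes b d :: "nat \<Rightarrow> 's::topological_space \<Rightarrow> real"
  assumes cb: "\<And>k. k < h \<Longrightarrow> continuous_on S (b k)" and cd: "\<And>k. k < h \<Longrightarrow> continuous_on S (d k)"
    and b: "\<And>s j k. s \<in> S \<Longrightarrow> j < k \<Longrightarrow> k < h \<Longrightarrow> b j s < b k s"
    and d: "\<And>s k. s \<in> S \<Longrightarrow> k < h \<Longrightarrow> 0 < d k s"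
  obtains a where "\<And>k. k < h \<Longrightarrow> continuous_on S (a k)"
    and "\<And>s. s \<in> S \<Longrightarrow> interlacing h (\<lambda>k. a k s) (\<lambda>k. b k s)"
    and "\<And>s z. s \<in> S \<Longrightarrow> (\<Prod>k<h. z - a k s)
      = (\<Prod>k<h. z - b k s) + (\<Sum>i<h. d i s * (\<Prod>j\<in>{..<h} - {i}. z - b j s))"
proof -
  define lo where "lo k s = (if k = 0 then b 0 s - (\<Sum>i<h. d i s) - 1 else b (k - 1) s)" for k s
  define r where "r s z = 1 + (\<Sum>i<h. d i s / (z - b i s))" for s z
  have "\<forall>k s. \<exists>a. k < h \<longrightarrow> s \<in> S \<longrightarrow> lo k s < a \<and> a < b k s \<and> r s a = 0"
    using interlacing_roots_exist[of h "\<lambda>k. b k s" "\<lambda>k. d k s" for s] b d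
    unfolding lo_def r_def by meson
  then obtain a where a: "\<And>k s. k < h \<Longrightarrow> s \<in> S \<Longrightarrow> lo k s < a k s \<and> a k s < b k s \<and> r s (a k s) = 0"
    by metis
  have gap: "if j < k then b j s < z else z < b j s"
    if "k < h" "s \<in> S" "lo k s < z" "z < b k s" "j < h" for j k s z
  proof (cases "j < k")
    case True
    then have "b j s \<le> lo k s" using b[of s j "k - 1"] that
      by (cases "j = k - 1") (auto simp: lo_def intro!: less_imp_le)
    then show ?thesis using that True by auto
  next
    case False
    then show ?thesis using that b[of s k j] by (cases "j = k") auto
  qed
  have mono: "r s y < r s x"
    if "k < h" "s \<in> S" "lo k s < x" "x < y" "y < b k s" for k s x y
    unfolding r_def
  proof (intro add_strict_left_mono sum_strict_mono)
    fix j assume "j \<in> {..<h}"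
    then have j: "j < h" by simp
    have gx: "if j < k then b j s < x else x < b j s" by (rule gap) (use that j in auto)
    have gy: "if j < k then b j s < y else y < b j s" by (rule gap) (use that j in auto)
    show "d j s / (y - b j s) < d j s / (x - b j s)"
      using gx gy \<open>x < y\<close> d[OF \<open>s \<in> S\<close> j]
      by (intro divide_strict_left_mono) (auto split: if_splits intro: mult_neg_neg)
  qed (use that in auto)
  \<comment> \<open>Monotonicity turns the chosen zero into the sign pattern that
    \<open>continuous_on_root\<close> asks for.\<close>
  have sign: "(0 < r s z \<longleftrightarrow> z < a k s) \<and> (r s z < 0 \<longleftrightarrow> a k s < z)"
    if "k < h" "s \<in> S" "lo k s < z" "z < b k s" for k s z
    using mono[of k s z "a k s"] mono[of k s "a k s" z] a[OF that(1,2)] that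
    by (cases z "a k s" rule: linorder_cases) auto
  show thesis
  proof
    fix k assume k: "k < h"
    show "continuous_on S (a k)"
    proof (rule continuous_on_root[where F = r and lo = "lo k" and hi = "b k"])
      show "continuous_on S (lo k)"
        using k cb cd by (cases "k = 0") (auto simp: lo_def intro!: continuous_intros)
      fix s z assume *: "s \<in> S" "lo k s < z" "z < b k s"
      show "((\<lambda>s. r s z) \<longlongrightarrow> r s z) (at s within S)"
        unfolding r_def
      proof (intro tendsto_intros)
        fix j assume "j \<in> {..<h}"
        then have j: "j < h" by simp
        show "(d j \<longlongrightarrow> d j s) (at s within S)" "(b j \<longlongrightarrow> b j s) (at s within S)"
          using cb[OF j] cd[OF j] * by (auto simp: continuous_on_def)
        show "z - b j s \<noteq> 0" using gap[OF k * j] by (auto split: if_splits)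
      qed
    qed (use a k cb sign in auto)
  next
    fix s assume s: "s \<in> S"
    show I: "interlacing h (\<lambda>k. a k s) (\<lambda>k. b k s)"
      unfolding interlacing_def
    proof (intro conjI allI impI)
      fix k assume "k < h"
      then show "a k s < b k s" using a s by blast
    next
      fix k assume "Suc k < h"
      then show "b k s < a (Suc k) s" using a[of "Suc k" s] s by (simp add: lo_def)
    qed
    fix z
    show "(\<Prod>k<h. z - a k s)
      = (\<Prod>k<h. z - b k s) + (\<Sum>i<h. d i s * (\<Prod>j\<in>{..<h} - {i}. z - b j s))"
    proof (rule monic_interpolation[OF interlacing_inj_on(1)[OF I]])
      fix k assume k: "k < h"
      have "a k s \<noteq> b j s" if "j < h" for j
        using gap[OF k s _ _ that, of "a k s"] a[OF k s] by (auto split: if_splits)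
      then have "(\<Prod>j<h. a k s - b j s) + (\<Sum>i<h. d i s * (\<Prod>j\<in>{..<h} - {i}. a k s - b j s))
        = (\<Prod>j<h. a k s - b j s) * r s (a k s)"
        unfolding r_def by (rule prod_eq_prod_mult_sum)
      also have "\<dots> = 0" using a[OF k s] by simp
      also have "0 = (\<Prod>j<h. a k s - a j s)" using k by auto
      finally show "(\<Prod>j<h. a k s - a j s)
        = (\<Prod>j<h. a k s - b j s) + (\<Sum>i<h. d i s * (\<Prod>j\<in>{..<h} - {i}. a k s - b j s))" by simp
    qed
  qed
qed

text \<open>Admissible data for a tree of order \<open>m\<close>. For even \<open>m\<close> deleting
  the root leaves a skew-symmetric matrix of odd order, which is singular and forces
  \<open>a 0 = 0\<close>. For odd \<open>m\<close> the full matrix has the eigenvalue 0, and strict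
  interlacing keeps \<open>a 0\<close> positive. The guard covers \<open>m = 1\<close>, where there
  are no nodes.\<close>

definition branch_data :: "nat \<Rightarrow> (nat \<Rightarrow> real) \<Rightarrow> (nat \<Rightarrow> real) \<Rightarrow> bool" where
  "branch_data m a b \<longleftrightarrow> interlacing (m div 2) a b \<and>
     (0 < m div 2 \<longrightarrow> (if even m then a 0 = 0 else 0 < a 0))"

text \<open>Each summand is split by \<open>z = (z - \<zeta> k) + \<zeta> k\<close>.\<close>

lemma times_sum_prod_remove:
  fixes \<zeta> c :: "nat \<Rightarrow> real"
  shows "z * (\<Sum>k<h. c k * (\<Prod>j\<in>{..<h} - {k}. z - \<zeta> j))
    = (\<Sum>k<h. c k) * (\<Prod>k<h. z - \<zeta> k) + (\<Sum>k<h. c k * \<zeta> k * (\<Prod>j\<in>{..<h} - {k}. z - \<zeta> j))"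
proof -
  have "z * (c k * (\<Prod>j\<in>{..<h} - {k}. z - \<zeta> j))
    = c k * (\<Prod>k<h. z - \<zeta> k) + c k * \<zeta> k * (\<Prod>j\<in>{..<h} - {k}. z - \<zeta> j)" if "k < h" for k
    using that by (subst prod.remove[of "{..<h}" k]) (auto simp: algebra_simps)
  then have "z * (\<Sum>k<h. c k * (\<Prod>j\<in>{..<h} - {k}. z - \<zeta> j))
    = (\<Sum>k<h. c k * (\<Prod>k<h. z - \<zeta> k) + c k * \<zeta> k * (\<Prod>j\<in>{..<h} - {k}. z - \<zeta> j))"
    unfolding sum_distrib_left by (intro sum.cong) auto
  then show ?thesis by (simp add: sum.distrib sum_distrib_right)
qed

lemma prod_lessThan_Suc_remove_shift:
  fixes f :: "nat \<Rightarrow> real"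
  assumes "k < h"
  shows "(\<Prod>j\<in>{..<Suc h} - {Suc k}. f j) = f 0 * (\<Prod>j\<in>{..<h} - {k}. f (Suc j))"
proof -
  have "{..<Suc h} - {Suc k} = insert 0 (Suc ` ({..<h} - {k}))"
    by (auto simp: image_iff less_Suc_eq_0_disj)
  then have "(\<Prod>j\<in>{..<Suc h} - {Suc k}. f j) = f 0 * (\<Prod>j\<in>Suc ` ({..<h} - {k}). f j)"
    by simp
  also have "(\<Prod>j\<in>Suc ` ({..<h} - {k}). f j) = (\<Prod>j\<in>{..<h} - {k}. f (Suc j))"
    by (subst prod.reindex) auto
  finally show ?thesis .
qed

text \<open>A branch of order \<open>m\<close> owns the poles \<open>\<zeta> k\<close> with residues
  \<open>c k\<close>. With C the sum of the \<open>c k\<close>, the two identities say in both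
  parities that the sum of \<open>c k / (z - \<zeta> k)\<close> is C times the product of the
  \<open>z - a k\<close>, divided by \<open>z\<close> times the product of the
  \<open>z - b k\<close>. The \<open>a k\<close> come from \<open>interlacing_roots\<close> via
  \<open>z / (z - \<zeta> k) = 1 + \<zeta> k / (z - \<zeta> k)\<close>, which explains the weights
  \<open>c k * \<zeta> k\<close> over C.\<close>

lemma branch_data_from_poles:
  fixes \<zeta> c :: "nat \<Rightarrow> 's::topological_space \<Rightarrow> real"
  assumes m: "1 \<le> m" and h: "h = (m + 1) div 2"
    and c\<zeta>: "\<And>k. k < h \<Longrightarrow> continuous_on S (\<zeta> k)" and cc: "\<And>k. k < h \<Longrightarrow> continuous_on S (c k)"
    and \<zeta>: "\<And>s j k. s \<in> S \<Longrightarrow> j < k \<Longrightarrow> k < h \<Longrightarrow> \<zeta> j s < \<zeta> k s"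
    and \<zeta>0: "\<And>s. s \<in> S \<Longrightarrow> if even m then 0 < \<zeta> 0 s else \<zeta> 0 s = 0"
    and c: "\<And>s k. s \<in> S \<Longrightarrow> k < h \<Longrightarrow> 0 < c k s"
  obtains a b where "\<And>k. k < m div 2 \<Longrightarrow> continuous_on S (a k)"
    and "\<And>k. k < m div 2 \<Longrightarrow> continuous_on S (b k)"
    and "\<And>s. s \<in> S \<Longrightarrow> branch_data m (\<lambda>k. a k s) (\<lambda>k. b k s)"
    and "\<And>s z. s \<in> S \<Longrightarrow>
      (if even m then 1 else z) * (\<Prod>k<m div 2. z - b k s) = (\<Prod>k<h. z - \<zeta> k s)"
    and "\<And>s z. s \<in> S \<Longrightarrow> z \<noteq> 0 \<Longrightarrow> (\<Sum>k<h. c k s) * (\<Prod>k<m div 2. z - a k s)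
      = (if even m then z else 1) * (\<Sum>k<h. c k s * (\<Prod>j\<in>{..<h} - {k}. z - \<zeta> j s))"
proof (cases "even m")
  case True
  then have h: "h = m div 2" "0 < h" using m h by auto
  define C where "C s = (\<Sum>k<h. c k s)" for s
  have C: "0 < C s" if "s \<in> S" for s
    unfolding C_def by (rule sum_pos) (use c that h in auto)
  have cC: "continuous_on S C" unfolding C_def using cc by (intro continuous_intros) auto
  have \<zeta>pos: "0 < \<zeta> k s" if "s \<in> S" "k < h" for s k
    using \<zeta>0[OF that(1)] \<zeta>[OF that(1), of 0 k] True that by (cases "k = 0") auto
  obtain a where a: "\<And>k. k < h \<Longrightarrow> continuous_on S (a k)"
    "\<And>s. s \<in> S \<Longrightarrow> interlacing h (\<lambda>k. a k s) (\<lambda>k. \<zeta> k s)"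
    "\<And>s z. s \<in> S \<Longrightarrow> (\<Prod>k<h. z - a k s)
      = (\<Prod>k<h. z - \<zeta> k s) + (\<Sum>i<h. c i s * \<zeta> i s / C s * (\<Prod>j\<in>{..<h} - {i}. z - \<zeta> j s))"
  proof (rule interlacing_roots[where h = h and S = S and b = \<zeta> and d = "\<lambda>k s. c k s * \<zeta> k s / C s"])
    fix k assume k: "k < h"
    show "continuous_on S (\<lambda>s. c k s * \<zeta> k s / C s)"
      using C k by (intro continuous_intros cc c\<zeta> cC) (auto simp: less_imp_neq[symmetric])
  qed (use c C \<zeta>pos \<zeta> c\<zeta> in auto)
  have key: "C s * (\<Prod>k<h. z - a k s) = z * (\<Sum>k<h. c k s * (\<Prod>j\<in>{..<h} - {k}. z - \<zeta> j s))"
    if "s \<in> S" for s z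
    unfolding times_sum_prod_remove a(3)[OF that]
    using C[OF that] by (simp add: C_def[symmetric] algebra_simps sum_distrib_left)
  \<comment> \<open>Multiplication by \<open>z\<close> makes the right-hand side of
    \<open>key\<close> vanish at 0, so some \<open>a k\<close> is 0; only the first can be, as the
    others lie above \<open>\<zeta> 0 > 0\<close>.\<close>
  have "a 0 s = 0" if s: "s \<in> S" for s
  proof -
    have "(\<Prod>k<h. 0 - a k s) = 0" using key[OF s, of 0] C[OF s] by auto
    then obtain k where k: "k < h" "a k s = 0" by auto
    have "k = 0"
    proof (rule ccontr)
      assume "k \<noteq> 0"
      then have "\<zeta> 0 s < a k s" using interlacing_less[OF a(2)[OF s], of 0 k] k by simp
      then show False using \<zeta>pos[OF s h(2)] k by simp
    qed
    then show ?thesis using k by simp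
  qed
  then show thesis
    using that[of a \<zeta>] a c\<zeta> h key True by (auto simp: branch_data_def C_def)
next
  case False
  define l where "l = m div 2"
  have h: "h = Suc l" using False h by (auto simp: l_def elim!: oddE)
  define C where "C s = (\<Sum>k<h. c k s)" for s
  have C: "0 < C s" if "s \<in> S" for s
    unfolding C_def by (rule sum_pos) (use c that h in auto)
  have cC: "continuous_on S C" unfolding C_def using cc by (intro continuous_intros) auto
  have \<zeta>z: "\<zeta> 0 s = 0" if "s \<in> S" for s using \<zeta>0[OF that] False by simp
  have \<zeta>pos: "0 < \<zeta> (Suc k) s" if "s \<in> S" "k < l" for s k
    using \<zeta>[OF that(1), of 0 "Suc k"] \<zeta>z that h by auto
  \<comment> \<open>The pole \<open>\<zeta> 0 = 0\<close> is absorbed by the explicit factor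
    \<open>z\<close>; the remaining poles are renumbered from 0.\<close>
  define b where "b k = \<zeta> (Suc k)" for k
  obtain a where a: "\<And>k. k < l \<Longrightarrow> continuous_on S (a k)"
    "\<And>s. s \<in> S \<Longrightarrow> interlacing l (\<lambda>k. a k s) (\<lambda>k. b k s)"
    "\<And>s z. s \<in> S \<Longrightarrow> (\<Prod>k<l. z - a k s)
      = (\<Prod>k<l. z - b k s) + (\<Sum>i<l. c (Suc i) s * b i s / C s * (\<Prod>j\<in>{..<l} - {i}. z - b j s))"
  proof (rule interlacing_roots[where h = l and S = S and b = b and d = "\<lambda>k s. c (Suc k) s * b k s / C s"])
    fix k assume k: "k < l"
    show "continuous_on S (\<lambda>s. c (Suc k) s * b k s / C s)"
      unfolding b_def using C k h by (intro continuous_intros cc c\<zeta> cC) (auto simp: less_imp_neq[symmetric])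
  qed (use c C \<zeta>pos \<zeta> c\<zeta> in \<open>auto simp: b_def h\<close>)
  have pz: "(\<Prod>k<h. z - \<zeta> k s) = z * (\<Prod>k<l. z - b k s)" if "s \<in> S" for s z
    unfolding h prod.lessThan_Suc_shift using \<zeta>z[OF that] by (simp add: b_def)
  \<comment> \<open>A factor \<open>z\<close> remains on both sides; cancelling it at the end is
    where \<open>z \<noteq> 0\<close> enters.\<close>
  have key: "z * (C s * (\<Prod>k<l. z - a k s)) = z * (\<Sum>k<h. c k s * (\<Prod>j\<in>{..<h} - {k}. z - \<zeta> j s))"
    if s: "s \<in> S" for s z
  proof -
    have "(\<Sum>k<h. c k s * \<zeta> k s * (\<Prod>j\<in>{..<h} - {k}. z - \<zeta> j s))
      = (\<Sum>k<l. c (Suc k) s * b k s * (z * (\<Prod>j\<in>{..<l} - {k}. z - b j s)))"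
      unfolding h sum.lessThan_Suc_shift
      using \<zeta>z[OF s] by (auto simp: b_def prod_lessThan_Suc_remove_shift intro!: sum.cong)
    then show ?thesis
      unfolding times_sum_prod_remove a(3)[OF s] pz[OF s]
      using C[OF s] by (simp add: C_def[symmetric] algebra_simps sum_distrib_left)
  qed
  \<comment> \<open>At \<open>z = 0\<close> the normalised quotient has the positive value
    \<open>c 0 s / C s\<close>. Comparing signs makes the product of all
    \<open>a k s * b k s\<close> positive, and every factor except \<open>a 0 s\<close> is already
    known to be positive.\<close>
  have "0 < a 0 s" if s: "s \<in> S" and l: "0 < l" for s
  proof -
    have e: "(\<Prod>k<l. 0 - a k s) = (\<Prod>k<l. 0 - b k s) * (1 + (\<Sum>k<l. c (Suc k) s * b k s / C s / (0 - b k s)))"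
      unfolding a(3)[OF s] by (rule prod_eq_prod_mult_sum) (use \<zeta>pos[OF s] in \<open>force simp: b_def\<close>)
    have bp: "0 < b k s" if "k < l" for k using \<zeta>pos[OF s that] by (simp add: b_def)
    have "(\<Sum>k<l. c (Suc k) s * b k s / C s / (0 - b k s)) = (\<Sum>k<l. - (c (Suc k) s / C s))"
      by (rule sum.cong) (use bp in force)+
    also have "\<dots> = - ((C s - c 0 s) / C s)"
      unfolding C_def h sum.lessThan_Suc_shift by (simp add: sum_negf sum_divide_distrib)
    also have "1 + \<dots> = c 0 s / C s" using C[OF s] by (simp add: field_simps)
    finally have "(\<Prod>k<l. 0 - a k s) = (\<Prod>k<l. 0 - b k s) * (c 0 s / C s)"
      using e by simp
    then have "(\<Prod>k<l. - a k s) * (\<Prod>k<l. - b k s) = (\<Prod>k<l. - b k s)\<^sup>2 * (c 0 s / C s)"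
      by (simp add: power2_eq_square)
    moreover have "0 < (\<Prod>k<l. - b k s)\<^sup>2 * (c 0 s / C s)"
      using bp c[OF s] C[OF s] h by (auto intro!: mult_pos_pos divide_pos_pos) force
    ultimately have "0 < (\<Prod>k<l. - a k s) * (\<Prod>k<l. - b k s)" by simp
    also have "\<dots> = (\<Prod>k<l. a k s * b k s)" unfolding prod.distrib[symmetric] by simp
    also have "\<dots> = a 0 s * (b 0 s * (\<Prod>k\<in>{..<l} - {0}. a k s * b k s))"
      using l by (subst prod.remove[of _ 0]) auto
    finally have "0 < a 0 s * (b 0 s * (\<Prod>k\<in>{..<l} - {0}. a k s * b k s))" .
    moreover have "0 < b 0 s * (\<Prod>k\<in>{..<l} - {0}. a k s * b k s)"
    proof (intro mult_pos_pos prod_pos)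
      show "0 < b 0 s" by (rule bp[OF l])
      fix k assume k: "k \<in> {..<l} - {0}"
      then show "0 < b k s" using bp by auto
      have "b 0 s < a k s" using interlacing_less[OF a(2)[OF s], of 0 k] k by auto
      then show "0 < a k s" using bp[OF l] by simp
    qed
    ultimately show ?thesis by (metis zero_less_mult_pos2)
  qed
  then have data: "branch_data m (\<lambda>k. a k s) (\<lambda>k. b k s)" if "s \<in> S" for s
    using a(2)[OF that] False that by (auto simp: branch_data_def l_def)
  show thesis
  proof (rule that[of a b])
    fix s z assume s: "s \<in> S"
    show "(if even m then 1 else z) * (\<Prod>k<m div 2. z - b k s) = (\<Prod>k<h. z - \<zeta> k s)"
      using pz[OF s] False by (simp only: l_def) simp
    assume "z \<noteq> 0"
    then show "(\<Sum>k<h. c k s) * (\<Prod>k<m div 2. z - a k s)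
      = (if even m then z else 1) * (\<Sum>k<h. c k s * (\<Prod>j\<in>{..<h} - {k}. z - \<zeta> j s))"
      using key[OF s, of z] False unfolding C_def l_def by (simp only: mult_cancel_left) simp
  qed (use a(1) c\<zeta> h data in \<open>auto simp: b_def l_def\<close>)
qed

section \<open>Distributing a finite set over blocks of prescribed sizes\<close>

lemma partition_with_cards:
  assumes "finite N" "finite X" "(\<Sum>u\<in>N. r u) = card X"
  obtains K where "(\<Union>u\<in>N. K u) = X" and "\<And>u. u \<in> N \<Longrightarrow> card (K u) = r u"
    and "\<And>u u'. u \<in> N \<Longrightarrow> u' \<in> N \<Longrightarrow> u \<noteq> u' \<Longrightarrow> K u \<inter> K u' = {}"
proof -
  have "\<exists>K. (\<Union>u\<in>N. K u) = X \<and> (\<forall>u\<in>N. card (K u) = r u)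
    \<and> (\<forall>u\<in>N. \<forall>u'\<in>N. u \<noteq> u' \<longrightarrow> K u \<inter> K u' = {})"
    using assms
  proof (induction N arbitrary: X rule: finite_induct)
    case (insert v N)
    then have "r v \<le> card X" by simp
    then obtain Y where Y: "Y \<subseteq> X" "card Y = r v"
      using obtain_subset_with_card_n by metis
    have "card (X - Y) = card X - r v" using Y insert.prems by (simp add: card_Diff_subset finite_subset)
    then have "(\<Sum>u\<in>N. r u) = card (X - Y)" using insert by simp
    then obtain K where K: "(\<Union>u\<in>N. K u) = X - Y" "\<forall>u\<in>N. card (K u) = r u"
      "\<forall>u\<in>N. \<forall>u'\<in>N. u \<noteq> u' \<longrightarrow> K u \<inter> K u' = {}"
      using insert.IH[of "X - Y"] insert.prems by auto
    have sub: "K u \<subseteq> X - Y" if "u \<in> N" for u using K(1) that by auto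
    show ?case
    proof (intro exI[of _ "K(v := Y)"] conjI ballI impI)
      show "(\<Union>u\<in>insert v N. (K(v := Y)) u) = X"
        using K(1) Y insert.hyps by (auto simp: fun_upd_def split: if_splits)
      fix u assume u: "u \<in> insert v N"
      then show "card ((K(v := Y)) u) = r u" using K(2) Y by auto
      fix u' assume u': "u' \<in> insert v N" "u \<noteq> u'"
      then show "(K(v := Y)) u \<inter> (K(v := Y)) u' = {}"
        using u u' sub[of u] sub[of u'] K(3) by (cases "u = v"; cases "u' = v") auto
    qed
  qed auto
  then show thesis by (elim exE conjE) (rule that, auto)
qed

text \<open>Serves to send the zero pole to the odd branch: \<open>x\<close> is reserved for
  \<open>v\<close>, whose quota is lowered by one while the rest is distributed.\<close>

lemma partition_with_cards_point:
  assumes N: "finite N" and X: "finite X" "x \<in> X" and r: "(\<Sum>u\<in>N. r u) = card X"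
    and v: "v \<in> N" "0 < r v"
  obtains K where "(\<Union>u\<in>N. K u) = X" and "\<And>u. u \<in> N \<Longrightarrow> card (K u) = r u"
    and "\<And>u u'. u \<in> N \<Longrightarrow> u' \<in> N \<Longrightarrow> u \<noteq> u' \<Longrightarrow> K u \<inter> K u' = {}" and "x \<in> K v"
proof -
  have "(\<Sum>u\<in>N. (r(v := r v - 1)) u) + 1 = (\<Sum>u\<in>N. r u)"
    using v by (simp add: sum.remove[OF N, of v])
  then have s: "(\<Sum>u\<in>N. (r(v := r v - 1)) u) = card (X - {x})" using r X by simp
  obtain K where K: "(\<Union>u\<in>N. K u) = X - {x}" "\<And>u. u \<in> N \<Longrightarrow> card (K u) = (r(v := r v - 1)) u"
    "\<And>u u'. u \<in> N \<Longrightarrow> u' \<in> N \<Longrightarrow> u \<noteq> u' \<Longrightarrow> K u \<inter> K u' = {}"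
    using partition_with_cards[OF N _ s] X by blast
  have sub: "K u \<subseteq> X - {x}" if "u \<in> N" for u using K(1) that by auto
  show thesis
  proof (rule that[of "K(v := insert x (K v))"])
    show "(\<Union>u\<in>N. (K(v := insert x (K v))) u) = X"
      using K(1) v X by (auto simp: fun_upd_def split: if_splits)
    fix u assume u: "u \<in> N"
    have "finite (K v)" "x \<notin> K v" using sub[OF v(1)] X finite_subset by auto
    then show "card ((K(v := insert x (K v))) u) = r u"
      using K(2)[OF u] v by auto
    fix u' assume u': "u' \<in> N" "u \<noteq> u'"
    show "(K(v := insert x (K v))) u \<inter> (K(v := insert x (K v))) u' = {}"
      using K(3)[OF u u'] sub[OF u] sub[OF u'(1)] u'(2) by (cases "u = v"; cases "u' = v") auto
  qed auto
qed

section \<open>The Poincare--Miranda theorem\<close>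

text \<open>A cube with infinitely many coordinates, so that one type serves every dimension; in the
  product topology it is compact by Tychonoff's theorem.\<close>

definition unit_box :: "(nat \<Rightarrow> real) set" where
  "unit_box = {x. \<forall>i. \<bar>x i\<bar> \<le> 1}"

lemma compact_unit_box: "compact unit_box"
proof -
  have "compactin (product_topology (\<lambda>i. euclidean) UNIV) (PiE UNIV (\<lambda>i::nat. {-1..1::real}))"
    by (subst compactin_PiE) auto
  moreover have "PiE UNIV (\<lambda>i::nat. {-1..1::real}) = unit_box"
    by (auto simp: unit_box_def PiE_UNIV_domain abs_le_iff Pi_iff minus_le_iff)
  ultimately show ?thesis by (simp add: euclidean_product_topology)
qed

lemma compact_unit_box_face: "compact {x \<in> unit_box. x i = c}"
proof -
  have "closed {x::nat \<Rightarrow> real. x i = c}"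
    by (intro closed_Collect_eq continuous_on_const continuous_on_product_coordinates)
  then have "compact (unit_box \<inter> {x. x i = c})"
    by (intro compact_Int_closed compact_unit_box)
  then show ?thesis by (simp add: Collect_conj_eq)
qed

lemma tendsto_coordinatewise:
  fixes f :: "'c \<Rightarrow> 'i \<Rightarrow> 'b::topological_space"
  shows "(f \<longlongrightarrow> l) F \<longleftrightarrow> (\<forall>i. ((\<lambda>c. f c i) \<longlongrightarrow> l i) F)"
proof -
  have "(f \<longlongrightarrow> l) F \<longleftrightarrow> limitin (product_topology (\<lambda>i. euclidean) UNIV) f l F"
    by (simp add: euclidean_product_topology)
  also have "\<dots> \<longleftrightarrow> (\<forall>i. ((\<lambda>c. f c i) \<longlongrightarrow> l i) F)"
    by (subst limitin_componentwise) auto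
  finally show ?thesis .
qed

text \<open>Grid points are labelled by the signs of the \<open>f i\<close>. Kuhn's lemma yields,
  for every mesh size, a cell on which each \<open>f i\<close> takes both signs; a limit point of
  such cells is a common zero.\<close>

theorem poincare_miranda:
  fixes f :: "nat \<Rightarrow> (nat \<Rightarrow> real) \<Rightarrow> real"
  assumes cont: "\<And>i. i < n \<Longrightarrow> continuous_on unit_box (f i)"
    and neg: "\<And>i x. i < n \<Longrightarrow> x \<in> unit_box \<Longrightarrow> x i = -1 \<Longrightarrow> f i x < 0"
    and pos: "\<And>i x. i < n \<Longrightarrow> x \<in> unit_box \<Longrightarrow> x i = 1 \<Longrightarrow> 0 < f i x"
  obtains x where "x \<in> unit_box" and "\<And>i. i < n \<Longrightarrow> f i x = 0"
proof -
  define pt where "pt m q i = (if i < n then 2 * real (q i) / real (Suc m) - 1 else 0)"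
    for m and q :: "nat \<Rightarrow> nat" and i
  have box: "pt m q \<in> unit_box" if "\<forall>i<n. q i \<le> Suc m" for m q
  proof -
    have "real (q i) * 2 \<le> 2 + real m * 2" if "i < n" for i
      using \<open>\<forall>i<n. q i \<le> Suc m\<close> that by fastforce
    then show ?thesis by (auto simp: unit_box_def pt_def abs_le_iff field_simps)
  qed
  have "\<exists>q. (\<forall>i<n. q i < Suc m) \<and> (\<forall>i<n. \<exists>r s.
      (\<forall>j<n. q j \<le> r j \<and> r j \<le> q j + 1) \<and> (\<forall>j<n. q j \<le> s j \<and> s j \<le> q j + 1)
      \<and> f i (pt m r) < 0 \<and> 0 \<le> f i (pt m s))" for m
  proof -
    \<comment> \<open>The face conditions on \<open>f\<close> become the boundary conditions of
      Kuhn's lemma: label 0 where the coordinate is 0, label 1 where it is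
      \<open>Suc m\<close>.\<close>
    define label where "label q i = (if 0 \<le> f i (pt m q) then 1 else 0::nat)" for q i
    have l0: "label q i = 0" if "\<forall>i<n. q i \<le> Suc m" "i < n" "q i = 0" for q i
      using neg[OF that(2) box[OF that(1)]] that by (auto simp: label_def pt_def)
    have l1: "label q i = 1" if "\<forall>i<n. q i \<le> Suc m" "i < n" "q i = Suc m" for q i
      using pos[OF that(2) box[OF that(1)]] that by (auto simp: label_def pt_def field_simps)
    obtain q where q: "\<forall>i<n. q i < Suc m"
      "\<forall>i<n. \<exists>r s. (\<forall>j<n. q j \<le> r j \<and> r j \<le> q j + 1) \<and> (\<forall>j<n. q j \<le> s j \<and> s j \<le> q j + 1)
        \<and> label r i \<noteq> label s i"
    proof (rule kuhn_lemma[of "Suc m" n label])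
      show "\<forall>x. (\<forall>i<n. x i \<le> Suc m) \<longrightarrow> (\<forall>i<n. label x i = 0 \<or> label x i = 1)"
        by (simp add: label_def)
    qed (use l0 l1 in auto)
    have "\<exists>r s. (\<forall>j<n. q j \<le> r j \<and> r j \<le> q j + 1) \<and> (\<forall>j<n. q j \<le> s j \<and> s j \<le> q j + 1)
      \<and> f i (pt m r) < 0 \<and> 0 \<le> f i (pt m s)" if i: "i < n" for i
    proof -
      obtain r s where rs: "\<forall>j<n. q j \<le> r j \<and> r j \<le> q j + 1" "\<forall>j<n. q j \<le> s j \<and> s j \<le> q j + 1"
        "label r i \<noteq> label s i" using q(2) i by blast
      show ?thesis
      proof (cases "f i (pt m r) < 0")
        case True
        then show ?thesis using rs by (intro exI[of _ r] exI[of _ s]) (auto simp: label_def split: if_splits)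
      next
        case False
        then show ?thesis using rs by (intro exI[of _ s] exI[of _ r]) (auto simp: label_def split: if_splits)
      qed
    qed
    then show ?thesis using q(1) by blast
  qed
  then obtain q where q: "\<And>m. \<forall>i<n. q m i < Suc m"
    and "\<And>m. \<forall>i<n. \<exists>r s. (\<forall>j<n. q m j \<le> r j \<and> r j \<le> q m j + 1)
      \<and> (\<forall>j<n. q m j \<le> s j \<and> s j \<le> q m j + 1) \<and> f i (pt m r) < 0 \<and> 0 \<le> f i (pt m s)"
    by metis
  \<comment> \<open>The two corners depend on \<open>i\<close> as well as on \<open>m\<close>; what
    all components share is the cell.\<close>
  then obtain r s where rs: "\<And>m i. i < n \<Longrightarrow> (\<forall>j<n. q m j \<le> r m i j \<and> r m i j \<le> q m j + 1)
      \<and> (\<forall>j<n. q m j \<le> s m i j \<and> s m i j \<le> q m j + 1)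
      \<and> f i (pt m (r m i)) < 0 \<and> 0 \<le> f i (pt m (s m i))"
    by metis
  have "seq_compact unit_box" by (rule compact_imp_seq_compact[OF compact_unit_box])
  moreover have "\<forall>m. pt m (q m) \<in> unit_box" using box q by (metis less_imp_le)
  ultimately obtain x \<phi> where x: "x \<in> unit_box" and \<phi>: "strict_mono \<phi>"
    and lim: "((\<lambda>m. pt m (q m)) \<circ> \<phi>) \<longlonglongrightarrow> x"
    by (rule seq_compactE)
  \<comment> \<open>Corners differ from the base point of their cell by at most one mesh width, so
    every choice of corners has the same limit.\<close>
  have near: "(\<lambda>m. pt (\<phi> m) (t (\<phi> m))) \<longlonglongrightarrow> x"
    if t: "\<And>m. \<forall>j<n. q m j \<le> t m j \<and> t m j \<le> q m j + 1" for t
    unfolding tendsto_coordinatewise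
  proof
    fix j
    have l: "(\<lambda>m. pt (\<phi> m) (q (\<phi> m)) j) \<longlonglongrightarrow> x j"
      using lim unfolding tendsto_coordinatewise by (simp add: o_def)
    have z: "(\<lambda>m. 2 / real (Suc (\<phi> m))) \<longlonglongrightarrow> 0"
      using LIMSEQ_subseq_LIMSEQ[OF tendsto_mult_right_zero[OF LIMSEQ_inverse_real_of_nat] \<phi>, of 2]
      by (simp add: o_def divide_inverse)
    have "(\<lambda>m. pt (\<phi> m) (t (\<phi> m)) j - pt (\<phi> m) (q (\<phi> m)) j) \<longlonglongrightarrow> 0"
    proof (rule Lim_null_comparison[OF _ z], rule always_eventually, rule allI)
      fix m
      show "norm (pt (\<phi> m) (t (\<phi> m)) j - pt (\<phi> m) (q (\<phi> m)) j) \<le> 2 / real (Suc (\<phi> m))"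
      proof (cases "j < n")
        case True
        then have d: "real (q (\<phi> m) j) \<le> real (t (\<phi> m) j)" "real (t (\<phi> m) j) \<le> real (q (\<phi> m) j) + 1"
          using t[of "\<phi> m"] by (auto simp flip: of_nat_Suc)
        have "pt (\<phi> m) (t (\<phi> m)) j - pt (\<phi> m) (q (\<phi> m)) j
          = 2 * (real (t (\<phi> m) j) - real (q (\<phi> m) j)) / real (Suc (\<phi> m))"
          using True by (simp add: pt_def diff_divide_distrib right_diff_distrib)
        also have "norm \<dots> \<le> 2 / real (Suc (\<phi> m))"
          using d by (simp add: abs_mult divide_right_mono)
        finally show ?thesis .
      qed (simp add: pt_def)
    qed
    from tendsto_add[OF this l] show "(\<lambda>m. pt (\<phi> m) (t (\<phi> m)) j) \<longlonglongrightarrow> x j" by simp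
  qed
  have inbox: "pt m (t m) \<in> unit_box"
    if t: "\<And>m. \<forall>j<n. q m j \<le> t m j \<and> t m j \<le> q m j + 1" for t m
  proof (rule box, intro allI impI)
    fix j assume "j < n"
    then show "t m j \<le> Suc m" using t[of m] q[of m] by fastforce
  qed
  have limf: "(\<lambda>m. f i (pt (\<phi> m) (t (\<phi> m)))) \<longlonglongrightarrow> f i x"
    if "i < n" and t: "\<And>m. \<forall>j<n. q m j \<le> t m j \<and> t m j \<le> q m j + 1" for t i
    by (rule continuous_on_tendsto_compose[OF cont[OF that(1)] near[OF t] x])
      (auto intro!: always_eventually inbox t)
  show thesis
  proof (rule that[OF x])
    fix i assume i: "i < n"
    have "f i x \<le> 0"
      by (rule LIMSEQ_le_const2[OF limf[OF i, of "\<lambda>m. r m i"]]) (use rs[OF i] in \<open>auto intro: less_imp_le\<close>)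
    moreover have "0 \<le> f i x"
      by (rule LIMSEQ_le_const[OF limf[OF i, of "\<lambda>m. s m i"]]) (use rs[OF i] in auto)
    ultimately show "f i x = 0" by simp
  qed
qed

text \<open>The tube lemma: the open positivity set contains the compact slice over 0 and hence a
  whole strip around it.\<close>

lemma eventually_pos_on_compact:
  fixes f :: "real \<times> 'a::topological_space \<Rightarrow> real"
  assumes cont: "continuous_on (UNIV \<times> K) f" and F: "compact F" "F \<subseteq> K"
    and pos: "\<And>x. x \<in> F \<Longrightarrow> 0 < f (0, x)"
  shows "eventually (\<lambda>e. \<forall>x\<in>F. 0 < f (e, x)) (at_right 0)"
proof -
  obtain W where W: "open W" "W \<inter> UNIV \<times> K = f -` {0<..} \<inter> UNIV \<times> K"
    using cont unfolding continuous_on_open_invariant by (metis open_greaterThan)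
  have "{0} \<times> F \<subseteq> W" using W(2) pos F(2) by blast
  then obtain X where X: "0 \<in> X" "open X" "X \<times> F \<subseteq> W"
    using Elementary_Topology.tube_lemma[OF F(1) W(1)] by blast
  have "eventually (\<lambda>e. e \<in> X) (at_right 0)"
    by (rule eventually_at_topological[THEN iffD2]) (use X in auto)
  then show ?thesis
    by eventually_elim (use X W(2) F(2) in blast)
qed

text \<open>Strict signs on finitely many compact faces at \<open>e = 0\<close> survive for all
  small positive \<open>e\<close>, and the unperturbed theorem is applied at one such
  \<open>e\<close>. This replaces solving for the box coordinates as functions of
  \<open>e\<close>.\<close>

lemma perturbed_poincare_miranda:
  fixes f :: "nat \<Rightarrow> real \<times> (nat \<Rightarrow> real) \<Rightarrow> real"
  assumes cont: "\<And>i. i < n \<Longrightarrow> continuous_on (UNIV \<times> unit_box) (f i)"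
    and neg: "\<And>i x. i < n \<Longrightarrow> x \<in> unit_box \<Longrightarrow> x i = -1 \<Longrightarrow> f i (0, x) < 0"
    and pos: "\<And>i x. i < n \<Longrightarrow> x \<in> unit_box \<Longrightarrow> x i = 1 \<Longrightarrow> 0 < f i (0, x)"
  obtains e x where "0 < e" and "x \<in> unit_box" and "\<And>i. i < n \<Longrightarrow> f i (e, x) = 0"
proof -
  have p: "eventually (\<lambda>e. \<forall>x\<in>{x\<in>unit_box. x i = 1}. 0 < f i (e, x)) (at_right 0)" if "i < n" for i
    by (rule eventually_pos_on_compact[OF cont[OF that] compact_unit_box_face])
      (use pos[OF that] in auto)
  have m: "eventually (\<lambda>e. \<forall>x\<in>{x\<in>unit_box. x i = -1}. 0 < - f i (e, x)) (at_right 0)" if "i < n" for i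
    by (rule eventually_pos_on_compact[OF continuous_on_minus[OF cont[OF that]] compact_unit_box_face])
      (use neg[OF that] in auto)
  have "\<forall>i\<in>{..<n}. eventually (\<lambda>e. (\<forall>x\<in>{x\<in>unit_box. x i = 1}. 0 < f i (e, x))
      \<and> (\<forall>x\<in>{x\<in>unit_box. x i = -1}. 0 < - f i (e, x))) (at_right 0)"
  proof
    fix i assume "i \<in> {..<n}"
    then have "i < n" by simp
    then show "eventually (\<lambda>e. (\<forall>x\<in>{x\<in>unit_box. x i = 1}. 0 < f i (e, x))
      \<and> (\<forall>x\<in>{x\<in>unit_box. x i = -1}. 0 < - f i (e, x))) (at_right 0)"
      by (intro eventually_conj p m)
  qed
  from eventually_conj[OF eventually_at_right_less eventually_ball_finite[OF finite_lessThan this]]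
  have "\<exists>e>0. \<forall>i\<in>{..<n}. (\<forall>x\<in>{x\<in>unit_box. x i = 1}. 0 < f i (e, x))
      \<and> (\<forall>x\<in>{x\<in>unit_box. x i = -1}. 0 < - f i (e, x))"
    by (rule eventually_happens'[OF trivial_limit_at_right_real])
  then obtain e where e: "0 < e" "\<forall>i\<in>{..<n}. (\<forall>x\<in>{x\<in>unit_box. x i = 1}. 0 < f i (e, x))
      \<and> (\<forall>x\<in>{x\<in>unit_box. x i = -1}. 0 < - f i (e, x))"
    by (elim exE conjE)
  obtain x where "x \<in> unit_box" "\<And>i. i < n \<Longrightarrow> f i (e, x) = 0"
  proof (rule poincare_miranda[of n "\<lambda>i x. f i (e, x)"])
    fix i assume "i < n"
    then show "continuous_on unit_box (\<lambda>x. f i (e, x))"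
      by (intro continuous_on_compose2[OF cont] continuous_intros) auto
  qed (use e in auto)
  then show thesis using that e(1) by blast
qed

section \<open>Branches of a rooted tree\<close>

lemma arcs_ends_del_vert:
  "arcs_ends (pre_digraph.del_vert T w) = {(x, y) \<in> arcs_ends T. x \<noteq> w \<and> y \<noteq> w}"
  by (auto simp: arcs_ends_def arc_to_ends_def pre_digraph.del_vert_def image_iff)

lemma sym_digraph_del_vert:
  assumes "sym_digraph T"
  shows "sym_digraph (pre_digraph.del_vert T w)"
proof -
  interpret sym_digraph T by fact
  interpret H: wf_digraph "pre_digraph.del_vert T w" by (rule wf_digraph_del_vert)
  have "sym (arcs_ends T)" using sym_arcs by (simp add: symmetric_def)
  then have "symmetric (pre_digraph.del_vert T w)"
    unfolding symmetric_def arcs_ends_del_vert by (auto simp: sym_def)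
  then show ?thesis by unfold_locales
qed

locale rooted_tree =
  fixes T :: "('a, 'b) pre_digraph" and w :: 'a
  assumes tree: "undirected_tree T" and root: "w \<in> verts T"
begin

sublocale graph T
  using tree by (simp add: undirected_tree_def)

abbreviation H :: "('a, 'b) pre_digraph" where "H \<equiv> del_vert w"

sublocale H: sym_digraph H
  by (rule sym_digraph_del_vert) unfold_locales

definition nbrs :: "'a set" where "nbrs = {u. w \<rightarrow>\<^bsub>T\<^esub> u}"

definition bverts :: "'a \<Rightarrow> 'a set" where "bverts u = verts (branch T w u)"

lemma verts_branch: "bverts u = H.scc_of u"
  by (simp add: bverts_def branch_def Let_def)

lemma mem_bverts_iff: "x \<in> bverts u \<longleftrightarrow> u \<rightarrow>\<^sup>*\<^bsub>H\<^esub> x"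
  unfolding verts_branch H.scc_of_def
  using symmetric_reachable[OF H.sym_arcs] by blast

lemma adj_commute: "x \<rightarrow>\<^bsub>T\<^esub> y \<longleftrightarrow> y \<rightarrow>\<^bsub>T\<^esub> x"
  using sym_arcs by (auto simp: symmetric_def sym_def)

lemma adj_H_iff: "x \<rightarrow>\<^bsub>H\<^esub> y \<longleftrightarrow> x \<rightarrow>\<^bsub>T\<^esub> y \<and> x \<noteq> w \<and> y \<noteq> w"
  by (auto simp: arcs_ends_del_vert)

lemma nbrs_subset: "nbrs \<subseteq> verts T - {w}"
  unfolding nbrs_def using adj_in_verts(2) adj_not_same by blast

lemma finite_nbrs: "finite nbrs"
  by (rule finite_subset[OF nbrs_subset]) simp

lemma bverts_subset: "bverts u \<subseteq> verts T - {w}"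
proof
  fix x assume "x \<in> bverts u"
  then have "x \<in> verts H" by (auto simp: mem_bverts_iff elim: reachable_in_vertsE)
  then show "x \<in> verts T - {w}" by (simp add: verts_del_vert)
qed

lemma nbr_in_bverts: "u \<in> nbrs \<Longrightarrow> u \<in> bverts u"
  using nbrs_subset by (auto simp: mem_bverts_iff verts_del_vert)

text \<open>A path between two neighbours avoiding \<open>w\<close>, closed up through
  \<open>w\<close>, would be a cycle. This is where acyclicity of the tree enters.\<close>

lemma nbr_unique:
  assumes "u \<in> nbrs" "u' \<in> nbrs" "u \<rightarrow>\<^sup>*\<^bsub>H\<^esub> u'"
  shows "u = u'"
proof (rule ccontr)
  assume ne: "u \<noteq> u'"
  obtain p where p: "H.apath u p u'" using assms(3) H.reachable_apath by blast
  then have pH: "H.awalk u p u'" "distinct (H.awalk_verts u p)" by (auto simp: H.apath_def)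
  have comp: "compatible T H" by (simp add: compatible_def del_vert_simps)
  have pw: "awalk u p u'" using pH(1) subgraph_awalk_imp_awalk[OF _ subgraph_del_vert] by blast
  have vs: "H.awalk_verts u p = awalk_verts u p"
    using compatible_awalk_verts[OF comp] by simp
  have w: "w \<notin> set (awalk_verts u p)"
    using H.awalk_verts_in_verts[of u p w] pH(1) vs by (auto simp: H.awalk_def verts_del_vert)
  obtain e0 where e0: "e0 \<in> arcs T" "tail T e0 = w" "head T e0 = u"
    using assms(1) by (auto simp: nbrs_def arcs_ends_def arc_to_ends_def)
  have "u' \<rightarrow>\<^bsub>T\<^esub> w" using assms(2) adj_commute by (auto simp: nbrs_def)
  then obtain e1 where e1: "e1 \<in> arcs T" "tail T e1 = u'" "head T e1 = w"
    by (auto simp: arcs_ends_def arc_to_ends_def)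
  have aw: "awalk w (e0 # p @ [e1]) w"
    using e0 e1 pw root by (auto simp: awalk_simps)
  have "tl (awalk_verts w (e0 # p @ [e1])) = awalk_verts u p @ [w]"
    using e0 e1 pw awalk_verts_append[of u p "[e1]" w] by (auto simp: awalk_simps)
  then have "cycle (e0 # p @ [e1])"
    unfolding cycle_def using aw pH(2) vs w by auto
  \<comment> \<open>Since \<open>u \<noteq> u'\<close>, the path \<open>p\<close> has an arc, so the
    closed walk is longer than a mere traversal of one edge back and forth.\<close>
  moreover have "3 \<le> length (e0 # p @ [e1])"
    using pw ne by (cases p) (auto simp: awalk_simps)
  ultimately show False using tree by (auto simp: undirected_tree_def)
qed

lemma bverts_disjoint:
  assumes "u \<in> nbrs" "u' \<in> nbrs" "u \<noteq> u'"
  shows "bverts u \<inter> bverts u' = {}"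
proof (rule ccontr)
  assume "bverts u \<inter> bverts u' \<noteq> {}"
  then obtain x where "u \<rightarrow>\<^sup>*\<^bsub>H\<^esub> x" "u' \<rightarrow>\<^sup>*\<^bsub>H\<^esub> x" by (auto simp: mem_bverts_iff)
  then have "u \<rightarrow>\<^sup>*\<^bsub>H\<^esub> u'"
    using symmetric_reachable[OF H.sym_arcs] H.reachable_trans by blast
  then show False using nbr_unique assms by blast
qed

lemma no_cross_adj:
  assumes "u \<in> nbrs" "u' \<in> nbrs" "u \<noteq> u'" "i \<in> bverts u" "j \<in> bverts u'"
  shows "\<not> i \<rightarrow>\<^bsub>T\<^esub> j"
proof
  assume "i \<rightarrow>\<^bsub>T\<^esub> j"
  then have "i \<rightarrow>\<^bsub>H\<^esub> j" using assms(4,5) bverts_subset by (auto simp: adj_H_iff)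
  then have "j \<in> bverts u"
    using assms(4) unfolding mem_bverts_iff by (meson H.reachable_adj_trans)
  then show False using bverts_disjoint assms by blast
qed

lemma root_adj:
  assumes "u \<in> nbrs" "i \<in> bverts u" "i \<noteq> u"
  shows "\<not> w \<rightarrow>\<^bsub>T\<^esub> i" "\<not> i \<rightarrow>\<^bsub>T\<^esub> w"
proof -
  show "\<not> w \<rightarrow>\<^bsub>T\<^esub> i"
    using nbr_unique[of u i] assms by (auto simp: nbrs_def mem_bverts_iff)
  then show "\<not> i \<rightarrow>\<^bsub>T\<^esub> w" using adj_commute by blast
qed

text \<open>A walk from \<open>w\<close> lies, after each return to \<open>w\<close>, in the branch
  of the neighbour it enters next.\<close>

lemma verts_eq: "verts T = insert w (\<Union>u\<in>nbrs. bverts u)"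
proof
  have "x = w \<or> (\<exists>u\<in>nbrs. u \<rightarrow>\<^sup>*\<^bsub>H\<^esub> x)" if "w \<rightarrow>\<^sup>*\<^bsub>T\<^esub> x" for x
    using that
  proof (induction rule: reachable_induct)
    case base
    then show ?case by simp
  next
    case (step x y)
    show ?case
    proof (cases "y = w \<or> x = w")
      case True
      then show ?thesis
        using step nbr_in_bverts[of y] by (auto simp: nbrs_def mem_bverts_iff)
    next
      case False
      then have "x \<rightarrow>\<^bsub>H\<^esub> y" using step by (simp add: adj_H_iff)
      then show ?thesis using step.IH False by (meson H.reachable_adj_trans)
    qed
  qed
  moreover have "w \<rightarrow>\<^sup>*\<^bsub>T\<^esub> x" if "x \<in> verts T" for x
  proof -
    have "strongly_connected T"
      using tree symmetric_connected_imp_strongly_connected[OF sym_arcs]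
      by (simp add: undirected_tree_def)
    then show ?thesis using that root by (simp add: strongly_connected_def)
  qed
  ultimately show "verts T \<subseteq> insert w (\<Union>u\<in>nbrs. bverts u)"
    using mem_bverts_iff by blast
qed (use root bverts_subset in auto)

lemma adj_branch_iff:
  assumes "i \<in> bverts u" "j \<in> bverts u"
  shows "i \<rightarrow>\<^bsub>branch T w u\<^esub> j \<longleftrightarrow> i \<rightarrow>\<^bsub>T\<^esub> j"
proof -
  have "i \<rightarrow>\<^bsub>branch T w u\<^esub> j \<longleftrightarrow> i \<rightarrow>\<^bsub>H\<^esub> j"
    using assms unfolding verts_branch branch_def Let_def
    by (force simp: arcs_ends_def arc_to_ends_def induce_subgraph_def)
  then show ?thesis using assms bverts_subset by (auto simp: adj_H_iff)
qed

text \<open>By connectedness every component left after deleting \<open>w\<close> contains a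
  neighbour of \<open>w\<close>, and is therefore a branch.\<close>

lemma odd_components_eq:
  "odd_components H = branch T w ` {u \<in> nbrs. odd (card (bverts u))}"
proof -
  have scc: "H.scc_of x = bverts u" if "x \<in> bverts u" for x u
  proof -
    have "u \<rightarrow>\<^sup>*\<^bsub>H\<^esub> x" using that by (simp only: mem_bverts_iff)
    moreover from this have "x \<rightarrow>\<^sup>*\<^bsub>H\<^esub> u" by (rule symmetric_reachable[OF H.sym_arcs])
    ultimately have "x \<rightarrow>\<^sup>*\<^bsub>H\<^esub> y \<longleftrightarrow> u \<rightarrow>\<^sup>*\<^bsub>H\<^esub> y" for y
      by (meson H.reachable_trans)
    then have "bverts x = bverts u" by (auto simp only: mem_bverts_iff set_eq_iff)
    then show ?thesis by (simp only: verts_branch)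
  qed
  have "H.sccs_verts = bverts ` nbrs"
  proof -
    have "verts H = (\<Union>u\<in>nbrs. bverts u)"
      using verts_eq bverts_subset by (auto simp: verts_del_vert)
    then have "H.sccs_verts = (\<Union>u\<in>nbrs. H.scc_of ` bverts u)"
      unfolding H.sccs_verts_conv_scc_of by (simp only: image_UN)
    also have "\<dots> = (\<Union>u\<in>nbrs. {bverts u})"
    proof (rule SUP_cong[OF refl])
      fix u assume "u \<in> nbrs"
      from nbr_in_bverts[OF this] show "H.scc_of ` bverts u = {bverts u}"
        using scc by (intro equalityI subsetI) (auto simp: image_iff)
    qed
    finally show ?thesis by auto
  qed
  then have "H.sccs = branch T w ` nbrs"
    unfolding H.sccs_conv_sccs_verts by (auto simp: branch_def Let_def verts_branch image_image)
  then show ?thesis by (auto simp: odd_components_def bverts_def)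
qed

text \<open>Distinct neighbours have disjoint branches, so the parity condition may be read as a
  count of neighbours.\<close>

lemma card_odd_components:
  "card (odd_components H) = card {u \<in> nbrs. odd (card (bverts u))}"
proof -
  have "inj_on (branch T w) nbrs"
  proof (rule inj_onI)
    fix u u' assume "u \<in> nbrs" "u' \<in> nbrs" "branch T w u = branch T w u'"
    then show "u = u'"
      using bverts_disjoint[of u u'] nbr_in_bverts[of u] by (auto simp: bverts_def)
  qed
  then show ?thesis unfolding odd_components_eq
    by (intro card_image) (auto simp: inj_on_def)
qed

end

section \<open>Realization on nearly even branching trees\<close>

lemma sum_prod_remove_reindex:
  fixes c f :: "nat \<Rightarrow> 'a::comm_ring_1"
  assumes "bij_betw e {..<r} K"
  shows "(\<Sum>k<r. c (e k) * (\<Prod>j\<in>{..<r} - {k}. f (e j))) = (\<Sum>k\<in>K. c k * (\<Prod>j\<in>K - {k}. f j))"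
proof -
  have "(\<Prod>j\<in>{..<r} - {k}. f (e j)) = (\<Prod>j\<in>K - {e k}. f j)" if "k < r" for k
  proof (rule prod.reindex_bij_betw)
    show "bij_betw e ({..<r} - {k}) (K - {e k})"
      using bij_betw_subset[OF assms, of "{..<r} - {k}"] assms that
      by (auto simp: bij_betw_def inj_on_image_set_diff[of e "{..<r}"])
  qed
  then have "(\<Sum>k<r. c (e k) * (\<Prod>j\<in>{..<r} - {k}. f (e j)))
    = (\<Sum>k<r. c (e k) * (\<Prod>j\<in>K - {e k}. f j))" by simp
  also have "\<dots> = (\<Sum>k\<in>K. c k * (\<Prod>j\<in>K - {k}. f j))"
    by (rule sum.reindex_bij_betw[OF assms])
  finally show ?thesis .
qed

text \<open>Formally both sides are the sum of all \<open>c k / f k\<close> times the product of all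
  \<open>f j\<close>, grouped by blocks on the left; no division is performed because the
  \<open>f j\<close> may vanish.\<close>

lemma sum_prod_remove_partition:
  fixes c f :: "nat \<Rightarrow> 'a::comm_ring_1"
  assumes N: "finite N" and K: "\<And>u. u \<in> N \<Longrightarrow> finite (K u)"
    and disj: "\<And>u u'. u \<in> N \<Longrightarrow> u' \<in> N \<Longrightarrow> u \<noteq> u' \<Longrightarrow> K u \<inter> K u' = {}"
  shows "(\<Sum>u\<in>N. (\<Sum>k\<in>K u. c k * (\<Prod>j\<in>K u - {k}. f j)) * (\<Prod>x\<in>N - {u}. \<Prod>j\<in>K x. f j))
    = (\<Sum>k\<in>(\<Union>u\<in>N. K u). c k * (\<Prod>j\<in>(\<Union>u\<in>N. K u) - {k}. f j))"
proof -
  have split: "(\<Prod>j\<in>K u - {k}. f j) * (\<Prod>x\<in>N - {u}. \<Prod>j\<in>K x. f j)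
    = (\<Prod>j\<in>(\<Union>u\<in>N. K u) - {k}. f j)" if u: "u \<in> N" "k \<in> K u" for u k
  proof -
    have "(\<Prod>x\<in>N - {u}. \<Prod>j\<in>K x. f j) = (\<Prod>j\<in>(\<Union>x\<in>N - {u}. K x). f j)"
      by (rule prod.UNION_disjoint[symmetric]) (use N K disj in auto)
    moreover have "(\<Union>u\<in>N. K u) - {k} = (K u - {k}) \<union> (\<Union>x\<in>N - {u}. K x)"
      using u disj by blast
    moreover have "(K u - {k}) \<inter> (\<Union>x\<in>N - {u}. K x) = {}" using u disj by blast
    ultimately show ?thesis
      using N K u by (simp add: prod.union_disjoint)
  qed
  have "(\<Sum>k\<in>(\<Union>u\<in>N. K u). c k * (\<Prod>j\<in>(\<Union>u\<in>N. K u) - {k}. f j))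
    = (\<Sum>u\<in>N. \<Sum>k\<in>K u. c k * (\<Prod>j\<in>(\<Union>u\<in>N. K u) - {k}. f j))"
    by (rule sum.UNION_disjoint) (use N K disj in auto)
  also have "\<dots> = (\<Sum>u\<in>N. \<Sum>k\<in>K u. c k * ((\<Prod>j\<in>K u - {k}. f j) * (\<Prod>x\<in>N - {u}. \<Prod>j\<in>K x. f j)))"
    by (intro sum.cong refl) (simp add: split)
  finally show ?thesis by (simp add: sum_distrib_right mult.assoc)
qed

text \<open>For skew-symmetric \<open>A\<close> this is the Hermitian pencil \<open>y I + \<i> A\<close>; it is singular iff
  \<open>\<i> y\<close> is an eigenvalue of \<open>A\<close>.\<close>

definition pencil :: "real \<Rightarrow> (nat \<Rightarrow> nat \<Rightarrow> real) \<Rightarrow> nat \<Rightarrow> nat \<Rightarrow> complex" where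
  "pencil y A i j = (if i = j then of_real y else 0) + \<i> * of_real (A i j)"

text \<open>The characteristic polynomials of \<open>A\<close> and \<open>A(w)\<close> are, up to one factor \<open>y\<close>, polynomials in
  \<open>y\<^sup>2\<close>. The parity factors make the formulas uniform: for a tree of even order the root
  \<open>a 0 = 0\<close> stands for the single factor \<open>y\<close> of \<open>A(w)\<close>. Everything depends continuously on a
  parameter \<open>s \<in> S\<close>, which is needed for the perturbation argument.\<close>

definition realizes ::
  "nat \<Rightarrow> 's::topological_space set \<Rightarrow> (nat, 'b) pre_digraph \<Rightarrow> nat \<Rightarrow> (nat \<Rightarrow> 's \<Rightarrow> real) \<Rightarrow>
    (nat \<Rightarrow> 's \<Rightarrow> real) \<Rightarrow> (nat \<Rightarrow> nat \<Rightarrow> 's \<Rightarrow> real) \<Rightarrow> bool" where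
  "realizes n S T w a b A \<longleftrightarrow>
     (\<forall>i j. continuous_on S (A i j)) \<and> (\<forall>s\<in>S. \<forall>i j. A i j s = - A j i s) \<and>
     (\<forall>s\<in>S. \<forall>i j. A i j s \<noteq> 0 \<longleftrightarrow> i \<rightarrow>\<^bsub>T\<^esub> j) \<and>
     (\<forall>s\<in>S. \<forall>y. y \<noteq> 0 \<longrightarrow>
        (if even (card (verts T)) then of_real y else 1) * pdet n (verts T) (pencil y (\<lambda>i j. A i j s))
          = of_real (y * (\<Prod>k<card (verts T) div 2. y\<^sup>2 - b k s)) \<and>
        (if even (card (verts T)) then of_real y else 1) * pdet n (verts T - {w}) (pencil y (\<lambda>i j. A i j s))
          = of_real (\<Prod>k<card (verts T) div 2. y\<^sup>2 - a k s))"

lemma realizesD: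
  assumes "realizes n S T w a b A"
  shows "continuous_on S (A i j)" and "s \<in> S \<Longrightarrow> A i j s = - A j i s"
    and "s \<in> S \<Longrightarrow> A i j s \<noteq> 0 \<longleftrightarrow> i \<rightarrow>\<^bsub>T\<^esub> j"
    and "s \<in> S \<Longrightarrow> y \<noteq> 0 \<Longrightarrow>
      (if even (card (verts T)) then of_real y else 1) * pdet n (verts T) (pencil y (\<lambda>i j. A i j s))
        = of_real (y * (\<Prod>k<card (verts T) div 2. y\<^sup>2 - b k s))"
    and "s \<in> S \<Longrightarrow> y \<noteq> 0 \<Longrightarrow>
      (if even (card (verts T)) then of_real y else 1) * pdet n (verts T - {w}) (pencil y (\<lambda>i j. A i j s))
        = of_real (\<Prod>k<card (verts T) div 2. y\<^sup>2 - a k s)"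
  using assms unfolding realizes_def by blast+

lemma pencil_cong:
  assumes "A i j = B i j"
  shows "pencil y A i j = pencil y B i j"
  using assms by (simp add: pencil_def)

lemma (in rooted_tree) sum_card_bverts: "(\<Sum>u\<in>nbrs. card (bverts u)) + 1 = card (verts T)"
proof -
  have "card (verts T) = card (\<Union>u\<in>nbrs. bverts u) + 1"
    unfolding verts_eq using bverts_subset finite_nbrs finite_subset[OF bverts_subset]
    by (subst card_insert_disjoint) auto
  also have "card (\<Union>u\<in>nbrs. bverts u) = (\<Sum>u\<in>nbrs. card (bverts u))"
    by (rule card_UN_disjoint) (use finite_nbrs finite_subset[OF bverts_subset] bverts_disjoint in auto)
  finally show ?thesis by simp
qed

text \<open>The summand \<open>(f u + 1) div 2\<close> is the number of poles taken by a branch with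
  \<open>f u\<close> vertices; rounding up costs one half for each odd branch.\<close>

lemma sum_half_round_up:
  fixes f :: "'a \<Rightarrow> nat"
  assumes "finite N"
  shows "2 * (\<Sum>u\<in>N. (f u + 1) div 2) = (\<Sum>u\<in>N. f u) + card {u \<in> N. odd (f u)}"
proof -
  have "2 * ((f u + 1) div 2) = f u + (if odd (f u) then 1 else 0)" for u
    by (auto elim!: evenE oddE)
  then have "2 * (\<Sum>u\<in>N. (f u + 1) div 2) = (\<Sum>u\<in>N. f u) + (\<Sum>u\<in>N. if odd (f u) then 1 else 0)"
    by (simp add: sum_distrib_left sum.distrib)
  also have "(\<Sum>u\<in>N. if odd (f u) then 1 else 0) = card {u \<in> N. odd (f u)}"
    using assms by (simp add: sum.If_cases Int_def)
  finally show ?thesis .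
qed

lemma realizes_single:
  assumes T: "undirected_tree T" "w \<in> verts T" and card: "card (verts T) = 1" and n: "verts T \<subseteq> {..<n}"
  shows "realizes n S T w a b (\<lambda>i j s. 0)"
proof -
  interpret rooted_tree T w using T by unfold_locales
  have V: "verts T = {w}" using card T(2) by (metis card_1_singletonE singletonD)
  have noarc: "\<not> i \<rightarrow>\<^bsub>T\<^esub> j" for i j
    using adj_in_verts[of i j] adj_not_same[of i] unfolding V by auto
  have "pdet n {w} (pencil y (\<lambda>i j. 0)) = of_real y" for y
    by (subst pdet_isolated_row[of w]) (use n V in \<open>auto simp: pencil_def\<close>)
  then show ?thesis using noarc by (simp add: realizes_def card V)
qed

text \<open>\<open>K\<close> distributes the poles of the root over the branches; the squared weight of the edge
  to \<open>u\<close> is the total residue of the poles assigned to \<open>u\<close>.\<close>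

lemma realizes_glue:
  fixes T :: "(nat, 'b) pre_digraph" and a b :: "nat \<Rightarrow> 's::topological_space \<Rightarrow> real"
    and w :: nat
  defines "N \<equiv> {u. w \<rightarrow>\<^bsub>T\<^esub> u}" and "W \<equiv> \<lambda>u. verts (branch T w u)"
    and "h \<equiv> card (verts T) div 2"
    and "c \<equiv> \<lambda>k s. pf_weight (card (verts T) div 2) (\<lambda>k. a k s) (\<lambda>k. b k s) k"
  assumes T: "undirected_tree T" "w \<in> verts T" and n: "verts T \<subseteq> {..<n}"
    and cont: "\<And>k. k < h \<Longrightarrow> continuous_on S (a k)" "\<And>k. k < h \<Longrightarrow> continuous_on S (b k)"
    and I: "\<And>s. s \<in> S \<Longrightarrow> interlacing h (\<lambda>k. a k s) (\<lambda>k. b k s)"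
    and K: "(\<Union>u\<in>N. K u) = {..<h}" "\<And>u u'. u \<in> N \<Longrightarrow> u' \<in> N \<Longrightarrow> u \<noteq> u' \<Longrightarrow> K u \<inter> K u' = {}"
      "\<And>u. u \<in> N \<Longrightarrow> K u \<noteq> {}"
    and odd: "card {u \<in> N. odd (card (W u))} = (if even (card (verts T)) then 1 else 0)"
    and B: "\<And>u i j. u \<in> N \<Longrightarrow> continuous_on S (B u i j)"
      "\<And>u s i j. u \<in> N \<Longrightarrow> s \<in> S \<Longrightarrow> B u i j s = - B u j i s"
      "\<And>u s i j. u \<in> N \<Longrightarrow> s \<in> S \<Longrightarrow> B u i j s \<noteq> 0 \<longleftrightarrow> i \<rightarrow>\<^bsub>branch T w u\<^esub> j"
    and P: "\<And>u s y. u \<in> N \<Longrightarrow> s \<in> S \<Longrightarrow> y \<noteq> 0 \<Longrightarrow>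
      (if odd (card (W u)) then of_real y else 1) * pdet n (W u) (pencil y (\<lambda>i j. B u i j s))
        = of_real (\<Prod>k\<in>K u. y\<^sup>2 - a k s)"
    and Q: "\<And>u s y. u \<in> N \<Longrightarrow> s \<in> S \<Longrightarrow> y \<noteq> 0 \<Longrightarrow>
      of_real (\<Sum>k\<in>K u. c k s) *
      ((if odd (card (W u)) then of_real y else 1) * pdet n (W u - {u}) (pencil y (\<lambda>i j. B u i j s)))
        = of_real (y * (\<Sum>k\<in>K u. c k s * (\<Prod>j\<in>K u - {k}. y\<^sup>2 - a j s)))"
  shows "\<exists>A. realizes n S T w a b A"
proof -
  interpret rooted_tree T w using T by unfold_locales
  have N: "nbrs = N" by (simp add: nbrs_def N_def)
  have W: "bverts u = W u" for u by (simp add: bverts_def W_def)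
  have Wsub: "W u \<subseteq> verts T - {w}" for u using bverts_subset[of u] by (simp add: W)
  have uW: "u \<in> W u" if "u \<in> N" for u using nbr_in_bverts[of u] that by (simp add: N W)
  have disj: "W u \<inter> W u' = {}" if "u \<in> N" "u' \<in> N" "u \<noteq> u'" for u u'
    using bverts_disjoint[of u u'] that by (simp add: N W)
  have finN: "finite N" using finite_nbrs by (simp add: N)
  have wN: "w \<notin> N" using nbrs_subset by (auto simp: N)
  have finK: "finite (K u)" "K u \<subseteq> {..<h}" if "u \<in> N" for u
    using K(1) that finite_subset[of "K u" "{..<h}"] by auto
  have B0: "B u i j s = 0" if "u \<in> N" "s \<in> S" "i \<notin> W u \<or> j \<notin> W u" for u i j s
  proof (rule ccontr)
    assume "B u i j s \<noteq> 0"
    then have "i \<rightarrow>\<^bsub>branch T w u\<^esub> j" using B(3) that by blast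
    then have "i \<in> W u \<and> j \<in> W u"
      by (auto simp: W_def branch_def Let_def arcs_ends_def arc_to_ends_def)
    then show False using that by blast
  qed
  define C where "C u s = (\<Sum>k\<in>K u. c k s)" for u s
  have cpos: "0 < c k s" if "k < h" "s \<in> S" for k s
    using pf_weight_pos[OF I[OF that(2)] that(1)] by (simp add: c_def h_def)
  have Cpos: "0 < C u s" if "u \<in> N" "s \<in> S" for u s
    unfolding C_def by (rule sum_pos) (use finK[OF that(1)] K(3)[OF that(1)] cpos that(2) in auto)
  have contC: "continuous_on S (C u)" if "u \<in> N" for u
  proof -
    have "continuous_on S (c k)" if "k < h" for k
      unfolding c_def using continuous_on_pf_weight[of h S a b k] cont I that by (simp add: h_def)
    then have "continuous_on S (\<lambda>s. \<Sum>k\<in>K u. c k s)"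
      using finK[OF that] by (intro continuous_on_sum) auto
    then show ?thesis by (simp add: C_def[abs_def])
  qed
  \<comment> \<open>Opposite signs in row and column \<open>w\<close> make the matrix
    skew-symmetric. Elsewhere at most one \<open>B u\<close> is nonzero at a given position, so the
    sum merely glues the branch matrices together.\<close>
  define A where "A i j s = (if i = w \<and> j \<in> N then sqrt (C j s) else if j = w \<and> i \<in> N then - sqrt (C i s)
    else \<Sum>u\<in>N. B u i j s)" for i j s
  have AB: "A i j s = B u i j s" if "u \<in> N" "s \<in> S" "i \<in> W u" "j \<in> W u" for u s i j
  proof -
    have "i \<noteq> w" "j \<noteq> w" using that Wsub by auto
    then have "A i j s = (\<Sum>x\<in>N. B x i j s)" by (simp add: A_def)
    also have "\<dots> = (\<Sum>x\<in>N. if x = u then B u i j s else 0)"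
    proof (rule sum.cong[OF refl])
      fix x assume "x \<in> N"
      then show "B x i j s = (if x = u then B u i j s else 0)"
        using disj[of u x] that B0[of x s i j] by (cases "x = u") auto
    qed
    finally show ?thesis using that finN by simp
  qed
  have A0: "A i j s = 0" if "s \<in> S" "\<not> (i = w \<and> j \<in> N)" "\<not> (j = w \<and> i \<in> N)"
    "\<And>u. u \<in> N \<Longrightarrow> i \<notin> W u \<or> j \<notin> W u" for i j s
    using that B0 by (auto simp: A_def intro!: sum.neutral)
  have supp: "A i j s \<noteq> 0 \<longleftrightarrow> i \<rightarrow>\<^bsub>T\<^esub> j" if s: "s \<in> S" for i j s
  proof (cases "\<exists>u\<in>N. i \<in> W u \<and> j \<in> W u")
    case True
    then obtain u where u: "u \<in> N" "i \<in> W u" "j \<in> W u" by blast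
    then show ?thesis
      using AB[OF u(1) s u(2,3)] B(3)[OF u(1) s] adj_branch_iff[of i u j] by (simp add: W)
  next
    case no: False
    show ?thesis
    proof (cases "i = w \<and> j \<in> N")
      case True
      then show ?thesis using Cpos[OF _ s, of j] by (simp add: A_def N_def)
    next
      case no1: False
      show ?thesis
      proof (cases "j = w \<and> i \<in> N")
        case True
        then have "i \<rightarrow>\<^bsub>T\<^esub> j" using adj_commute by (simp add: N_def)
        moreover have "A i j s = - sqrt (C i s)" using True wN by (auto simp: A_def)
        ultimately show ?thesis using Cpos[OF _ s, of i] True by simp
      next
        case no2: False
        have "\<not> i \<rightarrow>\<^bsub>T\<^esub> j"
        proof
          assume adj: "i \<rightarrow>\<^bsub>T\<^esub> j"
          have nw: "i \<noteq> w" "j \<noteq> w" using no1 no2 adj adj_commute by (auto simp: N_def)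
          then obtain u u' where "u \<in> N" "i \<in> W u" "u' \<in> N" "j \<in> W u'"
            using adj adj_in_verts[OF adj] verts_eq by (auto simp: N W)
          then show False using no_cross_adj[of u u' i j] no adj by (auto simp: N W)
        qed
        then show ?thesis using A0[OF s no1 no2] no by blast
      qed
    qed
  qed
  have skew: "A i j s = - A j i s" if "s \<in> S" for i j s
    using wN B(2)[OF _ that, of _ i j] by (auto simp: A_def sum_negf[symmetric] intro!: sum.cong)
  have contA: "continuous_on S (A i j)" for i j
  proof -
    consider "i = w" "j \<in> N" | "j = w" "i \<in> N" | "\<not> (i = w \<and> j \<in> N)" "\<not> (j = w \<and> i \<in> N)" by blast
    then show ?thesis
    proof cases
      case 1
      then show ?thesis by (auto simp: A_def[abs_def] intro!: continuous_intros contC)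
    next
      case 2
      then show ?thesis using wN by (auto simp: A_def[abs_def] intro!: continuous_intros contC)
    next
      case 3
      then have "A i j = (\<lambda>s. \<Sum>u\<in>N. B u i j s)" by (auto simp: A_def)
      then show ?thesis by (auto intro!: continuous_intros B(1))
    qed
  qed
  have main: "(if even (card (verts T)) then of_real y else 1) * pdet n (verts T) (pencil y (\<lambda>i j. A i j s))
        = of_real (y * (\<Prod>k<h. y\<^sup>2 - b k s))
      \<and> (if even (card (verts T)) then of_real y else 1) * pdet n (verts T - {w}) (pencil y (\<lambda>i j. A i j s))
          = of_real (\<Prod>k<h. y\<^sup>2 - a k s)" if s: "s \<in> S" and y: "y \<noteq> 0" for s y
  proof -
    let ?M = "pencil y (\<lambda>i j. A i j s)"
    define Y where "Y = complex_of_real y"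
    \<comment> \<open>The parity factor of branch \<open>u\<close>. The product over all branches is
      the parity factor of the whole tree, because the number of odd branches is 1 or 0
      accordingly.\<close>
    define g where "g u = (if odd (card (W u)) then Y else 1)" for u
    define p where "p u = pdet n (W u) (pencil y (\<lambda>i j. B u i j s))" for u
    define q where "q u = pdet n (W u - {u}) (pencil y (\<lambda>i j. B u i j s))" for u
    define f where "f k = complex_of_real (y\<^sup>2 - a k s)" for k
    have gp: "g u * p u = (\<Prod>k\<in>K u. f k)" if "u \<in> N" for u
      unfolding g_def p_def f_def Y_def using P[OF that s y] by (simp only: of_real_prod)
    have gq: "of_real (C u s) * (g u * q u) = Y * (\<Sum>k\<in>K u. of_real (c k s) * (\<Prod>j\<in>K u - {k}. f j))"
      if "u \<in> N" for u
      unfolding g_def q_def f_def Y_def C_def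
      using Q[OF that s y] by (simp only: of_real_mult of_real_sum of_real_prod)
    have Mp: "pdet n (W u) ?M = p u" if "u \<in> N" for u
      unfolding p_def by (rule pdet_cong, rule pencil_cong) (use AB that s in auto)
    have Mq: "pdet n (W u - {u}) ?M = q u" if "u \<in> N" for u
      unfolding q_def by (rule pdet_cong, rule pencil_cong) (use AB that s in auto)
    have gN: "(\<Prod>u\<in>N. g u) = (if even (card (verts T)) then Y else 1)"
    proof -
      have "(\<Prod>u\<in>N. g u) = (\<Prod>u\<in>{u \<in> N. odd (card (W u))}. Y)"
        using finN by (simp add: g_def prod.If_cases Int_def)
      then show ?thesis using odd by simp
    qed
    have cross: "?M i j = 0" if "u \<in> N" "u' \<in> N" "u \<noteq> u'" "i \<in> W u" "j \<in> W u'" for u u' i j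
    proof -
      have "A i j s = 0" using supp[OF s, of i j] no_cross_adj[of u u' i j] that by (auto simp: N W)
      moreover have "i \<noteq> j" using disj that by blast
      ultimately show ?thesis by (simp add: pencil_def)
    qed
    have rt: "?M w i = 0 \<and> ?M i w = 0" if "u \<in> N" "i \<in> W u" "i \<noteq> u" for u i
    proof -
      have "A w i s = 0" "A i w s = 0"
        using supp[OF s] root_adj[of u i] that by (auto simp: N W)
      moreover have "i \<noteq> w" using that Wsub by blast
      ultimately show ?thesis by (simp add: pencil_def)
    qed
    have V: "verts T = insert w (\<Union>u\<in>N. W u)" using verts_eq by (simp add: N W)
    have wW: "w \<notin> W u" for u using Wsub by blast
    have star: "pdet n (verts T) ?M = ?M w w * (\<Prod>u\<in>N. pdet n (W u) ?M)
      - (\<Sum>u\<in>N. ?M w u * ?M u w * (pdet n (W u - {u}) ?M * (\<Prod>x\<in>N - {u}. pdet n (W x) ?M)))"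
      unfolding V
    proof (rule pdet_star[OF finN])
      show "w < n" using n T(2) by auto
      show "u \<in> W u \<and> w \<notin> W u \<and> W u \<subseteq> {..<n}" if "u \<in> N" for u
        using uW[OF that] Wsub[of u] n by blast
    qed (use disj cross rt in blast)+
    have "A w w s = 0" using skew[OF s, of w w] by simp
    then have Mww: "?M w w = Y" by (simp add: pencil_def Y_def)
    \<comment> \<open>The square of the imaginary unit and the skew sign cancel, leaving a positive
      squared weight.\<close>
    have Mwu: "?M w u * ?M u w = of_real (C u s)" if "u \<in> N" for u
    proof -
      have "u \<noteq> w" using that wN by blast
      then have "?M w u = \<i> * of_real (sqrt (C u s))" "?M u w = - (\<i> * of_real (sqrt (C u s)))"
        using that wN by (auto simp: pencil_def A_def)
      moreover have "\<i> * x * - (\<i> * x) = x * x" for x :: complex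
      proof -
        have "\<i> * x * - (\<i> * x) = - (\<i> * \<i>) * (x * x)"
          by (simp only: mult_minus_left mult_minus_right mult.assoc mult.commute mult.left_commute)
        then show ?thesis by simp
      qed
      ultimately have "?M w u * ?M u w = of_real (sqrt (C u s) * sqrt (C u s))"
        by (simp only: of_real_mult)
      then show ?thesis using Cpos[OF that s] by simp
    qed
    have "pdet n (verts T) ?M = Y * (\<Prod>u\<in>N. p u)
      - (\<Sum>u\<in>N. of_real (C u s) * (q u * (\<Prod>x\<in>N - {u}. p x)))"
      unfolding star Mww by (simp add: Mwu Mp Mq)
    \<comment> \<open>Distributing one \<open>g u\<close> to each branch determinant turns the star
      formula into a partial fraction in \<open>y\<^sup>2\<close> over all poles.\<close>
    then have "(\<Prod>u\<in>N. g u) * pdet n (verts T) ?M = (\<Prod>u\<in>N. g u) * (Y * (\<Prod>u\<in>N. p u))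
      - (\<Sum>u\<in>N. (\<Prod>u\<in>N. g u) * (of_real (C u s) * (q u * (\<Prod>x\<in>N - {u}. p x))))"
      by (simp only: right_diff_distrib sum_distrib_left)
    also have "(\<Prod>u\<in>N. g u) * (Y * (\<Prod>u\<in>N. p u)) = Y * (\<Prod>u\<in>N. g u * p u)"
      by (simp add: prod.distrib)
    also have "(\<Sum>u\<in>N. (\<Prod>u\<in>N. g u) * (of_real (C u s) * (q u * (\<Prod>x\<in>N - {u}. p x))))
      = (\<Sum>u\<in>N. Y * ((\<Sum>k\<in>K u. of_real (c k s) * (\<Prod>j\<in>K u - {k}. f j)) * (\<Prod>x\<in>N - {u}. \<Prod>j\<in>K x. f j)))"
    proof (rule sum.cong[OF refl])
      fix u assume u: "u \<in> N"
      have "(\<Prod>u\<in>N. g u) * (of_real (C u s) * (q u * (\<Prod>x\<in>N - {u}. p x)))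
        = (of_real (C u s) * (g u * q u)) * (\<Prod>x\<in>N - {u}. g x * p x)"
        unfolding prod.remove[OF finN u] by (simp add: prod.distrib algebra_simps)
      also have "(\<Prod>x\<in>N - {u}. g x * p x) = (\<Prod>x\<in>N - {u}. \<Prod>j\<in>K x. f j)"
        by (rule prod.cong) (use gp in auto)
      finally show "(\<Prod>u\<in>N. g u) * (of_real (C u s) * (q u * (\<Prod>x\<in>N - {u}. p x)))
        = Y * ((\<Sum>k\<in>K u. of_real (c k s) * (\<Prod>j\<in>K u - {k}. f j)) * (\<Prod>x\<in>N - {u}. \<Prod>j\<in>K x. f j))"
        unfolding gq[OF u] by (simp add: algebra_simps)
    qed
    also have "\<dots> = Y * (\<Sum>k<h. of_real (c k s) * (\<Prod>j\<in>{..<h} - {k}. f j))"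
      unfolding sum_distrib_left[symmetric] K(1)[symmetric]
      by (subst sum_prod_remove_partition) (use finN finK K in auto)
    also have gpN: "(\<Prod>u\<in>N. g u * p u) = (\<Prod>k<h. f k)"
    proof -
      have "(\<Prod>u\<in>N. g u * p u) = (\<Prod>u\<in>N. \<Prod>k\<in>K u. f k)" by (rule prod.cong) (use gp in auto)
      also have "\<dots> = (\<Prod>k<h. f k)"
        unfolding K(1)[symmetric] by (rule prod.UNION_disjoint[symmetric]) (use finN finK K in auto)
      finally show ?thesis .
    qed
    finally have "(\<Prod>u\<in>N. g u) * pdet n (verts T) ?M
      = of_real (y * ((\<Prod>k<h. y\<^sup>2 - a k s) - (\<Sum>k<h. c k s * (\<Prod>j\<in>{..<h} - {k}. y\<^sup>2 - a j s))))"
      by (simp add: f_def Y_def algebra_simps)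
    also have "\<dots> = of_real (y * (\<Prod>k<h. y\<^sup>2 - b k s))"
      using pf_weight_expansion[OF I[OF s], of "y\<^sup>2"] by (simp add: c_def h_def)
    finally have 1: "(\<Prod>u\<in>N. g u) * pdet n (verts T) ?M = of_real (y * (\<Prod>k<h. y\<^sup>2 - b k s))" .
    have "verts T - {w} = (\<Union>u\<in>N. W u)" using V wW by auto
    moreover have "pdet n (\<Union>u\<in>N. W u) ?M = (\<Prod>u\<in>N. pdet n (W u) ?M)"
    proof (rule pdet_disjoint_blocks[OF finN])
      show "W u \<subseteq> {..<n}" for u using Wsub[of u] n by blast
      show "W u \<inter> W u' = {}" if "u \<in> N" "u' \<in> N" "u \<noteq> u'" for u u' by (rule disj[OF that])
      show "?M i j = 0" if "u \<in> N" "u' \<in> N" "u \<noteq> u'" "i \<in> W u" "j \<in> W u'" for u u' i j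
        by (rule cross[OF that])
    qed
    ultimately have "pdet n (verts T - {w}) ?M = (\<Prod>u\<in>N. pdet n (W u) ?M)" by (simp only:)
    also have "\<dots> = (\<Prod>u\<in>N. p u)" by (rule prod.cong) (use Mp in auto)
    finally have "(\<Prod>u\<in>N. g u) * pdet n (verts T - {w}) ?M = (\<Prod>k<h. f k)"
      using gpN by (simp add: prod.distrib)
    then have "(\<Prod>u\<in>N. g u) * pdet n (verts T - {w}) ?M = of_real (\<Prod>k<h. y\<^sup>2 - a k s)"
      by (simp only: f_def of_real_prod)
    with 1 show ?thesis unfolding gN Y_def by (rule conjI)
  qed
  have "realizes n S T w a b A"
    unfolding realizes_def h_def[symmetric]
    by (intro conjI allI ballI impI contA skew supp main[THEN conjunct1] main[THEN conjunct2])
  then show ?thesis by (rule exI[of _ A])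
qed

text \<open>One recursion step seen from a branch: its share \<open>K\<close> of poles is converted
  to branch data, the recursion hypothesis realizes them, and the result is restated in the form
  that \<open>realizes_glue\<close> consumes. The parity factor moves from even order, as in
  \<open>realizes\<close>, to odd order, as needed by the parent.\<close>

lemma realizes_branch:
  fixes a c :: "nat \<Rightarrow> 's::topological_space \<Rightarrow> real" and T :: "(nat, 'b) pre_digraph"
  defines "m \<equiv> card (verts T)"
  assumes u: "u \<in> verts T" "finite (verts T)"
    and IH: "\<And>a b. (\<And>k. k < m div 2 \<Longrightarrow> continuous_on S (a k)) \<Longrightarrow>
      (\<And>k. k < m div 2 \<Longrightarrow> continuous_on S (b k)) \<Longrightarrow>
      (\<And>s. s \<in> S \<Longrightarrow> branch_data m (\<lambda>k. a k s) (\<lambda>k. b k s)) \<Longrightarrow> \<exists>A. realizes n S T u a b A"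
    and K: "finite K" "card K = (m + 1) div 2"
    and cont: "\<And>k. k \<in> K \<Longrightarrow> continuous_on S (a k)" "\<And>k. k \<in> K \<Longrightarrow> continuous_on S (c k)"
    and a: "\<And>s j k. s \<in> S \<Longrightarrow> j \<in> K \<Longrightarrow> k \<in> K \<Longrightarrow> j < k \<Longrightarrow> a j s < a k s"
    and c: "\<And>s k. s \<in> S \<Longrightarrow> k \<in> K \<Longrightarrow> 0 < c k s"
    and even: "\<And>s k. even m \<Longrightarrow> s \<in> S \<Longrightarrow> k \<in> K \<Longrightarrow> 0 < a k s"
    and odd: "odd m \<Longrightarrow> 0 \<in> K" "\<And>s. odd m \<Longrightarrow> s \<in> S \<Longrightarrow> a 0 s = 0"
  shows "\<exists>B. (\<forall>i j. continuous_on S (B i j)) \<and> (\<forall>s\<in>S. \<forall>i j. B i j s = - B j i s) \<and>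
     (\<forall>s\<in>S. \<forall>i j. B i j s \<noteq> 0 \<longleftrightarrow> i \<rightarrow>\<^bsub>T\<^esub> j) \<and>
     (\<forall>s\<in>S. \<forall>y. y \<noteq> 0 \<longrightarrow>
        (if odd m then of_real y else 1) * pdet n (verts T) (pencil y (\<lambda>i j. B i j s))
          = of_real (\<Prod>k\<in>K. y\<^sup>2 - a k s) \<and>
        of_real (\<Sum>k\<in>K. c k s) *
          ((if odd m then of_real y else 1) * pdet n (verts T - {u}) (pencil y (\<lambda>i j. B i j s)))
          = of_real (y * (\<Sum>k\<in>K. c k s * (\<Prod>j\<in>K - {k}. y\<^sup>2 - a j s))))"
proof -
  define h where "h = (m + 1) div 2"
  have m: "1 \<le> m" using u by (auto simp: m_def card_gt_0_iff Suc_le_eq)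
  then have h0: "0 < h" by (simp add: h_def)
  \<comment> \<open>The share \<open>K\<close> may be any set of indices; an increasing enumeration
    restores the ordered list of poles and, for odd order, puts the zero pole first.\<close>
  obtain e where e: "bij_betw e {..<h} K" "strict_mono_on {..<h} e"
    using ex_bij_betw_strict_mono_card[OF K(1)] K(2) by (metis h_def)
  have eK: "e k \<in> K" if "k < h" for k using e(1) that by (auto simp: bij_betw_def)
  have e0: "e 0 = 0" if o: "odd m"
  proof -
    obtain k where k: "k < h" "e k = 0" using odd(1)[OF o] e(1) by (auto simp: bij_betw_def)
    have "k = 0"
    proof (rule ccontr)
      assume "k \<noteq> 0"
      then have "e 0 < e k" using strict_mono_onD[OF e(2), of 0 k] k h0 by auto
      then show False using k by simp
    qed
    then show ?thesis using k by simp
  qed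
  obtain a' b' where ab: "\<And>k. k < m div 2 \<Longrightarrow> continuous_on S (a' k)"
    "\<And>k. k < m div 2 \<Longrightarrow> continuous_on S (b' k)"
    "\<And>s. s \<in> S \<Longrightarrow> branch_data m (\<lambda>k. a' k s) (\<lambda>k. b' k s)"
    and b': "\<And>s z. s \<in> S \<Longrightarrow>
      (if even m then 1 else z) * (\<Prod>k<m div 2. z - b' k s) = (\<Prod>k<h. z - a (e k) s)"
    and a': "\<And>s z. s \<in> S \<Longrightarrow> z \<noteq> 0 \<Longrightarrow> (\<Sum>k<h. c (e k) s) * (\<Prod>k<m div 2. z - a' k s)
      = (if even m then z else 1) * (\<Sum>k<h. c (e k) s * (\<Prod>j\<in>{..<h} - {k}. z - a (e j) s))"
  proof (rule branch_data_from_poles[OF m h_def, of S "\<lambda>k. a (e k)" "\<lambda>k. c (e k)"])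
    show "a (e j) s < a (e k) s" if "s \<in> S" "j < k" "k < h" for s j k
      using a[OF that(1) eK eK, of j k] strict_mono_onD[OF e(2), of j k] that by auto
    show "if even m then 0 < a (e 0) s else a (e 0) s = 0" if "s \<in> S" for s
      using even[OF _ that eK[OF h0]] odd(2)[OF _ that] e0 by auto
  qed (use cont c eK in auto)
  obtain B where B: "realizes n S T u a' b' B" using IH[OF ab] by blast
  show ?thesis
  proof (intro exI[of _ B] conjI allI ballI impI)
    fix s and y :: real assume s: "s \<in> S" and y: "y \<noteq> 0"
    let ?p = "pdet n (verts T) (pencil y (\<lambda>i j. B i j s))"
    let ?q = "pdet n (verts T - {u}) (pencil y (\<lambda>i j. B i j s))"
    have b1: "(if even m then 1 else y\<^sup>2) * (\<Prod>k<m div 2. y\<^sup>2 - b' k s) = (\<Prod>k\<in>K. y\<^sup>2 - a k s)"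
      unfolding b'[OF s] by (rule prod.reindex_bij_betw[OF e(1)])
    have "(\<Sum>k<h. c (e k) s) = (\<Sum>k\<in>K. c k s)" by (rule sum.reindex_bij_betw[OF e(1)])
    then have a1: "(\<Sum>k\<in>K. c k s) * (\<Prod>k<m div 2. y\<^sup>2 - a' k s)
      = (if even m then y\<^sup>2 else 1) * (\<Sum>k\<in>K. c k s * (\<Prod>j\<in>K - {k}. y\<^sup>2 - a j s))"
      using a'[OF s, of "y\<^sup>2"] y
        sum_prod_remove_reindex[OF e(1), of "\<lambda>k. c k s" "\<lambda>j. y\<^sup>2 - a j s"] by simp
    have p: "(if even m then of_real y else 1) * ?p = of_real (y * (\<Prod>k<m div 2. y\<^sup>2 - b' k s))"
      and q: "(if even m then of_real y else 1) * ?q = of_real (\<Prod>k<m div 2. y\<^sup>2 - a' k s)"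
      using realizesD(4,5)[OF B s y] by (simp_all add: m_def)
    \<comment> \<open>For even order the factor \<open>y\<close> on both sides is cancelled; for odd
      order both sides are multiplied by \<open>y\<close>, and \<open>y\<^sup>2\<close> supplies the
      linear factor of the zero pole.\<close>
    show "(if odd m then of_real y else 1) * ?p = of_real (\<Prod>k\<in>K. y\<^sup>2 - a k s)"
    proof (cases "even m")
      case True
      then show ?thesis using p y by (simp flip: b1)
    next
      case False
      then have "of_real y * ?p = of_real (y\<^sup>2 * (\<Prod>k<m div 2. y\<^sup>2 - b' k s))"
        using p by (simp add: power2_eq_square del: of_real_prod)
      also have "y\<^sup>2 * (\<Prod>k<m div 2. y\<^sup>2 - b' k s) = (\<Prod>k\<in>K. y\<^sup>2 - a k s)"
        using b1 False by simp
      finally show ?thesis using False by simp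
    qed
    show "of_real (\<Sum>k\<in>K. c k s) * ((if odd m then of_real y else 1) * ?q)
      = of_real (y * (\<Sum>k\<in>K. c k s * (\<Prod>j\<in>K - {k}. y\<^sup>2 - a j s)))"
    proof (cases "even m")
      case True
      have "of_real y * (of_real (\<Sum>k\<in>K. c k s) * ?q)
        = of_real ((\<Sum>k\<in>K. c k s) * (\<Prod>k<m div 2. y\<^sup>2 - a' k s))"
        using q True by (simp add: algebra_simps del: of_real_sum of_real_prod)
      also have "\<dots> = of_real y * of_real (y * (\<Sum>k\<in>K. c k s * (\<Prod>j\<in>K - {k}. y\<^sup>2 - a j s)))"
        unfolding a1 using True by (simp add: power2_eq_square del: of_real_sum of_real_prod)
      finally show ?thesis using True y by (simp del: of_real_sum of_real_prod of_real_mult)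
    next
      case False
      have "of_real (\<Sum>k\<in>K. c k s) * (of_real y * ?q)
        = of_real (y * ((\<Sum>k\<in>K. c k s) * (\<Prod>k<m div 2. y\<^sup>2 - a' k s)))"
        using q False by (simp add: algebra_simps del: of_real_sum of_real_prod)
      then show ?thesis unfolding a1 using False by simp
    qed
  qed (use realizesD(1-3)[OF B] in blast)+
qed

text \<open>Induction over the recursive definition, with \<open>a\<close> and \<open>b\<close>
  generalised because each branch receives new data derived from its share of poles and
  residues.\<close>

theorem NEB_realizes:
  fixes T :: "(nat, 'b) pre_digraph" and a b :: "nat \<Rightarrow> 's::topological_space \<Rightarrow> real"
  assumes "NEB T w" and "verts T \<subseteq> {..<n}"
    and "\<And>k. k < card (verts T) div 2 \<Longrightarrow> continuous_on S (a k)"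
    and "\<And>k. k < card (verts T) div 2 \<Longrightarrow> continuous_on S (b k)"
    and "\<And>s. s \<in> S \<Longrightarrow> branch_data (card (verts T)) (\<lambda>k. a k s) (\<lambda>k. b k s)"
  shows "\<exists>A. realizes n S T w a b A"
  using assms
proof (induction arbitrary: a b rule: NEB.induct)
  case (single T w)
  then show ?case using realizes_single by blast
next
  case (branching T w)
  interpret rooted_tree T w using branching.hyps(1,2) by unfold_locales
  let ?m = "card (verts T)"
  let ?h = "?m div 2"
  let ?c = "\<lambda>k s. pf_weight ?h (\<lambda>k. a k s) (\<lambda>k. b k s) k"
  let ?mu = "\<lambda>u. card (bverts u)"
  have I: "interlacing ?h (\<lambda>k. a k s) (\<lambda>k. b k s)"
    and a0: "if even ?m then a 0 s = 0 else 0 < a 0 s" if "s \<in> S" for s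
    using branching.prems(4)[OF that] branching.hyps(3) by (auto simp: branch_data_def)
  have finb: "finite (bverts u)" for u using bverts_subset finite_subset by fastforce
  have mu1: "1 \<le> ?mu u" if "u \<in> nbrs" for u
    using nbr_in_bverts[OF that] finb[of u] by (auto simp: Suc_le_eq card_gt_0_iff)
  have odd: "card {u \<in> nbrs. odd (?mu u)} = (if even ?m then 1 else 0)"
    using branching.hyps(4,5) card_odd_components by auto
  \<comment> \<open>Supply meets demand: the poles wanted by the branches number exactly those
    available at the root.\<close>
  have r: "(\<Sum>u\<in>nbrs. (?mu u + 1) div 2) = card {..<?h}"
  proof -
    have "2 * (\<Sum>u\<in>nbrs. (?mu u + 1) div 2) + 1 = ?m + (if even ?m then 1 else 0)"
      using sum_half_round_up[OF finite_nbrs, of ?mu] sum_card_bverts odd by simp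
    then show ?thesis by (auto split: if_splits elim!: evenE oddE)
  qed
  \<comment> \<open>For even order \<open>a 0\<close> is the zero pole and must go to the unique odd
    branch, while even branches need positive poles. For odd order all poles are positive and all
    branches even, so any distribution of the right sizes works.\<close>
  obtain K where K: "(\<Union>u\<in>nbrs. K u) = {..<?h}"
    "\<And>u. u \<in> nbrs \<Longrightarrow> card (K u) = (?mu u + 1) div 2"
    "\<And>u u'. u \<in> nbrs \<Longrightarrow> u' \<in> nbrs \<Longrightarrow> u \<noteq> u' \<Longrightarrow> K u \<inter> K u' = {}"
    and K0: "\<And>u. u \<in> nbrs \<Longrightarrow> if odd (?mu u) then even ?m \<and> 0 \<in> K u else odd ?m \<or> 0 \<notin> K u"
  proof (cases "even ?m")
    case True
    then obtain v where v: "{u \<in> nbrs. odd (?mu u)} = {v}"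
      using odd by (auto simp: card_1_singleton_iff)
    then have vn: "v \<in> nbrs" "odd (?mu v)" by auto
    have "(0::nat) \<in> {..<?h}" using branching.hyps(3) by simp
    moreover have "0 < (?mu v + 1) div 2" using mu1[OF vn(1)] by simp
    ultimately obtain K where K: "(\<Union>u\<in>nbrs. K u) = {..<?h}"
      "\<And>u. u \<in> nbrs \<Longrightarrow> card (K u) = (?mu u + 1) div 2"
      "\<And>u u'. u \<in> nbrs \<Longrightarrow> u' \<in> nbrs \<Longrightarrow> u \<noteq> u' \<Longrightarrow> K u \<inter> K u' = {}" "0 \<in> K v"
      using partition_with_cards_point[OF finite_nbrs finite_lessThan _ r vn(1), of 0] by metis
    show thesis
    proof (rule that[OF K(1-3)])
      fix u assume u: "u \<in> nbrs"
      show "if odd (?mu u) then even ?m \<and> 0 \<in> K u else odd ?m \<or> 0 \<notin> K u"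
      proof (cases "u = v")
        case False
        then have "even (?mu u)" using v u by blast
        moreover have "0 \<notin> K u" using K(3)[OF u vn(1) False] K(4) by auto
        ultimately show ?thesis by simp
      qed (use vn True K(4) in auto)
    qed
  next
    case False
    then have ev: "\<And>u. u \<in> nbrs \<Longrightarrow> even (?mu u)" using odd finite_nbrs by auto
    show thesis
      using partition_with_cards[OF finite_nbrs finite_lessThan r] that ev False by metis
  qed
  have Ksub: "K u \<subseteq> {..<?h}" if "u \<in> nbrs" for u using K(1) that by auto
  have br: "\<exists>B. (\<forall>i j. continuous_on S (B i j)) \<and> (\<forall>s\<in>S. \<forall>i j. B i j s = - B j i s) \<and>
     (\<forall>s\<in>S. \<forall>i j. B i j s \<noteq> 0 \<longleftrightarrow> i \<rightarrow>\<^bsub>branch T w u\<^esub> j) \<and>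
     (\<forall>s\<in>S. \<forall>y. y \<noteq> 0 \<longrightarrow>
        (if odd (?mu u) then of_real y else 1) * pdet n (bverts u) (pencil y (\<lambda>i j. B i j s))
          = of_real (\<Prod>k\<in>K u. y\<^sup>2 - a k s) \<and>
        of_real (\<Sum>k\<in>K u. ?c k s) *
          ((if odd (?mu u) then of_real y else 1) * pdet n (bverts u - {u}) (pencil y (\<lambda>i j. B i j s)))
          = of_real (y * (\<Sum>k\<in>K u. ?c k s * (\<Prod>j\<in>K u - {k}. y\<^sup>2 - a j s))))"
    if u: "u \<in> nbrs" for u
    unfolding bverts_def
  proof (rule realizes_branch)
    show "u \<in> verts (branch T w u)" "finite (verts (branch T w u))"
      using nbr_in_bverts[OF u] finb[of u] by (simp_all add: bverts_def)
    show "finite (K u)" using Ksub[OF u] finite_subset by blast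
    show "card (K u) = (card (verts (branch T w u)) + 1) div 2" using K(2)[OF u] by (simp add: bverts_def)
    fix s k assume s: "s \<in> S" and k: "k \<in> K u"
    then have kh: "k < ?h" using Ksub[OF u] by auto
    show "0 < ?c k s" by (rule pf_weight_pos[OF I[OF s] kh])
    show "a j s < a k s" if "j \<in> K u" "j < k" for j
      using interlacing_strict(1)[OF I[OF s] that(2) kh] .
    show "0 < a k s" if "even (card (verts (branch T w u)))"
    proof -
      have "odd ?m \<or> 0 \<notin> K u" using K0[OF u] that by (simp add: bverts_def)
      then show ?thesis
        using a0[OF s] interlacing_strict(1)[OF I[OF s] _ kh, of 0] k
        by (cases "k = 0"; cases "even ?m") auto
    qed
  next
    fix a' b' :: "nat \<Rightarrow> 's \<Rightarrow> real"
    assume *: "\<And>k. k < card (verts (branch T w u)) div 2 \<Longrightarrow> continuous_on S (a' k)"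
      "\<And>k. k < card (verts (branch T w u)) div 2 \<Longrightarrow> continuous_on S (b' k)"
      "\<And>s. s \<in> S \<Longrightarrow> branch_data (card (verts (branch T w u))) (\<lambda>k. a' k s) (\<lambda>k. b' k s)"
    have "verts (branch T w u) \<subseteq> {..<n}"
      using bverts_subset[of u] branching.prems(1) by (auto simp: bverts_def)
    then show "\<exists>A. realizes n S (branch T w u) u a' b' A"
      using branching.IH[of u] u * by (simp add: nbrs_def)
  next
    fix k assume "k \<in> K u"
    then have k: "k < ?h" using Ksub[OF u] by auto
    then show "continuous_on S (a k)" by (rule branching.prems(2))
    show "continuous_on S (?c k)"
      by (rule continuous_on_pf_weight[OF branching.prems(2,3) I k])
  next
    assume o: "odd (card (verts (branch T w u)))"
    then show "0 \<in> K u" using K0[OF u] by (simp add: bverts_def)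
    show "a 0 s = 0" if "s \<in> S" for s using a0[OF that] K0[OF u] o by (simp add: bverts_def)
  qed
  from bchoice[OF ballI[OF br]] obtain B where B: "\<forall>u\<in>nbrs. (\<forall>i j. continuous_on S (B u i j)) \<and>
     (\<forall>s\<in>S. \<forall>i j. B u i j s = - B u j i s) \<and>
     (\<forall>s\<in>S. \<forall>i j. B u i j s \<noteq> 0 \<longleftrightarrow> i \<rightarrow>\<^bsub>branch T w u\<^esub> j) \<and>
     (\<forall>s\<in>S. \<forall>y. y \<noteq> 0 \<longrightarrow>
        (if odd (?mu u) then of_real y else 1) * pdet n (bverts u) (pencil y (\<lambda>i j. B u i j s))
          = of_real (\<Prod>k\<in>K u. y\<^sup>2 - a k s) \<and>
        of_real (\<Sum>k\<in>K u. ?c k s) *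
          ((if odd (?mu u) then of_real y else 1) * pdet n (bverts u - {u}) (pencil y (\<lambda>i j. B u i j s)))
          = of_real (y * (\<Sum>k\<in>K u. ?c k s * (\<Prod>j\<in>K u - {k}. y\<^sup>2 - a j s))))"
    ..
  have Kne: "K u \<noteq> {}" if "u \<in> nbrs" for u
    using K(2)[OF that] mu1[OF that] by auto
  have nb: "{u. w \<rightarrow>\<^bsub>T\<^esub> u} = nbrs" by (simp only: nbrs_def)
  have bv: "verts (branch T w u) = bverts u" for u by (simp only: bverts_def)
  show ?case
  proof (rule realizes_glue[OF branching.hyps(1,2) branching.prems(1-3) I, where K = K and B = B, unfolded nb bv])
    fix u assume u: "u \<in> nbrs"
    note Bu = bspec[OF B u]
    show "K u \<noteq> {}" by (rule Kne[OF u])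
    show "continuous_on S (B u i j)" for i j using Bu by blast
    fix s assume s: "s \<in> S"
    show "B u i j s = - B u j i s" for i j using Bu s by blast
    show "B u i j s \<noteq> 0 \<longleftrightarrow> i \<rightarrow>\<^bsub>branch T w u\<^esub> j" for i j using Bu s by blast
    fix y :: real assume y: "y \<noteq> 0"
    from Bu s y show "(if odd (?mu u) then of_real y else 1) * pdet n (bverts u) (pencil y (\<lambda>i j. B u i j s))
        = of_real (\<Prod>k\<in>K u. y\<^sup>2 - a k s)" by blast
    from Bu s y show "of_real (\<Sum>k\<in>K u. ?c k s) *
        ((if odd (?mu u) then of_real y else 1) * pdet n (bverts u - {u}) (pencil y (\<lambda>i j. B u i j s)))
        = of_real (y * (\<Sum>k\<in>K u. ?c k s * (\<Prod>j\<in>K u - {k}. y\<^sup>2 - a j s)))" by blast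
  qed (use K odd in simp_all)
qed

section \<open>Perturbation to supergraphs\<close>

text \<open>A Hermitian determinant is real, so its sign is meaningful and the vanishing of its real
  part gives singularity.\<close>

lemma pdet_hermitian_Im:
  assumes "\<And>i j. cnj (P i j) = P j i"
  shows "Im (pdet n V P) = 0"
proof -
  interpret cnj: comm_ring_hom cnj by unfold_locales auto
  have "map_mat cnj (mask_mat n V P) = transpose_mat (mask_mat n V P)"
    unfolding mask_mat_def by (rule eq_matI) (auto simp: assms)
  then have "cnj (pdet n V P) = Determinant.det (transpose_mat (mask_mat n V P))"
    unfolding pdet_def by (metis cnj.hom_det)
  also have "\<dots> = pdet n V P"
    unfolding pdet_def by (rule det_transpose[OF mask_mat_carrier])
  finally show ?thesis by (metis complex_cnj_cancel_iff cnj.simps(2) neg_equal_zero)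
qed

lemma cnj_pencil:
  assumes "\<And>i j. A i j = - A j i"
  shows "cnj (pencil y A i j) = pencil y A j i"
  using assms[of i j] by (auto simp: pencil_def)

definition pencil_mat :: "real mat \<Rightarrow> real \<Rightarrow> complex mat" where
  "pencil_mat A y = Matrix.mat (dim_row A) (dim_row A) (\<lambda>(i, j). pencil y (\<lambda>i j. A $$ (i, j)) i j)"

text \<open>The characteristic matrix at \<i> y is the pencil y I + \<i> A multiplied by
  -\<i>.\<close>

lemma mem_complex_eigenvalues_iff:
  assumes A: "A \<in> carrier_mat m m"
  shows "\<i> * of_real y \<in> complex_eigenvalues A \<longleftrightarrow> Determinant.det (pencil_mat A y) = 0"
proof -
  have C: "map_mat complex_of_real A \<in> carrier_mat m m" using A by simp
  have "char_matrix (map_mat complex_of_real A) (\<i> * of_real y) = (- \<i>) \<cdot>\<^sub>m pencil_mat A y"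
    unfolding char_matrix_def pencil_mat_def pencil_def
    by (rule eq_matI) (use A in \<open>auto simp: algebra_simps\<close>)
  then show ?thesis
    unfolding complex_eigenvalues_def spectrum_def mem_Collect_eq eigenvalue_det[OF C] by simp
qed

text \<open>Negating \<open>y\<close> negates and transposes the pencil. Hence eigenvalues come in
  opposite pairs, and 0 is an eigenvalue in odd order.\<close>

lemma det_pencil_mat_uminus:
  assumes A: "A \<in> carrier_mat m m" and skew: "skew_symmetric A"
  shows "Determinant.det (pencil_mat A (- y)) = (-1) ^ m * Determinant.det (pencil_mat A y)"
proof -
  have sk: "A $$ (i, j) = - A $$ (j, i)" if "i < m" "j < m" for i j
  proof -
    have "transpose_mat A $$ (j, i) = (- A) $$ (j, i)" using skew by (simp add: skew_symmetric_def)
    then show ?thesis using that A by simp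
  qed
  have "pencil_mat A (- y) = (- 1) \<cdot>\<^sub>m transpose_mat (pencil_mat A y)"
  proof (rule eq_matI)
    fix i j assume "i < dim_row ((- 1) \<cdot>\<^sub>m transpose_mat (pencil_mat A y))"
      "j < dim_col ((- 1) \<cdot>\<^sub>m transpose_mat (pencil_mat A y))"
    then have ij: "i < m" "j < m" using A by (simp_all add: pencil_mat_def)
    then show "pencil_mat A (- y) $$ (i, j) = ((- 1) \<cdot>\<^sub>m transpose_mat (pencil_mat A y)) $$ (i, j)"
      using A sk[OF ij] by (simp add: pencil_mat_def pencil_def)
  qed (simp_all add: pencil_mat_def)
  moreover have "pencil_mat A y \<in> carrier_mat m m" using A by (simp add: pencil_mat_def)
  ultimately show ?thesis by (simp add: det_transpose)
qed

text \<open>Only the upper half of the list has to be checked: symmetry supplies the lower half and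
  the middle zero. The list then consists of \<open>m\<close> distinct eigenvalues, as many as a
  matrix of order \<open>m\<close> can have.\<close>

lemma complex_eigenvalues_skew_eq:
  fixes l :: "nat \<Rightarrow> real"
  assumes A: "A \<in> carrier_mat m m" and skew: "skew_symmetric A"
    and mono: "\<And>j k. 1 \<le> j \<Longrightarrow> j < k \<Longrightarrow> k \<le> m \<Longrightarrow> l j < l k"
    and sym: "\<And>j. 1 \<le> j \<Longrightarrow> j \<le> m \<Longrightarrow> l j = - l (m + 1 - j)"
    and ev: "\<And>k. k < m div 2 \<Longrightarrow> \<i> * of_real (l (m - m div 2 + k + 1)) \<in> complex_eigenvalues A"
  shows "complex_eigenvalues A = (\<lambda>j. \<i> * complex_of_real (l j)) ` {1..m}"
proof -
  have neg: "\<i> * of_real (- y) \<in> complex_eigenvalues A" if "\<i> * of_real y \<in> complex_eigenvalues A" for y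
    using that unfolding mem_complex_eigenvalues_iff[OF A] det_pencil_mat_uminus[OF A skew] by simp
  have zero: "\<i> * of_real 0 \<in> complex_eigenvalues A" if "odd m"
    using det_pencil_mat_uminus[OF A skew, of 0] that unfolding mem_complex_eigenvalues_iff[OF A] by simp
  have mem: "\<i> * of_real (l j) \<in> complex_eigenvalues A" if j: "1 \<le> j" "j \<le> m" for j
  proof -
    \<comment> \<open>Upper half, lower half, and for odd \<open>m\<close> the middle index, which
      the reflection \<open>m + 1 - j\<close> fixes.\<close>
    have "m - m div 2 < j \<or> j \<le> m div 2 \<or> odd m \<and> j = m div 2 + 1" using j by presburger
    then consider "m - m div 2 < j" | "j \<le> m div 2" | "odd m" "j = m div 2 + 1" by blast
    then show ?thesis
    proof cases
      case 1
      then have "j = m - m div 2 + (j - (m - m div 2) - 1) + 1" "j - (m - m div 2) - 1 < m div 2"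
        using j by auto
      then show ?thesis using ev by metis
    next
      case 2
      have "m + 1 - j = m - m div 2 + (m div 2 - j) + 1" "m div 2 - j < m div 2" using 2 j by auto
      then have "\<i> * of_real (l (m + 1 - j)) \<in> complex_eigenvalues A" using ev by metis
      then show ?thesis using neg sym[OF j] by simp
    next
      case 3
      then have "m + 1 - j = j" by (auto elim!: oddE)
      then have "l j = 0" using sym[OF j] by simp
      then show ?thesis using zero 3 by simp
    qed
  qed
  have C: "map_mat complex_of_real A \<in> carrier_mat m m" using A by simp
  have "inj_on (\<lambda>j. \<i> * complex_of_real (l j)) {1..m}"
  proof (rule inj_onI)
    fix j k assume "j \<in> {1..m}" "k \<in> {1..m}" "\<i> * complex_of_real (l j) = \<i> * complex_of_real (l k)"
    then have "1 \<le> j" "j \<le> m" "1 \<le> k" "k \<le> m" "l j = l k" by auto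
    then show "j = k" using mono[of j k] mono[of k j] by (cases j k rule: linorder_cases) auto
  qed
  then have "card ((\<lambda>j. \<i> * complex_of_real (l j)) ` {1..m}) = m"
    by (simp add: card_image)
  then have card: "card (complex_eigenvalues A) \<le> card ((\<lambda>j. \<i> * complex_of_real (l j)) ` {1..m})"
    using card_finite_spectrum(2)[OF C] by (simp add: complex_eigenvalues_def)
  have "finite (complex_eigenvalues A)"
    using card_finite_spectrum(1)[OF C] by (simp add: complex_eigenvalues_def)
  moreover have "(\<lambda>j. \<i> * complex_of_real (l j)) ` {1..m} \<subseteq> complex_eigenvalues A"
    using mem by auto
  ultimately show ?thesis by (rule card_seteq[symmetric, OF _ _ card])
qed

lemma skew_symmetric_mat_delete:
  assumes A: "A \<in> carrier_mat n n" and skew: "skew_symmetric A" and v: "v < n"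
  shows "skew_symmetric (mat_delete A v v)"
proof -
  have sk: "A $$ (i, j) = - A $$ (j, i)" if "i < n" "j < n" for i j
  proof -
    have "transpose_mat A $$ (j, i) = (- A) $$ (j, i)" using skew by (simp add: skew_symmetric_def)
    then show ?thesis using that A by simp
  qed
  have "transpose_mat (mat_delete A v v) = - mat_delete A v v"
  proof (rule eq_matI)
    fix i j assume "i < dim_row (- mat_delete A v v)" "j < dim_col (- mat_delete A v v)"
    then have ij: "i < n - 1" "j < n - 1" using A by (simp_all add: mat_delete_def)
    then have "(if i < v then i else Suc i) < n" "(if j < v then j else Suc j) < n" by auto
    from sk[OF this(2,1)] show "transpose_mat (mat_delete A v v) $$ (i, j) = (- mat_delete A v v) $$ (i, j)"
      using A ij by (simp add: mat_delete_def)
  qed (use A in \<open>simp_all add: mat_delete_def\<close>)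
  then show ?thesis using A by (simp add: skew_symmetric_def mat_delete_def)
qed

lemma det_pencil_mat_eq_pdet:
  fixes M :: "nat \<Rightarrow> nat \<Rightarrow> real" and n :: nat
  defines "A \<equiv> Matrix.mat n n (\<lambda>(i, j). M i j)"
  shows "Determinant.det (pencil_mat A y) = pdet n {0..<n} (pencil y M)"
    and "v < n \<Longrightarrow> Determinant.det (pencil_mat (mat_delete A v v) y) = pdet n ({0..<n} - {v}) (pencil y M)"
proof -
  have "pencil_mat A y = mask_mat n {0..<n} (pencil y M)"
    unfolding pencil_mat_def mask_mat_def A_def pencil_def by (rule eq_matI) auto
  then show "Determinant.det (pencil_mat A y) = pdet n {0..<n} (pencil y M)" by (simp add: pdet_def)
next
  assume v: "v < n"
  have "pencil_mat (mat_delete A v v) y = mat_delete (mask_mat n {0..<n} (pencil y M)) v v"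
    unfolding pencil_mat_def mask_mat_def A_def pencil_def mat_delete_def
    by (rule eq_matI) (use v in auto)
  then show "Determinant.det (pencil_mat (mat_delete A v v) y) = pdet n ({0..<n} - {v}) (pencil y M)"
    using pdet_remove[OF v, of "{0..<n}" "pencil y M"] by simp
qed

text \<open>For even \<open>n\<close> the symmetry pins the node \<open>0\<close> of the first family (\<open>r \<noteq> 0\<close>) at zero.\<close>

definition shift :: "nat \<Rightarrow> nat \<Rightarrow> (nat \<Rightarrow> real) \<Rightarrow> real \<Rightarrow> (nat \<Rightarrow> real) \<Rightarrow> nat \<Rightarrow> real" where
  "shift n r \<alpha> d s k = \<alpha> k + (if even n \<and> r \<noteq> 0 \<and> k = 0 then 0 else d) * s (r + k)"

lemma branch_data_shift:
  assumes "branch_data n \<alpha> \<beta>"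
  obtains d where "0 < d"
    and "\<And>s. s \<in> unit_box \<Longrightarrow> branch_data n (shift n (n div 2) \<alpha> d s) (shift n 0 \<beta> d s)"
proof -
  let ?h = "n div 2"
  \<comment> \<open>All quantities that must stay positive under the shift; the element 1 keeps the
    set nonempty.\<close>
  define X where "X = insert 1 ((\<lambda>k. \<beta> k - \<alpha> k) ` {..<?h} \<union> (\<lambda>k. \<alpha> (Suc k) - \<beta> k) ` {k. Suc k < ?h}
    \<union> (if odd n \<and> 0 < ?h then {\<alpha> 0} else {}))"
  have "finite {k. Suc k < ?h}" by (rule finite_subset[of _ "{..<?h}"]) auto
  then have fin: "finite X" unfolding X_def by simp
  have "\<forall>x\<in>X. 0 < x" using assms by (auto simp: X_def branch_data_def interlacing_def)
  moreover have "Min X \<in> X" using fin by (rule Min_in) (simp add: X_def)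
  ultimately have "0 < Min X" by blast
  \<comment> \<open>Each node moves by at most \<open>d\<close>, so a gap of at least
    \<open>3 * d\<close> keeps length at least \<open>d\<close>.\<close>
  define d where "d = Min X / 3"
  have d: "0 < d" using \<open>0 < Min X\<close> by (simp add: d_def)
  have dX: "3 * d \<le> x" if "x \<in> X" for x using fin that by (simp add: d_def)
  have close: "shift n r \<gamma> d s k \<in> {\<gamma> k - d..\<gamma> k + d}" if "s \<in> unit_box" for r \<gamma> s k
  proof -
    define t where "t = d * s (r + k)"
    have "\<bar>t\<bar> \<le> d * 1"
      unfolding t_def abs_mult using that d by (intro mult_mono) (auto simp: unit_box_def)
    moreover have "shift n r \<gamma> d s k = \<gamma> k + (if even n \<and> r \<noteq> 0 \<and> k = 0 then 0 else t)"
      by (simp add: shift_def t_def)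
    ultimately show ?thesis using d by auto
  qed
  show thesis
  proof (rule that[OF d])
    fix s assume s: "s \<in> unit_box"
    note ca = close[OF s, of "n div 2" \<alpha>] and cb = close[OF s, of 0 \<beta>]
    show "branch_data n (shift n (n div 2) \<alpha> d s) (shift n 0 \<beta> d s)"
      unfolding branch_data_def interlacing_def
    proof (intro conjI allI impI)
      fix k assume k: "k < ?h"
      have "3 * d \<le> \<beta> k - \<alpha> k" by (rule dX) (use k in \<open>simp add: X_def\<close>)
      then show "shift n ?h \<alpha> d s k < shift n 0 \<beta> d s k" using ca[of k] cb[of k] d by simp
    next
      fix k assume k: "Suc k < ?h"
      have "3 * d \<le> \<alpha> (Suc k) - \<beta> k" by (rule dX) (use k in \<open>auto simp: X_def\<close>)
      then show "shift n 0 \<beta> d s k < shift n ?h \<alpha> d s (Suc k)" using ca[of "Suc k"] cb[of k] d by simp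
    next
      assume h: "0 < ?h"
      show "if even n then shift n ?h \<alpha> d s 0 = 0 else 0 < shift n ?h \<alpha> d s 0"
      proof (cases "even n")
        case True
        then show ?thesis using assms h by (simp add: branch_data_def shift_def)
      next
        case False
        have "3 * d \<le> \<alpha> 0" by (rule dX) (use h False in \<open>simp add: X_def\<close>)
        then show ?thesis using ca[of 0] d False by simp
      qed
    qed
  qed
qed

text \<open>The fixed factor \<open>\<Prod>j\<noteq>i. \<beta> i - \<beta> j\<close> normalises the sign of the characteristic polynomial
  at the target node.\<close>

lemma prod_shift_sign:
  assumes strict: "\<And>s j k. s \<in> unit_box \<Longrightarrow> j < k \<Longrightarrow> k < h \<Longrightarrow> B s j < B s k"
    and B: "\<And>s k. s \<in> unit_box \<Longrightarrow> k < h \<Longrightarrow> B s k = \<beta> k + e k * s (r + k)"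
    and s: "s \<in> unit_box" and i: "i < h" and d: "0 < e i"
  shows "\<exists>c>0. (\<Prod>j\<in>{..<h} - {i}. \<beta> i - \<beta> j) * (\<Prod>k<h. \<beta> i - B s k) = - (c * s (r + i))"
proof -
  \<comment> \<open>The centre of the box yields the target nodes. Resetting only the coordinate of
    node \<open>i\<close> puts that node on target and leaves the others where \<open>s\<close> has
    them, so strict ordering there shows on which side of \<open>\<beta> i\<close> they lie.\<close>
  let ?z = "\<lambda>_. 0::real"
  let ?s = "s(r + i := 0)"
  have z: "?z \<in> unit_box" by (simp add: unit_box_def)
  have s': "?s \<in> unit_box" using s by (simp add: unit_box_def)
  have Bz: "B ?z k = \<beta> k" if "k < h" for k using B[OF z that] by simp
  have Bi: "B ?s i = \<beta> i" using B[OF s' i] by simp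
  have Bk: "B ?s k = B s k" if "k < h" "k \<noteq> i" for k using B[OF s' that(1)] B[OF s that(1)] that(2) by simp
  have pos: "0 < (\<beta> i - \<beta> k) * (\<beta> i - B s k)" if k: "k < h" "k \<noteq> i" for k
  proof (cases "k < i")
    case True
    then show ?thesis using strict[OF z True i] strict[OF s' True i] Bz Bi Bk k i by simp
  next
    case False
    then have "i < k" using k by simp
    then show ?thesis using strict[OF z _ k(1), of i] strict[OF s' _ k(1), of i] Bz Bi Bk k i
      by (auto intro!: mult_neg_neg)
  qed
  define c where "c = e i * (\<Prod>k\<in>{..<h} - {i}. (\<beta> i - \<beta> k) * (\<beta> i - B s k))"
  have "0 < (\<Prod>k\<in>{..<h} - {i}. (\<beta> i - \<beta> k) * (\<beta> i - B s k))"
    by (rule prod_pos) (use pos in blast)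
  then have "0 < c" using d by (simp add: c_def)
  moreover have "(\<Prod>k<h. \<beta> i - B s k) = - (e i * s (r + i)) * (\<Prod>k\<in>{..<h} - {i}. \<beta> i - B s k)"
    using i B[OF s i] by (subst prod.remove[of _ i]) auto
  ultimately show ?thesis
    by (intro exI[of _ c]) (simp add: c_def prod.distrib mult_ac)
qed

section \<open>Prescribed spectra on the full graph\<close>

theorem theorem5p2:
  fixes G T :: "nat pair_pre_digraph" and n v :: nat and lam mu :: "nat \<Rightarrow> real"
  assumes "2 \<le> n"
    and "pair_graph G" and "pverts G = {0..<n}" and "Digraph_Component.connected (with_proj G)"
    and "\<forall>k\<in>{1..n - 1}. lam k < mu k \<and> mu k < lam (k + 1)"
    and "\<forall>j\<in>{1..n}. lam j = - lam (n + 1 - j)"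
    and "\<forall>k\<in>{1..n - 1}. mu k = - mu (n - k)"
    and "undirected_spanning_tree (with_proj T) (with_proj G)"
    and "v \<in> pverts G" and "NEB (with_proj T) v"
  shows "\<exists>A \<in> S_minus G.
           complex_eigenvalues A = (\<lambda>j. \<i> * complex_of_real (lam j)) ` {1..n} \<and>
           complex_eigenvalues (mat_delete A v v)
             = (\<lambda>k. \<i> * complex_of_real (mu k)) ` {1..n - 1}"
proof -
  interpret G: pair_graph G by fact
  define h where "h = n div 2"
  define V where "V = {0..<n}"
  have v: "v < n" using assms(3,9) by auto
  have h: "0 < h" using assms(1) by (simp add: h_def)
  have span: "spanning (with_proj T) (with_proj G)" and tree: "undirected_tree (with_proj T)"
    using assms(8) by (auto simp: undirected_spanning_tree_def)
  have Tsub: "parcs T \<subseteq> parcs G" and Tverts: "pverts T = {0..<n}"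
    using span assms(3) by (auto simp: spanning_def subgraph_def)
  interpret T: graph "with_proj T" using tree by (simp add: undirected_tree_def)
  have adjT: "i \<rightarrow>\<^bsub>with_proj T\<^esub> j \<longleftrightarrow> (i, j) \<in> parcs T" for i j by simp
  have symT: "(i, j) \<in> parcs T \<longleftrightarrow> (j, i) \<in> parcs T" for i j
    using T.sym_arcs by (auto simp: symmetric_def sym_def)
  have symG: "(i, j) \<in> parcs G \<longleftrightarrow> (j, i) \<in> parcs G" for i j
    using G.sym_arcs by (auto simp: symmetric_def sym_def)

  have lm: "lam k < mu k" "mu k < lam (k + 1)" if "1 \<le> k" "k \<le> n - 1" for k
    using assms(5) that by auto
  have lam_sym: "lam j = - lam (n + 1 - j)" if "1 \<le> j" "j \<le> n" for j using assms(6) that by auto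
  have mu_sym: "mu k = - mu (n - k)" if "1 \<le> k" "k \<le> n - 1" for k using assms(7) that by auto
  \<comment> \<open>The positive upper half of \<open>lam\<close> and the nonnegative upper half of
    \<open>mu\<close>. As \<open>n - h\<close> is \<open>n / 2\<close> rounded up,
    \<open>mp 0\<close> is the middle value 0 for even \<open>n\<close> and the first positive value
    for odd \<open>n\<close>.\<close>
  define lp where "lp k = lam (n - h + k + 1)" for k
  define mp where "mp k = mu (n - h + k)" for k
  have inter: "mp k < lp k" if "k < h" for k
    using lm(2)[of "n - h + k"] that by (simp add: lp_def mp_def h_def)
  have inter': "lp k < mp (Suc k)" if "Suc k < h" for k
    using lm(1)[of "n - h + k + 1"] that by (simp add: lp_def mp_def h_def)
  have mp0: "if even n then mp 0 = 0 else 0 < mp 0"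
  proof (cases "even n")
    case True
    then have "n - h = h" by (auto simp: h_def)
    then show ?thesis using mu_sym[of h] h True by (simp add: mp_def h_def)
  next
    case False
    then have nh: "n - h = h + 1" "n + 1 - (h + 1) = h + 1" by (auto simp: h_def elim!: oddE)
    have "lam (h + 1) = 0" using lam_sym[of "h + 1"] nh by simp
    moreover have "lam (h + 1) < mu (h + 1)" using lm(1)[of "h + 1"] nh h by simp
    ultimately show ?thesis using False nh by (simp add: mp_def)
  qed
  have mp_nonneg: "0 \<le> mp k" if "k < h" for k
    using that
  proof (induction k)
    case 0
    then show ?case using mp0 by (auto split: if_splits)
  next
    case (Suc k)
    then show ?case using inter[of k] inter'[of k] by simp
  qed
  have lp_pos: "0 < lp k" if "k < h" for k using inter[OF that] mp_nonneg[OF that] by simp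
  have mp_pos: "0 < mp k" if "k < h" "\<not> (even n \<and> k = 0)" for k
  proof (cases k)
    case 0
    then show ?thesis using mp0 that by auto
  next
    case (Suc j)
    then show ?thesis using inter'[of j] lp_pos[of j] that by simp
  qed

  define \<alpha> where "\<alpha> k = (mp k)\<^sup>2" for k
  define \<beta> where "\<beta> k = (lp k)\<^sup>2" for k
  have bd: "branch_data n \<alpha> \<beta>"
    unfolding branch_data_def interlacing_def h_def[symmetric]
  proof (intro conjI allI impI)
    show "\<alpha> k < \<beta> k" if "k < h" for k
      using inter[OF that] mp_nonneg[OF that] by (simp add: \<alpha>_def \<beta>_def power_strict_mono)
    show "\<beta> k < \<alpha> (Suc k)" if "Suc k < h" for k
      using inter'[OF that] lp_pos[of k] that by (simp add: \<alpha>_def \<beta>_def power_strict_mono)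
    show "if even n then \<alpha> 0 = 0 else 0 < \<alpha> 0" using mp0 by (auto simp: \<alpha>_def)
  qed
  obtain d where d: "0 < d"
    and data: "\<And>s. s \<in> unit_box \<Longrightarrow> branch_data n (shift n h \<alpha> d s) (shift n 0 \<beta> d s)"
  proof (rule branch_data_shift[OF bd])
    fix d assume "0 < d"
      "\<And>s. s \<in> unit_box \<Longrightarrow> branch_data n (shift n (n div 2) \<alpha> d s) (shift n 0 \<beta> d s)"
    then show thesis unfolding h_def[symmetric] by (rule that)
  qed
  define a where "a k s = shift n h \<alpha> d s k" for k s
  define b where "b k s = shift n 0 \<beta> d s k" for k s
  have Ib: "interlacing h (\<lambda>k. a k s) (\<lambda>k. b k s)" if "s \<in> unit_box" for s
    using data[OF that] by (simp add: a_def b_def branch_data_def h_def)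
  have coord: "continuous_on S (\<lambda>s::nat \<Rightarrow> real. s i)" for S i
    by (rule continuous_on_subset[OF continuous_on_product_coordinates]) simp
  have cn: "card (verts (with_proj T)) = n" using Tverts by simp
  have "\<exists>A. realizes n unit_box (with_proj T) v a b A"
  proof (rule NEB_realizes[OF assms(10)])
    show "verts (with_proj T) \<subseteq> {..<n}" using Tverts by auto
    show "continuous_on unit_box (a k)" "continuous_on unit_box (b k)" for k
      unfolding a_def b_def shift_def by (intro continuous_intros coord)+
    show "branch_data (card (verts (with_proj T))) (\<lambda>k. a k s) (\<lambda>k. b k s)" if "s \<in> unit_box" for s
      unfolding cn a_def b_def by (rule data[OF that])
  qed
  then obtain A where A: "realizes n unit_box (with_proj T) v a b A" by (elim exE)
  define ev where "ev y = (if even n then y else 1)" for y :: real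
  have D: "of_real (ev y) * pdet n V (pencil y (\<lambda>i j. A i j s)) = of_real (y * (\<Prod>k<h. y\<^sup>2 - b k s))"
    "of_real (ev y) * pdet n (V - {v}) (pencil y (\<lambda>i j. A i j s)) = of_real (\<Prod>k<h. y\<^sup>2 - a k s)"
    if "s \<in> unit_box" "y \<noteq> 0" for s y
  proof -
    have evc: "complex_of_real (ev y) = (if even n then of_real y else 1)" by (simp add: ev_def)
    have vT: "verts (with_proj T) = V" using Tverts by (simp add: V_def)
    show "of_real (ev y) * pdet n V (pencil y (\<lambda>i j. A i j s)) = of_real (y * (\<Prod>k<h. y\<^sup>2 - b k s))"
      using realizesD(4)[OF A that] unfolding cn unfolding vT evc h_def .
    show "of_real (ev y) * pdet n (V - {v}) (pencil y (\<lambda>i j. A i j s)) = of_real (\<Prod>k<h. y\<^sup>2 - a k s)"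
      using realizesD(5)[OF A that] unfolding cn unfolding vT evc h_def .
  qed


  \<comment> \<open>A fixed skew pattern on the edges missing from the tree, signed by the order of
    the endpoints.\<close>
  define E where "E i j = (if (i, j) \<in> parcs G - parcs T then if i < j then 1 else - 1 else 0 :: real)" for i j
  have noloop: "i \<noteq> j" if "(i, j) \<in> parcs G" for i j using G.pair_no_loops[OF that] by simp
  have Eskew: "E i j = - E j i" for i j
    using symT[of i j] symG[of i j] noloop[of i j] by (auto simp: E_def)
  define M where "M e s i j = A i j s + e * E i j" for e s i j
  have Mskew: "M e s i j = - M e s j i" if "s \<in> unit_box" for e s i j
    using realizesD(2)[OF A that, of i j] Eskew[of i j] by (simp add: M_def)

  \<comment> \<open>One equation per box coordinate: the full matrix at each \<open>lp i\<close>,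
    then the matrix without \<open>v\<close> at each \<open>mp (i - h)\<close>. For even
    \<open>n\<close> the node \<open>mp 0 = 0\<close> is automatic, and its slot is filled by the
    coordinate itself. The minus signs match the negative sign in
    \<open>prod_shift_sign\<close>.\<close>
  define F where "F i p = (if i < h
      then - (\<Prod>j\<in>{..<h} - {i}. \<beta> i - \<beta> j) * Re (of_real (ev (lp i)) * pdet n V (pencil (lp i) (M (fst p) (snd p))))
    else if even n \<and> i = h then snd p h
    else - (\<Prod>j\<in>{..<h} - {i - h}. \<alpha> (i - h) - \<alpha> j) *
      Re (of_real (ev (mp (i - h))) * pdet n (V - {v}) (pencil (mp (i - h)) (M (fst p) (snd p)))))"
    for i and p :: "real \<times> (nat \<Rightarrow> real)"
  have contM: "continuous_on (UNIV \<times> unit_box) (\<lambda>p. M (fst p) (snd p) i j)" for i j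
    unfolding M_def
    by (intro continuous_intros continuous_on_compose2[OF realizesD(1)[OF A]]) auto
  have contF: "continuous_on (UNIV \<times> unit_box) (F i)" for i
  proof -
    have "continuous_on (UNIV \<times> unit_box) (\<lambda>p. pdet n W (pencil y (M (fst p) (snd p))))" for W y
      using continuous_on_pdet[of "UNIV \<times> unit_box" "\<lambda>i j p. pencil y (M (fst p) (snd p)) i j" n W]
      unfolding pencil_def by (simp add: continuous_intros contM)
    moreover have "continuous_on (UNIV \<times> unit_box) (\<lambda>p::real \<times> (nat \<Rightarrow> real). snd p h)"
      by (rule continuous_on_product_then_coordinatewise) (intro continuous_intros)
    ultimately show ?thesis
      unfolding F_def by (cases "i < h"; cases "even n \<and> i = h") (auto intro!: continuous_intros)
  qed
  \<comment> \<open>Without perturbation each component has the sign of its own coordinate, which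
    gives the opposite signs on opposite faces.\<close>
  have F0: "\<exists>c>0. F i (0, s) = c * s i" if i: "i < 2 * h" and s: "s \<in> unit_box" for i s
  proof -
    have M0: "M 0 s = (\<lambda>i j. A i j s)" by (intro ext) (simp add: M_def)
    consider "i < h" | "even n" "i = h" | "h \<le> i" "\<not> (even n \<and> i = h)" by linarith
    then show ?thesis
    proof cases
      case 1
      have "\<exists>c>0. (\<Prod>j\<in>{..<h} - {i}. \<beta> i - \<beta> j) * (\<Prod>k<h. \<beta> i - b k s) = - (c * s (0 + i))"
        by (rule prod_shift_sign[where B = "\<lambda>s k. b k s" and e = "\<lambda>_. d"])
          (use interlacing_strict(2)[OF Ib] s 1 d in \<open>auto simp: b_def shift_def\<close>)
      then obtain c where c: "0 < c"
        "(\<Prod>j\<in>{..<h} - {i}. \<beta> i - \<beta> j) * (\<Prod>k<h. \<beta> i - b k s) = - (c * s i)" by auto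
      have "F i (0, s) = - (\<Prod>j\<in>{..<h} - {i}. \<beta> i - \<beta> j) * (lp i * (\<Prod>k<h. \<beta> i - b k s))"
        using 1 D(1)[OF s, of "lp i"] lp_pos[OF 1]
        by (simp only: F_def if_True fst_conv snd_conv M0) (simp add: \<beta>_def flip: of_real_prod of_real_diff of_real_power of_real_mult)
      also have "\<dots> = lp i * c * s i" using c(2) by (simp add: algebra_simps)
      finally show ?thesis using c(1) lp_pos[OF 1] by (intro exI[of _ "lp i * c"]) simp
    next
      case 2
      then show ?thesis by (intro exI[of _ 1]) (simp add: F_def)
    next
      case 3
      define j where "j = i - h"
      have j: "i = h + j" "j < h" "\<not> (even n \<and> j = 0)" using 3 i by (auto simp: j_def)
      have "\<exists>c>0. (\<Prod>k\<in>{..<h} - {j}. \<alpha> j - \<alpha> k) * (\<Prod>k<h. \<alpha> j - a k s) = - (c * s (h + j))"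
        by (rule prod_shift_sign[where B = "\<lambda>s k. a k s" and e = "\<lambda>k. if even n \<and> h \<noteq> 0 \<and> k = 0 then 0 else d"])
          (use interlacing_strict(1)[OF Ib] s j d in \<open>auto simp: a_def shift_def\<close>)
      then obtain c where c: "0 < c"
        "(\<Prod>k\<in>{..<h} - {j}. \<alpha> j - \<alpha> k) * (\<Prod>k<h. \<alpha> j - a k s) = - (c * s i)" using j(1) by auto
      have "\<not> i < h" using 3(1) by simp
      then have "F i (0, s) = - (\<Prod>k\<in>{..<h} - {j}. \<alpha> j - \<alpha> k) *
          Re (of_real (ev (mp j)) * pdet n (V - {v}) (pencil (mp j) (\<lambda>i j. A i j s)))"
        unfolding F_def fst_conv snd_conv M0 j_def[symmetric] by (simp only: if_False if_not_P[OF 3(2)])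
      also have "\<dots> = - (\<Prod>k\<in>{..<h} - {j}. \<alpha> j - \<alpha> k) * (\<Prod>k<h. \<alpha> j - a k s)"
        using D(2)[OF s, of "mp j"] mp_pos[OF j(2,3)] by (simp only: Re_complex_of_real \<alpha>_def)
      also have "\<dots> = c * s i" using c(2) by simp
      finally show ?thesis using c(1) by blast
    qed
  qed
  obtain e s where e: "0 < e" and s: "s \<in> unit_box" and F: "\<And>i. i < 2 * h \<Longrightarrow> F i (e, s) = 0"
  proof (rule perturbed_poincare_miranda[of "2 * h" F])
    fix e s assume "0 < e" "s \<in> unit_box" "\<And>i. i < 2 * h \<Longrightarrow> F i (e, s) = 0"
    then show thesis by (rule that)
  next
    show "continuous_on (UNIV \<times> unit_box) (F i)" for i by (rule contF)
    fix i x assume "i < 2 * h" "x \<in> unit_box"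
    from F0[OF this] obtain c where c: "0 < c" "F i (0, x) = c * x i" by blast
    show "F i (0, x) < 0" if "x i = - 1" using c that by simp
    show "0 < F i (0, x)" if "x i = 1" using c that by simp
  qed
  define N where "N = M e s"
  have Nskew: "N i j = - N j i" for i j unfolding N_def by (rule Mskew[OF s])
  have real: "pdet n W (pencil y N) = of_real (Re (pdet n W (pencil y N)))" for W y
    using pdet_hermitian_Im[OF cnj_pencil[OF Nskew]] by (simp add: complex_eq_iff)
  have sq_inj: "\<beta> i \<noteq> \<beta> j" "\<alpha> i \<noteq> \<alpha> j" if "i < h" "j < h" "i \<noteq> j" for i j
    using inj_onD[OF interlacing_inj_on(2), of h \<alpha> \<beta> i j] inj_onD[OF interlacing_inj_on(1), of h \<alpha> \<beta> i j]
      bd that by (auto simp: branch_data_def h_def)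
  have detV: "pdet n V (pencil (lp k) N) = 0" if k: "k < h" for k
  proof -
    have "(\<Prod>j\<in>{..<h} - {k}. \<beta> k - \<beta> j) \<noteq> 0" using sq_inj k by auto
    moreover have "ev (lp k) \<noteq> 0" using lp_pos[OF k] by (simp add: ev_def)
    ultimately have "Re (pdet n V (pencil (lp k) N)) = 0"
      using F[of k] k by (simp add: F_def N_def)
    then show ?thesis using real[of V "lp k"] by simp
  qed
  \<comment> \<open>The excluded node is the zero eigenvalue in odd order \<open>n - 1\<close>,
    which skew-symmetry provides.\<close>
  have detVv: "pdet n (V - {v}) (pencil (mp k) N) = 0" if k: "k < h" "\<not> (even n \<and> k = 0)" for k
  proof -
    have "(\<Prod>j\<in>{..<h} - {k}. \<alpha> k - \<alpha> j) \<noteq> 0" using sq_inj k by auto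
    moreover have "ev (mp k) \<noteq> 0" using mp_pos[OF k] by (simp add: ev_def)
    ultimately have "Re (pdet n (V - {v}) (pencil (mp k) N)) = 0"
      using F[of "h + k"] k by (auto simp: F_def N_def)
    then show ?thesis using real[of "V - {v}" "mp k"] by simp
  qed
  define R where "R = Matrix.mat n n (\<lambda>(i, j). N i j)"
  have Rc: "R \<in> carrier_mat n n" by (simp add: R_def)
  have Rskew: "skew_symmetric R"
  proof -
    have "transpose_mat R = - R"
    proof (rule eq_matI)
      fix i j assume "i < dim_row (- R)" "j < dim_col (- R)"
      then show "transpose_mat R $$ (i, j) = (- R) $$ (i, j)" using Nskew[of j i] by (simp add: R_def)
    qed (simp_all add: R_def)
    then show ?thesis by (simp add: skew_symmetric_def R_def)
  qed
  \<comment> \<open>Tree arcs carry a nonzero entry of \<open>A\<close> and none of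
    \<open>E\<close>, the other arcs of \<open>G\<close> the reverse, so \<open>e > 0\<close> gives
    exactly the arcs of \<open>G\<close>.\<close>
  have supp: "N i j \<noteq> 0 \<longleftrightarrow> (i, j) \<in> parcs G" for i j
    using realizesD(3)[OF A s, of i j] e Tsub unfolding N_def M_def E_def adjT by auto
  have supp0: "N i j = 0 \<longleftrightarrow> (i, j) \<notin> parcs G" for i j using supp[of i j] by blast
  have "mat_graph R = G"
  proof (rule pair_pre_digraph.equality)
    show "pverts (mat_graph R) = pverts G" using assms(3) by (simp add: mat_graph_def R_def)
    have "i < n \<and> j < n" if "(i, j) \<in> parcs G" for i j
      using G.in_arcsD1[OF that] G.in_arcsD2[OF that] assms(3) by auto
    then show "parcs (mat_graph R) = parcs G" by (auto simp: mat_graph_def R_def supp0)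
  qed simp
  then have "R \<in> S_minus G" using Rskew by (simp add: S_minus_def)
  moreover have "complex_eigenvalues R = (\<lambda>j. \<i> * complex_of_real (lam j)) ` {1..n}"
  proof (rule complex_eigenvalues_skew_eq[OF Rc Rskew])
    show "lam j < lam k" if "1 \<le> j" "j < k" "k \<le> n" for j k
      using that(2,3)
    proof (induction k)
      case (Suc k)
      then have "1 \<le> k" "k \<le> n - 1" using that(1) by auto
      then show ?case using lm[of k] Suc by (cases "j = k") auto
    qed simp
    show "lam j = - lam (n + 1 - j)" if "1 \<le> j" "j \<le> n" for j by (rule lam_sym[OF that])
    show "\<i> * of_real (lam (n - n div 2 + k + 1)) \<in> complex_eigenvalues R" if "k < n div 2" for k
      unfolding mem_complex_eigenvalues_iff[OF Rc]
      using detV[of k] that det_pencil_mat_eq_pdet(1)[of n N] by (simp add: R_def V_def lp_def h_def)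
  qed
  moreover have "complex_eigenvalues (mat_delete R v v) = (\<lambda>k. \<i> * complex_of_real (mu k)) ` {1..n - 1}"
  proof (rule complex_eigenvalues_skew_eq)
    show Rd: "mat_delete R v v \<in> carrier_mat (n - 1) (n - 1)" using Rc by (simp add: mat_delete_def)
    show "skew_symmetric (mat_delete R v v)" by (rule skew_symmetric_mat_delete[OF Rc Rskew v])
    show "mu j < mu k" if "1 \<le> j" "j < k" "k \<le> n - 1" for j k
      using that(2,3)
    proof (induction k)
      case (Suc k)
      then have "1 \<le> k" "k + 1 \<le> n - 1" using that(1) by auto
      then show ?case using lm(2)[of k] lm(1)[of "k + 1"] Suc by (cases "j = k") auto
    qed simp
    show "mu j = - mu (n - 1 + 1 - j)" if "1 \<le> j" "j \<le> n - 1" for j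
      using mu_sym[OF that] assms(1) by simp
    fix k assume k: "k < (n - 1) div 2"
    \<comment> \<open>The positive nodes of the matrix of order \<open>n - 1\<close> start at
      \<open>mp 1\<close> for even \<open>n\<close>, after the middle zero, and at
      \<open>mp 0\<close> for odd \<open>n\<close>.\<close>
    obtain l where l: "l < h" "\<not> (even n \<and> l = 0)" "n - 1 - (n - 1) div 2 + k + 1 = n - h + l"
    proof (cases "even n")
      case True
      then show thesis using that[of "k + 1"] k by (auto simp: h_def elim!: evenE)
    next
      case False
      then show thesis using that[of k] k by (auto simp: h_def elim!: oddE)
    qed
    show "\<i> * of_real (mu (n - 1 - (n - 1) div 2 + k + 1)) \<in> complex_eigenvalues (mat_delete R v v)"
      unfolding mem_complex_eigenvalues_iff[OF Rd] l(3)
      using detVv[OF l(1,2)] det_pencil_mat_eq_pdet(2)[OF v, of N] by (simp add: R_def V_def mp_def)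
  qed
  ultimately show ?thesis by blast
qed

end
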